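(* Let $\Psi=\{\Omega_1,\dots,\Omega_L\}$ be a domain hierarchy on $\Omega=(0,1)^n$ whose refinement domains $\Omega_{\ell+1}$ are unions of closures of level-$\ell$ $\vec p$-boxes (i.e. $\vec q$-boxes with $\vec q=\vec p$, the spline degree, all $p^i\ge 1$), and let $\mathcal N_\Psi^{\vec p}$ be the associated $\vec p$-box mesh and $\mathcal T_\Psi$ the THB-spline basis of degree $\vec p$. Then neither the well-behaved $\vec p$-boxes nor the regular $\vec p$-boxes are overloaded with respect to $\mathcal T_\Psi$; that is, for every well-behaved or regular $\vec p$-box $E$, the set $\{T|_{\Omega^E} : T\in\mathcal T_\Psi,\ T|_{\Omega^E}\neq 0\}$ is linearly independent.
   Context: **B-splines.** $\mathbb N=\{0,1,2,\dots\}$, $\mathbb N_+=\mathbb N\setminus\{0\}$, $\Omega=(0,1)^n$. Fix a degree $\vec p=(p^1,\dots,p^n)\in\mathbb N^n$ and interior knot multiplicities $\vec m$ with $1\le m^i\le p^i+1$, the same at all levels. For levels $\ell=1,\dots,L$ and directions $i=1,\dots,n$ there is a breakpoint sequence $0=\hat\xi^i_{0,\ell}<\hat\xi^i_{1,\ell}<\dots<1$; for $\ell>1$ the level-$\ell$ sequence is obtained from the level-$(\ell-1)$ one by bisecting every interval; ratios of neighbouring interval lengths lie in $[\eta^{-1},\eta]$ for a fixed $\eta\ge1$. The knot vector in direction $i$ repeats $0$ and $1$ each $p^i+1$ times and each interior breakpoint $m^i$ times. $B_{\vec j,\ell}$ are the corresponding tensor-product B-splines of degree $\vec p$, $\mathcal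 B_\ell$ is their set, $\mathbb B_\ell=\mathrm{span}\,\mathcal B_\ell$; thus $\mathbb B_1\subset\dots\subset\mathbb B_L$. Supports are regarded as open sets. Level-$\ell$ mesh elements are the open boxes $\Omega^{\vec e_\ell}=\prod_i(\hat\xi^i_{e^i,\ell},\hat\xi^i_{e^i+1,\ell})$. **Hierarchy and THB-splines.** A domain hierarchy is $\Psi=\{\Omega_1,\dots,\Omega_L\}$ with closed sets $\Omega_L\subseteq\dots\subseteq\Omega_1=\overline\Omega$ (and $\Omega_{L+1}=\emptyset$). Put $\mathcal B_\ell^{\mathrm{in},k}=\{B\in\mathcal B_\ell:\mathrm{supp}\,B\subseteq\Omega_k\}$ and $\mathcal B_\ell^{\mathrm{ex},k}=\mathcal B_\ell\setminus\mathcal B_\ell^{\mathrm{in},k}$. For $f=\sum_{\vec j}\tau_{\vec j}B_{\vec j,\ell}\in\mathbb B_\ell$, $\mathrm{trunc}_\ell(f)=\sum_{\vec j:B_{\vec j,\ell}\in\mathcal B_\ell^{\mathrm{ex},\ell}}\tau_{\vec j}B_{\vec j,\ell}$. The THB-spline basis $\mathcal T_\Psi=\mathcal T_L$ is defined by $\mathcal T_1=\mathcal B_1$ and $\mathcal T_\ell=\{\mathrm{trunc}_\ell(T):T\in\mathcal T_{\ell-1},\ \mathrm{supp}\,T\nsubseteq\Omega_\ell\}\cup\mathcal B_\ell^{\mathrm{in},\ell}$ for $\ell=2,\dots,L$. **$\vec q$-boxes.** Let $\vec q\in\mathbb N_+^n$ and assume the number of level-$\ell$ intervals in direction $i$ is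 $q^iR^i_\ell$ with $R^i_\ell\in\mathbb N_+$. For $0\le r^i\le R^i_\ell-1$, the level-$\ell$ $\vec q$-box $E_{\vec r,\ell}$ is the set of level-$\ell$ elements contained in $\Omega^{E_{\vec r,\ell}}=\prod_i(\hat\xi^i_{r^iq^i,\ell},\hat\xi^i_{(r^i+1)q^i,\ell})$. Each $\Omega_{\ell+1}$ is a union of closures of regions $\Omega^{E}$ of level-$\ell$ $\vec q$-boxes $E$. A level-$\ell$ $\vec q$-box $E$ is active if $\Omega^E\subset\Omega_\ell$ and $\Omega^E\not\subset\Omega_{\ell+1}$; the $\vec q$-box mesh $\mathcal N_\Psi^{\vec q}$ is the set of all active $\vec q$-boxes of all levels. For $\ell>1$, a level-$\ell$ $\vec q$-box $E$ with $\Omega^E\subset\Omega_\ell$ is a border $\vec q$-box if $\partial\Omega^E\cap(\partial\Omega_\ell\setminus\partial\Omega)\ne\emptyset$. Recursively in the level, a border $\vec q$-box of level $\ell$ is well-behaved if it is not contained in any well-behaved $\vec q$-box of levels $2,\dots,\ell-1$. An active $\vec q$-box not contained in any well-behaved $\vec q$-box is called regular. *)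

theory Defs
  imports "HOL-Analysis.Analysis" "HOL-Library.Function_Algebras"
begin

text \<open>
  Real functions form a real vector space pointwise, so that \<^const>\<open>span\<close>, \<^const>\<open>independent\<close> and
  \<^const>\<open>representation\<close> from the library apply to splines.
\<close>

instantiation "fun" :: (type, real_vector) real_vector
begin

definition scaleR_fun :: "real \<Rightarrow> ('a \<Rightarrow> 'b) \<Rightarrow> 'a \<Rightarrow> 'b"
  where "scaleR_fun c f = (\<lambda>x. c *\<^sub>R f x)"

instance
  by standard (simp_all add: scaleR_fun_def fun_eq_iff scaleR_add_right scaleR_add_left)

end


section \<open>Univariate B-splines\<close>

text \<open>
  Knot vector of degree \<open>d\<close> and interior multiplicity \<open>\<mu>\<close> on the breakpoints \<open>z 0 < \<dots> < z N\<close>.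
\<close>

definition knots :: "nat \<Rightarrow> nat \<Rightarrow> nat \<Rightarrow> (nat \<Rightarrow> real) \<Rightarrow> real list"
  where "knots d \<mu> N z =
    replicate (d + 1) (z 0) @ concat (map (\<lambda>k. replicate \<mu> (z k)) [1..<N]) @ replicate (d + 1) (z N)"

text \<open>
  Cox-de Boor recursion; the usual convention \<open>0/0 = 0\<close> is the library's \<open>x / 0 = 0\<close>.  Knot spans
  are half-open, so splines are right-continuous and vanish at the last knot; this only concerns
  points outside the open domain \<open>(0,1)\<^sup>n\<close>.
\<close>

fun bspline :: "real list \<Rightarrow> nat \<Rightarrow> nat \<Rightarrow> real \<Rightarrow> real" where
  "bspline t 0 j x = (if t ! j \<le> x \<and> x < t ! (j + 1) then 1 else 0)"
| "bspline t (Suc d) j x =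
     (x - t ! j) / (t ! (j + d + 1) - t ! j) * bspline t d j x
   + (t ! (j + d + 2) - x) / (t ! (j + d + 2) - t ! (j + 1)) * bspline t d (j + 1) x"


section \<open>Hierarchy of tensor-product spline spaces\<close>

text \<open>
  The type variable \<open>'n\<close> indexes the \<open>n\<close> coordinate directions.  Levels run from \<open>1\<close> to \<open>depth\<close>;
  on level \<open>l\<close>, direction \<open>i\<close> has \<open>nint l i\<close> intervals with breakpoints \<open>brk l i 0\<close>, \<open>\<dots>\<close>,
  \<open>brk l i (nint l i)\<close>.
\<close>

record 'n spline_data =
  depth :: nat
  deg :: "'n \<Rightarrow> nat"
  kmult :: "'n \<Rightarrow> nat"
  nint :: "nat \<Rightarrow> 'n \<Rightarrow> nat"
  brk :: "nat \<Rightarrow> 'n \<Rightarrow> nat \<Rightarrow> real"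

definition spline_hierarchy :: "real \<Rightarrow> 'n spline_data \<Rightarrow> bool"
  where "spline_hierarchy \<eta> S \<longleftrightarrow>
    1 \<le> depth S \<and> 1 \<le> \<eta> \<and>
    (\<forall>i. 1 \<le> kmult S i \<and> kmult S i \<le> deg S i + 1) \<and>
    (\<forall>l\<in>{1..depth S}. \<forall>i.
       0 < nint S l i \<and> brk S l i 0 = 0 \<and> brk S l i (nint S l i) = 1 \<and>
       (\<forall>k < nint S l i. brk S l i k < brk S l i (k + 1)) \<and>
       (\<forall>k. k + 1 < nint S l i \<longrightarrow>
          (brk S l i (k + 2) - brk S l i (k + 1)) / (brk S l i (k + 1) - brk S l i k)
            \<in> {inverse \<eta>..\<eta>})) \<and>
    (\<forall>l\<in>{1..<depth S}. \<forall>i.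
       nint S (l + 1) i = 2 * nint S l i \<and>
       (\<forall>k \<le> nint S l i. brk S (l + 1) i (2 * k) = brk S l i k) \<and>
       (\<forall>k < nint S l i. brk S (l + 1) i (2 * k + 1) = (brk S l i k + brk S l i (k + 1)) / 2))"

definition level_knots :: "'n spline_data \<Rightarrow> nat \<Rightarrow> 'n \<Rightarrow> real list"
  where "level_knots S l i = knots (deg S i) (kmult S i) (nint S l i) (brk S l i)"

definition tensor_bspline ::
    "'n::finite spline_data \<Rightarrow> nat \<Rightarrow> ('n \<Rightarrow> nat) \<Rightarrow> real ^ 'n \<Rightarrow> real"
  where "tensor_bspline S l j = (\<lambda>x. \<Prod>i\<in>UNIV. bspline (level_knots S l i) (deg S i) (j i) (x $ i))"

definition bsplines :: "'n::finite spline_data \<Rightarrow> nat \<Rightarrow> (real ^ 'n \<Rightarrow> real) set"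
  where "bsplines S l =
    tensor_bspline S l ` {j. \<forall>i. j i < length (level_knots S l i) - (deg S i + 1)}"

text \<open>
  Supports are open sets: the interior of the usual (closed) support.
\<close>

definition supp :: "('a::topological_space \<Rightarrow> real) \<Rightarrow> 'a set"
  where "supp f = interior (closure {x. f x \<noteq> 0})"


section \<open>Domain hierarchies and THB-splines\<close>

definition unit_cube :: "(real ^ 'n::finite) set"
  where "unit_cube = box 0 1"

text \<open>
  \<open>\<Psi> l\<close> is the domain \<open>\<Omega>\<^sub>l\<close>.
\<close>

definition domain_hierarchy :: "'n::finite spline_data \<Rightarrow> (nat \<Rightarrow> (real ^ 'n) set) \<Rightarrow> bool"
  where "domain_hierarchy S \<Psi> \<longleftrightarrow>
    \<Psi> 1 = closure unit_cube \<and> \<Psi> (depth S + 1) = {} \<and>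
    (\<forall>l\<in>{1..depth S}. closed (\<Psi> l)) \<and>
    (\<forall>l\<in>{1..<depth S}. \<Psi> (l + 1) \<subseteq> \<Psi> l)"

definition bsplines_in ::
    "'n::finite spline_data \<Rightarrow> (nat \<Rightarrow> (real ^ 'n) set) \<Rightarrow> nat \<Rightarrow> nat \<Rightarrow> (real ^ 'n \<Rightarrow> real) set"
  where "bsplines_in S \<Psi> l k = {B \<in> bsplines S l. supp B \<subseteq> \<Psi> k}"

definition bsplines_ex ::
    "'n::finite spline_data \<Rightarrow> (nat \<Rightarrow> (real ^ 'n) set) \<Rightarrow> nat \<Rightarrow> nat \<Rightarrow> (real ^ 'n \<Rightarrow> real) set"
  where "bsplines_ex S \<Psi> l k = bsplines S l - bsplines_in S \<Psi> l k"

text \<open>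
  \<open>representation (bsplines S l) f B\<close> is the coefficient of \<open>B\<close> in the expansion of
  \<open>f \<in> span (bsplines S l)\<close> (a junk value is returned for other \<open>f\<close>).
\<close>

definition trunc ::
    "'n::finite spline_data \<Rightarrow> (nat \<Rightarrow> (real ^ 'n) set) \<Rightarrow> nat \<Rightarrow> (real ^ 'n \<Rightarrow> real) \<Rightarrow> real ^ 'n \<Rightarrow> real"
  where "trunc S \<Psi> l f = (\<Sum>B\<in>bsplines_ex S \<Psi> l l. representation (bsplines S l) f B *\<^sub>R B)"

fun thb_upto ::
    "'n::finite spline_data \<Rightarrow> (nat \<Rightarrow> (real ^ 'n) set) \<Rightarrow> nat \<Rightarrow> (real ^ 'n \<Rightarrow> real) set"
  where
  "thb_upto S \<Psi> 0 = {}"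
| "thb_upto S \<Psi> (Suc 0) = bsplines S 1"
| "thb_upto S \<Psi> (Suc (Suc l)) =
     trunc S \<Psi> (Suc (Suc l)) ` {T \<in> thb_upto S \<Psi> (Suc l). \<not> supp T \<subseteq> \<Psi> (Suc (Suc l))}
     \<union> bsplines_in S \<Psi> (Suc (Suc l)) (Suc (Suc l))"

definition thb :: "'n::finite spline_data \<Rightarrow> (nat \<Rightarrow> (real ^ 'n) set) \<Rightarrow> (real ^ 'n \<Rightarrow> real) set"
  where "thb S \<Psi> = thb_upto S \<Psi> (depth S)"


section \<open>Boxes of \<open>q\<close> elements per direction\<close>

text \<open>
  A \<open>q\<close>-box is given by its level \<open>l\<close> and its index \<open>r\<close>; as a set of mesh elements it consists of
  the level-\<open>l\<close> elements contained in \<open>region S q l r\<close>.  Containment of boxes of different levels is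
  containment of regions.
\<close>

definition is_qbox :: "'n spline_data \<Rightarrow> ('n \<Rightarrow> nat) \<Rightarrow> nat \<Rightarrow> ('n \<Rightarrow> nat) \<Rightarrow> bool"
  where "is_qbox S q l r \<longleftrightarrow> l \<in> {1..depth S} \<and> (\<forall>i. r i < nint S l i div q i)"

definition region :: "'n::finite spline_data \<Rightarrow> ('n \<Rightarrow> nat) \<Rightarrow> nat \<Rightarrow> ('n \<Rightarrow> nat) \<Rightarrow> (real ^ 'n) set"
  where "region S q l r = box (\<chi> i. brk S l i (r i * q i)) (\<chi> i. brk S l i ((r i + 1) * q i))"

definition qbox_compatible ::
    "'n::finite spline_data \<Rightarrow> ('n \<Rightarrow> nat) \<Rightarrow> (nat \<Rightarrow> (real ^ 'n) set) \<Rightarrow> bool"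
  where "qbox_compatible S q \<Psi> \<longleftrightarrow>
    (\<forall>i. 1 \<le> q i) \<and>
    (\<forall>l\<in>{1..depth S}. \<forall>i. \<exists>R\<ge>1. nint S l i = q i * R) \<and>
    (\<forall>l\<in>{1..<depth S}. \<exists>\<R> \<subseteq> {r. is_qbox S q l r}.
       \<Psi> (l + 1) = (\<Union>r\<in>\<R>. closure (region S q l r)))"

definition active ::
    "'n::finite spline_data \<Rightarrow> ('n \<Rightarrow> nat) \<Rightarrow> (nat \<Rightarrow> (real ^ 'n) set) \<Rightarrow> nat \<Rightarrow> ('n \<Rightarrow> nat) \<Rightarrow> bool"
  where "active S q \<Psi> l r \<longleftrightarrow>
    is_qbox S q l r \<and> region S q l r \<subseteq> \<Psi> l \<and> \<not> region S q l r \<subseteq> \<Psi> (l + 1)"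

definition border ::
    "'n::finite spline_data \<Rightarrow> ('n \<Rightarrow> nat) \<Rightarrow> (nat \<Rightarrow> (real ^ 'n) set) \<Rightarrow> nat \<Rightarrow> ('n \<Rightarrow> nat) \<Rightarrow> bool"
  where "border S q \<Psi> l r \<longleftrightarrow>
    is_qbox S q l r \<and> 1 < l \<and> region S q l r \<subseteq> \<Psi> l \<and>
    frontier (region S q l r) \<inter> (frontier (\<Psi> l) - frontier unit_cube) \<noteq> {}"

fun well_behaved ::
    "'n::finite spline_data \<Rightarrow> ('n \<Rightarrow> nat) \<Rightarrow> (nat \<Rightarrow> (real ^ 'n) set) \<Rightarrow> nat \<Rightarrow> ('n \<Rightarrow> nat) \<Rightarrow> bool"
  where "well_behaved S q \<Psi> l r \<longleftrightarrow>
    border S q \<Psi> l r \<and>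
    (\<forall>k\<in>{2..<l}. \<forall>s. well_behaved S q \<Psi> k s \<longrightarrow> \<not> region S q l r \<subseteq> region S q k s)"

declare well_behaved.simps [simp del]

definition regular ::
    "'n::finite spline_data \<Rightarrow> ('n \<Rightarrow> nat) \<Rightarrow> (nat \<Rightarrow> (real ^ 'n) set) \<Rightarrow> nat \<Rightarrow> ('n \<Rightarrow> nat) \<Rightarrow> bool"
  where "regular S q \<Psi> l r \<longleftrightarrow>
    active S q \<Psi> l r \<and>
    (\<forall>k s. well_behaved S q \<Psi> k s \<longrightarrow> \<not> region S q l r \<subseteq> region S q k s)"


section \<open>Overloading\<close>

text \<open>
  The restriction of \<open>f\<close> to \<open>A\<close>, represented by its extension by zero (rather than by
  \<^const>\<open>undefined\<close>, as with \<^const>\<open>restrict\<close>), which makes restriction a linear map.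
\<close>

definition restr :: "'a set \<Rightarrow> ('a \<Rightarrow> real) \<Rightarrow> 'a \<Rightarrow> real"
  where "restr A f = (\<lambda>x. if x \<in> A then f x else 0)"

definition nonvanishing :: "'a set \<Rightarrow> ('a \<Rightarrow> real) set \<Rightarrow> ('a \<Rightarrow> real) set"
  where "nonvanishing A F = {T \<in> F. restr A T \<noteq> 0}"

text \<open>
  The functions not vanishing on \<open>A\<close> are linearly dependent there as an indexed family; injectivity
  excludes that two distinct functions with the same restriction are counted as one.
\<close>

definition is_overloaded :: "'a set \<Rightarrow> ('a \<Rightarrow> real) set \<Rightarrow> bool"
  where "is_overloaded A F \<longleftrightarrow>
    \<not> (inj_on (restr A) (nonvanishing A F) \<and> independent (restr A ` nonvanishing A F))"

end

theory Submission
  imports Defs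
begin

text \<open>
  Let \<open>E\<close> be a box of level \<open>l\<close> and consider a combination of THB-splines that vanishes on \<open>E\<close>. Three
  ideas show that the coefficients of all THB-splines visible on \<open>E\<close> vanish.

  First, if a box of level \<open>k\<close> in \<open>\<Omega>\<^sub>k\<close> is not a border box (or \<open>k = 1\<close>), \<open>\<Omega>\<^sub>k\<close> contains its neighbours. As a
  spline touching a box of \<open>p\<close> elements per direction reaches no further than the neighbours, all
  B-splines of level \<open>k\<close> that are nonzero on the box are then supported in \<open>\<Omega>\<^sub>k\<close>. Truncation at level \<open>k\<close>
  therefore removes every THB-spline of a level below \<open>k\<close> from this box (\<open>nonborder_saturated\<close>,
  \<open>saturated_lower_levels\<close>). This applies to a regular box itself, and to the parent of a well-behaved
  box: otherwise they would lie inside a well-behaved box of the same or a coarser level.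

  Second, let \<open>F\<close> be a child of a box of level \<open>k\<close> inside \<open>\<Omega>\<^sub>k\<^sub>+\<^sub>1\<close>. The THB-splines of level \<open>k\<close> visible on
  \<open>F\<close> are truncated, but still independent modulo the span of all finer ones (\<open>corner\<close>). The reason is
  that a spline touching \<open>F\<close> can leave the parent only across the corner that \<open>F\<close> shares with it.
  Truncation keeps or removes components according to the set of directions in which they cross this
  corner, and the refinement matrix is block triangular with respect to these sets. Its diagonal blocks
  are tensor products of univariate blocks, which are injective (\<open>refinement_coeff_corner_indep\<close>).

  Third, the THB-splines of level at least \<open>k\<close> are independent on every box of level \<open>k\<close>
  (\<open>indep_from_level\<close>): on a box that is not refined they reduce to B-splines of level \<open>k\<close>, and on a
  refined box the second idea eliminates level \<open>k\<close> on each child before descending. For a regular box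
  this finishes the proof. For a well-behaved one, the second idea is used once more, on the parent.

  The univariate facts rest on the Marsden identity: it yields local linear independence of
  B-splines, and it identifies their span with that of the truncated powers, which makes refinement
  evident and shows that the splines around a breakpoint are determined by the finer splines around it
  (\<open>R_crossing_indep\<close>).
\<close>

section \<open>Linearly independent families of functions\<close>

lemma sum_fun_apply: "(\<Sum>i\<in>A. f i) x = (\<Sum>i\<in>A. f i x)"
  for f :: "'b \<Rightarrow> 'a \<Rightarrow> real"
  by (induction A rule: infinite_finite_induct) (simp_all add: zero_fun_def plus_fun_def)

lemma scaleR_fun_apply: "(c *\<^sub>R f) x = c * f x" for f :: "'a \<Rightarrow> real"
  by (simp add: scaleR_fun_def)

definition indep_family :: "'x set \<Rightarrow> 'j set \<Rightarrow> ('j \<Rightarrow> 'x \<Rightarrow> real) \<Rightarrow> bool"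
  where "indep_family X J f \<longleftrightarrow>
    (\<forall>c. (\<forall>x\<in>X. (\<Sum>j\<in>J. c j * f j x) = 0) \<longrightarrow> (\<forall>j\<in>J. c j = 0))"

lemma indep_familyI:
  assumes "\<And>c j. \<lbrakk>\<And>x. x \<in> X \<Longrightarrow> (\<Sum>j\<in>J. c j * f j x) = 0; j \<in> J\<rbrakk> \<Longrightarrow> c j = 0"
  shows "indep_family X J f"
  using assms unfolding indep_family_def by blast

lemma indep_familyD:
  assumes "indep_family X J f" "\<And>x. x \<in> X \<Longrightarrow> (\<Sum>j\<in>J. c j * f j x) = 0" "j \<in> J"
  shows "c j = 0"
  using assms unfolding indep_family_def by blast

lemma indep_family_mono:
  assumes "indep_family X J f" "X \<subseteq> Y" "J' \<subseteq> J" "finite J"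
  shows "indep_family Y J' f"
proof (rule indep_familyI)
  fix c j
  assume c: "\<And>x. x \<in> Y \<Longrightarrow> (\<Sum>j\<in>J'. c j * f j x) = 0" and j: "j \<in> J'"
  define c' where "c' = (\<lambda>j. if j \<in> J' then c j else 0)"
  have "(\<Sum>j\<in>J. c' j * f j x) = 0" if "x \<in> X" for x
  proof -
    have "(\<Sum>j\<in>J. c' j * f j x) = (\<Sum>j\<in>J'. c' j * f j x)"
      using assms by (intro sum.mono_neutral_right) (auto simp: c'_def)
    also have "\<dots> = (\<Sum>j\<in>J'. c j * f j x)"
      by (simp add: c'_def)
    finally show ?thesis using c that assms by auto
  qed
  from indep_familyD[OF assms(1) this, of j] j assms show "c j = 0"
    by (auto simp: c'_def)
qed

text \<open>
  Indexed families make two members with equal restrictions count as dependent, so independence of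
  the family bundles the two conditions whose failure is \<^const>\<open>is_overloaded\<close>.
\<close>

lemma indep_family_iff:
  assumes "finite J"
  shows "indep_family X J f \<longleftrightarrow>
    inj_on (\<lambda>j. restr X (f j)) J \<and> independent ((\<lambda>j. restr X (f j)) ` J)"
proof
  assume ind: "indep_family X J f"
  have inj: "inj_on (\<lambda>j. restr X (f j)) J"
  proof (rule inj_onI, rule ccontr)
    fix a b assume ab: "a \<in> J" "b \<in> J" "restr X (f a) = restr X (f b)" "a \<noteq> b"
    define c where "c = (\<lambda>j. (if j = a then 1 else 0) - (if j = b then 1 else (0::real)))"
    have "(\<Sum>j\<in>J. c j * f j x) = 0" if "x \<in> X" for x
    proof -
      have "f a x = f b x"
        using fun_cong[OF ab(3), of x] that by (simp add: restr_def)
      then show ?thesis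
        using assms ab by (simp add: c_def left_diff_distrib sum_subtractf if_distrib[of "\<lambda>y. y * _"] cong: if_cong)
    qed
    from indep_familyD[OF ind this ab(1)] ab(4) show False by (simp add: c_def)
  qed
  have "independent ((\<lambda>j. restr X (f j)) ` J)"
  proof (rule real_vector.independent_if_scalars_zero)
    show "finite ((\<lambda>j. restr X (f j)) ` J)" using assms by simp
  next
    fix u v
    assume s: "(\<Sum>v\<in>(\<lambda>j. restr X (f j)) ` J. u v *\<^sub>R v) = 0" and v: "v \<in> (\<lambda>j. restr X (f j)) ` J"
    from v obtain j where j: "j \<in> J" "v = restr X (f j)" by auto
    have "(\<Sum>j\<in>J. u (restr X (f j)) * f j x) = 0" if "x \<in> X" for x
    proof -
      have "(\<Sum>j\<in>J. u (restr X (f j)) *\<^sub>R restr X (f j)) = 0"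
        using s by (simp add: sum.reindex[OF inj] o_def)
      from fun_cong[OF this, of x] that show ?thesis
        by (simp add: sum_fun_apply scaleR_fun_apply restr_def)
    qed
    from indep_familyD[OF ind this j(1)] j(2) show "u v = 0" by simp
  qed
  with inj show "inj_on (\<lambda>j. restr X (f j)) J \<and> independent ((\<lambda>j. restr X (f j)) ` J)" ..
next
  assume a: "inj_on (\<lambda>j. restr X (f j)) J \<and> independent ((\<lambda>j. restr X (f j)) ` J)"
  then have inj: "inj_on (\<lambda>j. restr X (f j)) J" ..
  show "indep_family X J f"
  proof (rule indep_familyI)
    fix c j
    assume c: "\<And>x. x \<in> X \<Longrightarrow> (\<Sum>j\<in>J. c j * f j x) = 0" and j: "j \<in> J"
    let ?g = "\<lambda>j. restr X (f j)"
    have "(\<Sum>v\<in>?g ` J. c (the_inv_into J ?g v) *\<^sub>R v) = (\<Sum>j\<in>J. c j *\<^sub>R ?g j)"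
      by (simp add: sum.reindex[OF inj] o_def the_inv_into_f_f[OF inj])
    also have "\<dots> = 0"
    proof
      fix x show "(\<Sum>j\<in>J. c j *\<^sub>R ?g j) x = 0 x"
        using c[of x] by (cases "x \<in> X") (simp_all add: sum_fun_apply scaleR_fun_apply restr_def)
    qed
    finally have "(\<Sum>v\<in>?g ` J. c (the_inv_into J ?g v) *\<^sub>R v) = 0" .
    from real_vector.independentD[OF conjunct2[OF a] _ order_refl this, of "?g j"] assms j
    show "c j = 0" by (simp add: the_inv_into_f_f[OF inj])
  qed
qed

text \<open>
  The Steinitz exchange lemma for families: if an independent family of at least as many functions is
  expressed through \<open>f\<close>, then \<open>f\<close> is independent too and spans nothing more.
\<close>

lemma indep_family_exchange:
  assumes fin: "finite J" "finite I" and card: "card J \<le> card I"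
    and ind: "indep_family X I g"
    and gen: "\<And>i x. i \<in> I \<Longrightarrow> x \<in> X \<Longrightarrow> g i x = (\<Sum>j\<in>J. M i j * f j x)"
  shows "indep_family X J f"
    and "\<exists>K. \<forall>j\<in>J. \<forall>x\<in>X. f j x = (\<Sum>i\<in>I. K j i * g i x)"
proof -
  let ?f = "\<lambda>j. restr X (f j)" and ?g = "\<lambda>i. restr X (g i)"
  have inj_g: "inj_on ?g I" and ind_g: "independent (?g ` I)"
    using ind indep_family_iff[OF fin(2)] by blast+
  have g_eq: "?g i = (\<Sum>j\<in>J. M i j *\<^sub>R ?f j)" if "i \<in> I" for i
    using gen[OF that] by (auto simp: fun_eq_iff sum_fun_apply scaleR_fun_apply restr_def)
  have sub: "?g ` I \<subseteq> span (?f ` J)"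
    by (auto simp: g_eq intro!: span_sum span_scale intro: span_base)
  have cg: "card (?g ` I) = card I" using inj_g by (rule card_image)
  have "card (?g ` I) \<le> card (?f ` J)"
    using real_vector.independent_span_bound[OF _ ind_g sub] fin by simp
  moreover have "card (?f ` J) \<le> card J" using fin by (intro card_image_le)
  ultimately have cf: "card (?f ` J) = card J" "card (?f ` J) = card (?g ` I)" using card cg by linarith+
  have inj_f: "inj_on ?f J" using cf(1) fin eq_card_imp_inj_on by blast
  have ind_f: "independent (?f ` J)"
  proof (rule ccontr)
    assume "\<not> independent (?f ` J)"
    then obtain a where a: "a \<in> ?f ` J" "a \<in> span (?f ` J - {a})"
      unfolding dependent_def by blast
    have "span (?f ` J) = span (?f ` J - {a})"
      using a by (metis insert_Diff real_vector.span_redundant)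
    then have "card (?g ` I) \<le> card (?f ` J - {a})"
      using real_vector.independent_span_bound[OF _ ind_g, of "?f ` J - {a}"] sub fin by simp
    also have "\<dots> < card (?f ` J)" using a fin by (intro psubset_card_mono) auto
    finally show False using cf(2) by simp
  qed
  show "indep_family X J f" using indep_family_iff[OF fin(1)] inj_f ind_f by blast
  have sp: "?f j \<in> span (?g ` I)" if j: "j \<in> J" for j
  proof (rule ccontr)
    assume n: "?f j \<notin> span (?g ` I)"
    then have "independent (insert (?f j) (?g ` I))"
      using ind_g by (rule real_vector.independent_insertI)
    moreover have "insert (?f j) (?g ` I) \<subseteq> span (?f ` J)"
      using sub j by (auto intro: span_base)
    ultimately have "card (insert (?f j) (?g ` I)) \<le> card (?f ` J)"
      using real_vector.independent_span_bound[of "?f ` J"] fin by blast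
    moreover have "?f j \<notin> ?g ` I" using n by (meson real_vector.span_base)
    ultimately show False using cf(2) fin by simp
  qed
  have "\<exists>k. \<forall>x\<in>X. f j x = (\<Sum>i\<in>I. k i * g i x)" if "j \<in> J" for j
  proof -
    from sp[OF that] obtain u where u: "?f j = (\<Sum>v\<in>?g ` I. u v *\<^sub>R v)"
      using fin by (auto simp: real_vector.span_finite)
    have "\<forall>x\<in>X. f j x = (\<Sum>i\<in>I. u (?g i) * g i x)"
    proof
      fix x assume "x \<in> X"
      then show "f j x = (\<Sum>i\<in>I. u (?g i) * g i x)"
        using fun_cong[OF u, of x] unfolding sum.reindex[OF inj_g] o_def sum_fun_apply scaleR_fun_apply
        by (simp add: restr_def)
    qed
    then show ?thesis by (intro exI)
  qed
  then show "\<exists>K. \<forall>j\<in>J. \<forall>x\<in>X. f j x = (\<Sum>i\<in>I. K j i * g i x)" by metis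
qed

text \<open>
  Dual functionals of an independent family can be taken to be finite combinations of point
  evaluations; by induction, the new functional evaluates at a point where the residual of the new
  function does not vanish. Point evaluations are convenient because they multiply under tensor
  products.
\<close>

lemma indep_family_dual_weights:
  assumes "finite J" "indep_family X J f"
  shows "\<exists>Y w. finite Y \<and> Y \<subseteq> X \<and>
    (\<forall>i\<in>J. \<forall>j\<in>J. (\<Sum>x\<in>Y. w i x * f j x) = (if i = j then 1 else 0))"
  using assms
proof (induction J)
  case empty
  then show ?case by auto
next
  case (insert a J)
  have "indep_family X J f"
    by (rule indep_family_mono[OF insert.prems]) (use insert in auto)
  with insert.IH obtain Y w where Y: "finite Y" "Y \<subseteq> X"
    and w: "\<And>i j. i \<in> J \<Longrightarrow> j \<in> J \<Longrightarrow> (\<Sum>x\<in>Y. w i x * f j x) = (if i = j then 1 else 0)"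
    by blast
  \<comment> \<open>The functionals found so far, and the residual \<open>r\<close> of \<open>f a\<close> that they leave.\<close>
  define p where "p i g = (\<Sum>x\<in>Y. w i x * g x)" for i and g :: "'b \<Rightarrow> real"
  define r where "r x = f a x - (\<Sum>i\<in>J. p i (f a) * f i x)" for x
  obtain x0 where x0: "x0 \<in> X" "r x0 \<noteq> 0"
  proof -
    have False if z: "\<forall>x\<in>X. r x = 0"
    proof -
      define c where "c i = (if i = a then 1 else - p i (f a))" for i
      have "(\<Sum>i\<in>insert a J. c i * f i x) = 0" if "x \<in> X" for x
      proof -
        have "(\<Sum>i\<in>J. c i * f i x) = - (\<Sum>i\<in>J. p i (f a) * f i x)"
          unfolding sum_negf[symmetric] using insert.hyps by (intro sum.cong) (auto simp: c_def)
        then show ?thesis using z that insert.hyps by (auto simp: r_def c_def)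
      qed
      from indep_familyD[OF insert.prems this, of a] show False by (simp add: c_def)
    qed
    then show thesis using that by blast
  qed
  define Z where "Z = insert x0 Y"
  define w0 where "w0 i x = (if x \<in> Y then w i x else 0)" for i x
  define v where "v x = ((if x = x0 then 1 else 0) - (\<Sum>i\<in>J. f i x0 * w0 i x)) / r x0" for x
  define u where "u i x = (if i = a then v x else w0 i x - p i (f a) * v x)" for i x
  have finZ: "finite Z" using Y by (simp add: Z_def)
  have w0: "(\<Sum>x\<in>Z. w0 i x * g x) = p i g" for i and g :: "'b \<Rightarrow> real"
    unfolding p_def using Y by (intro sum.mono_neutral_cong_right) (auto simp: Z_def w0_def)
  have v: "(\<Sum>x\<in>Z. v x * g x) = (g x0 - (\<Sum>i\<in>J. f i x0 * p i g)) / r x0" for g :: "'b \<Rightarrow> real"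
  proof -
    have "(\<Sum>x\<in>Z. v x * g x) =
        ((\<Sum>x\<in>Z. (if x = x0 then 1 else 0) * g x) - (\<Sum>x\<in>Z. \<Sum>i\<in>J. f i x0 * (w0 i x * g x))) / r x0"
      unfolding sum_divide_distrib sum_subtractf[symmetric]
      by (intro sum.cong) (auto simp: v_def field_simps sum_distrib_left)
    also have "(\<Sum>x\<in>Z. \<Sum>i\<in>J. f i x0 * (w0 i x * g x)) = (\<Sum>i\<in>J. f i x0 * p i g)"
      by (subst sum.swap) (simp add: sum_distrib_left[symmetric] w0)
    also have "(\<Sum>x\<in>Z. (if x = x0 then 1 else 0) * g x) = g x0"
      using finZ by (simp add: Z_def if_distrib[of "\<lambda>y. y * _"] cong: if_cong)
    finally show ?thesis .
  qed
  have pw: "p i (f j) = (if i = j then 1 else 0)" if "i \<in> J" "j \<in> J" for i j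
    using w[OF that] by (simp add: p_def)
  have v_J: "(\<Sum>x\<in>Z. v x * f j x) = 0" if "j \<in> J" for j
    using that insert.hyps by (simp add: v pw if_distrib[of "\<lambda>y. _ * y"] cong: if_cong)
  have v_a: "(\<Sum>x\<in>Z. v x * f a x) = 1"
    using x0(2) by (simp add: v r_def mult.commute)
  have u: "(\<Sum>x\<in>Z. u i x * f j x) = (\<Sum>x\<in>Z. w0 i x * f j x) - p i (f a) * (\<Sum>x\<in>Z. v x * f j x)"
    if "i \<noteq> a" for i j
    unfolding sum_distrib_left sum_subtractf[symmetric] using that
    by (intro sum.cong) (auto simp: u_def algebra_simps)
  have "(\<Sum>x\<in>Z. u i x * f j x) = (if i = j then 1 else 0)" if "i \<in> insert a J" "j \<in> insert a J" for i j
  proof (cases "i = a")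
    case True
    then show ?thesis using that insert.hyps v_J v_a by (auto simp: u_def)
  next
    case False
    then show ?thesis using that insert.hyps by (auto simp: u w0 v_J v_a pw)
  qed
  moreover have "Z \<subseteq> X" using Y x0 by (auto simp: Z_def)
  ultimately show ?case using finZ by blast
qed

text \<open>
  The products of the dual point weights in the single directions are dual weights for the products
  of the functions. The lemma serves twice below: for splines at points of a box, and for refinement
  coefficients at multi-indices of finer splines.
\<close>

lemma indep_family_tensor:
  fixes f :: "'n::finite \<Rightarrow> 'j \<Rightarrow> 'x \<Rightarrow> real"
  assumes fin: "\<And>i. finite (J i)" and ind: "\<And>i. indep_family (X i) (J i) (f i)"
  shows "indep_family {x. \<forall>i. x i \<in> X i} {j. \<forall>i. j i \<in> J i} (\<lambda>j x. \<Prod>i\<in>UNIV. f i (j i) (x i))"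
proof (rule indep_familyI)
  fix c k
  assume c: "\<And>x. x \<in> {x. \<forall>i. x i \<in> X i} \<Longrightarrow>
      (\<Sum>j\<in>{j. \<forall>i. j i \<in> J i}. c j * (\<Prod>i\<in>UNIV. f i (j i) (x i))) = 0"
    and k: "k \<in> {j. \<forall>i. j i \<in> J i}"
  have "\<forall>i. \<exists>Y w. finite Y \<and> Y \<subseteq> X i \<and>
    (\<forall>a\<in>J i. \<forall>b\<in>J i. (\<Sum>x\<in>Y. w a x * f i b x) = (if a = b then 1 else 0))"
    using indep_family_dual_weights[OF fin ind] by blast
  then obtain Y w where Y: "\<And>i. finite (Y i)" "\<And>i. Y i \<subseteq> X i"
    and w: "\<And>i a b. a \<in> J i \<Longrightarrow> b \<in> J i \<Longrightarrow>
      (\<Sum>x\<in>Y i. w i a x * f i b x) = (if a = b then 1 else 0)"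
    by metis
  have J: "{j. \<forall>i. j i \<in> J i} = PiE UNIV J" by (auto simp: PiE_def)
  have finJ: "finite {j. \<forall>i. j i \<in> J i}" unfolding J using fin by (intro finite_PiE) auto
  have "0 = (\<Sum>x\<in>PiE UNIV Y. (\<Prod>i\<in>UNIV. w i (k i) (x i)) *
      (\<Sum>j\<in>{j. \<forall>i. j i \<in> J i}. c j * (\<Prod>i\<in>UNIV. f i (j i) (x i))))"
    by (rule sum.neutral[symmetric]) (use Y(2) in \<open>auto simp: c PiE_def Pi_def subset_iff\<close>)
  also have "\<dots> = (\<Sum>x\<in>PiE UNIV Y. \<Sum>j\<in>{j. \<forall>i. j i \<in> J i}.
      c j * (\<Prod>i\<in>UNIV. w i (k i) (x i) * f i (j i) (x i)))"
    by (simp add: sum_distrib_left prod.distrib algebra_simps)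
  also have "\<dots> = (\<Sum>j\<in>{j. \<forall>i. j i \<in> J i}. c j *
      (\<Sum>x\<in>PiE UNIV Y. \<Prod>i\<in>UNIV. w i (k i) (x i) * f i (j i) (x i)))"
    by (subst sum.swap) (simp add: sum_distrib_left)
  also have "\<dots> = (\<Sum>j\<in>{j. \<forall>i. j i \<in> J i}. c j *
      (\<Prod>i\<in>UNIV. \<Sum>x\<in>Y i. w i (k i) x * f i (j i) x))"
    using Y(1) by (simp add: prod_sum_PiE)
  also have "\<dots> = (\<Sum>j\<in>{j. \<forall>i. j i \<in> J i}. c j * (if j = k then 1 else 0))"
  proof (intro sum.cong refl arg_cong[where f="\<lambda>y. c _ * y"])
    fix j assume j: "j \<in> {j. \<forall>i. j i \<in> J i}"
    have "(\<Prod>i\<in>UNIV. \<Sum>x\<in>Y i. w i (k i) x * f i (j i) x) = (\<Prod>i\<in>UNIV. if k i = j i then 1 else 0)"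
      using j k by (intro prod.cong refl w) auto
    also have "\<dots> = (if j = k then 1 else 0)"
    proof (cases "k = j")
      case False
      then obtain i where "k i \<noteq> j i" by (meson ext)
      then have "(\<Prod>i\<in>UNIV. if k i = j i then 1 else 0 :: real) = 0"
        by (intro prod_zero) auto
      then show ?thesis using False by simp
    qed simp
    finally show "(\<Prod>i\<in>UNIV. \<Sum>x\<in>Y i. w i (k i) x * f i (j i) x) = (if j = k then 1 else 0)" .
  qed
  also have "\<dots> = (\<Sum>j\<in>{j. \<forall>i. j i \<in> J i}. if j = k then c j else 0)"
    by (intro sum.cong) auto
  also have "\<dots> = c k" using k by (subst sum.delta[OF finJ]) auto
  finally show "c k = 0" by simp
qed

section \<open>The Marsden identity\<close>

lemma div_nat_eq_range: "k * m \<le> n \<Longrightarrow> n < k * m + m \<Longrightarrow> n div m = k" for k m n :: nat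
  by (intro div_nat_eqI) (simp_all add: mult.commute)

lemma nth_concat_map_replicate:
  "i < n * m \<Longrightarrow> concat (map (\<lambda>k. replicate m (z k)) [a..<a + n]) ! i = z (a + i div m)"
proof (induction n)
  case (Suc n)
  have len: "length (concat (map (\<lambda>k. replicate m (z k)) [a..<a + n])) = n * m"
    by (induction n) auto
  show ?case
  proof (cases "i < n * m")
    case True
    then show ?thesis using Suc.IH by (simp add: nth_append len)
  next
    case False
    then have "i div m = n" using Suc.prems
      by (intro div_nat_eqI) (auto simp: algebra_simps)
    then show ?thesis using False Suc.prems by (simp add: nth_append len)
  qed
qed simp

lemma bspline_support:
  assumes "\<And>a b. a \<le> b \<Longrightarrow> b < length t \<Longrightarrow> t ! a \<le> t ! b"
    and "j + d + 1 < length t" and "bspline t d j x \<noteq> 0"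
  shows "t ! j \<le> x \<and> x < t ! (j + d + 1)"
  using assms(2,3)
proof (induction d arbitrary: j)
  case 0
  then show ?case by (auto split: if_splits)
next
  case (Suc d)
  from Suc.prems(2) have "bspline t d j x \<noteq> 0 \<or> bspline t d (j + 1) x \<noteq> 0"
    by auto
  then show ?case
  proof
    assume "bspline t d j x \<noteq> 0"
    from Suc.IH[OF _ this] Suc.prems(1) assms(1)[of "j + d + 1" "j + d + 2"] show ?thesis by auto
  next
    assume "bspline t d (j + 1) x \<noteq> 0"
    from Suc.IH[OF _ this] Suc.prems(1) assms(1)[of j "j + 1"] show ?thesis by auto
  qed
qed

text \<open>
  Induction on the degree: each spline of degree \<open>d\<close> enters two splines of degree \<open>d + 1\<close>, and the two
  contributions combine to the factor \<open>y - x\<close>. The splines at the two ends drop out of the telescoped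
  sum because \<open>x\<close> lies outside their supports.
\<close>

lemma marsden_identity:
  assumes sorted: "\<And>a b. a \<le> b \<Longrightarrow> b < length t \<Longrightarrow> t ! a \<le> t ! b"
    and "d \<le> s" "s + d + 1 < length t" and x: "t ! s \<le> x" "x < t ! (s + 1)"
  shows "(\<Sum>j<length t - (d + 1). (\<Prod>i=1..d. y - t ! (j + i)) * bspline t d j x) = (y - x) ^ d"
  using assms(2,3)
proof (induction d)
  case 0
  have "bspline t 0 j x = (if j = s then 1 else 0)" if "j < length t - 1" for j
  proof -
    have "j < s \<Longrightarrow> t ! (j + 1) \<le> t ! s" "s < j \<Longrightarrow> t ! (s + 1) \<le> t ! j"
      using that 0 by (auto intro: sorted)
    then show ?thesis using x by (cases j s rule: linorder_cases) auto
  qed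
  then have "(\<Sum>j<length t - 1. bspline t 0 j x) = (\<Sum>j<length t - 1. if j = s then 1 else 0)"
    by (intro sum.cong) auto
  also have "\<dots> = 1" using 0 by auto
  finally show ?case by simp
next
  case (Suc d)
  let ?B = "\<lambda>j. bspline t d j x"
  let ?\<psi> = "\<lambda>e j. \<Prod>i=1..e. y - t ! (j + i)"
  define n where "n = length t - (d + 2)"
  define u where "u j = (x - t ! j) / (t ! (j + d + 1) - t ! j)" for j
  define v where "v j = (t ! (j + d + 1) - x) / (t ! (j + d + 1) - t ! j)" for j
  have n: "0 < n" "s < n" "length t = n + d + 2" using Suc.prems by (auto simp: n_def)
  have B0: "?B 0 = 0"
  proof (rule ccontr)
    assume "?B 0 \<noteq> 0"
    from bspline_support[OF sorted _ this] n have "x < t ! (d + 1)" by auto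
    moreover have "t ! (d + 1) \<le> t ! s" using Suc.prems by (intro sorted) auto
    ultimately show False using x by simp
  qed
  have Bn: "?B n = 0"
  proof (rule ccontr)
    assume "?B n \<noteq> 0"
    from bspline_support[OF sorted _ this] n have "t ! n \<le> x" by auto
    moreover have "t ! (s + 1) \<le> t ! n" using n by (intro sorted) auto
    ultimately show False using x by simp
  qed
  \<comment> \<open>Linear interpolation of \<open>y - \<cdot>\<close> between the knots \<open>t ! j\<close> and \<open>t ! (j + d + 1)\<close>.\<close>
  have comb: "?\<psi> (Suc d) j * u j * ?B j + ?\<psi> (Suc d) (j - 1) * v j * ?B j = (y - x) * (?\<psi> d j * ?B j)"
    if "0 < j" "j < n" for j
  proof (cases "?B j = 0")
    case False
    from bspline_support[OF sorted _ this] n that have "t ! j \<le> x" "x < t ! (j + d + 1)" by auto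
    then have ne: "t ! (j + d + 1) - t ! j \<noteq> 0" by simp
    have 1: "?\<psi> (Suc d) j = ?\<psi> d j * (y - t ! (j + d + 1))" by (simp add: add.assoc)
    have "?\<psi> (Suc d) (j - 1) = (\<Prod>i=0..d. y - t ! (j + i))"
      using that prod.shift_bounds_cl_Suc_ivl[of "\<lambda>i. y - t ! (j - 1 + i)" 0 d] by simp
    also have "\<dots> = (y - t ! j) * ?\<psi> d j" by (simp add: prod.atLeast_Suc_atMost)
    finally have 2: "?\<psi> (Suc d) (j - 1) = (y - t ! j) * ?\<psi> d j" .
    have "(y - t ! (j + d + 1)) * u j + (y - t ! j) * v j = y - x"
    proof -
      define a b where "a = t ! j" and "b = t ! (j + d + 1)"
      have "(y - b) * ((x - a) / (b - a)) + (y - a) * ((b - x) / (b - a)) =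
          ((y - b) * (x - a) + (y - a) * (b - x)) / (b - a)"
        by (simp add: add_divide_distrib)
      also have "(y - b) * (x - a) + (y - a) * (b - x) = (y - x) * (b - a)"
        by (simp add: algebra_simps)
      finally show ?thesis using ne by (simp add: u_def v_def a_def b_def)
    qed
    then have "?\<psi> d j * ?B j * ((y - t ! (j + d + 1)) * u j + (y - t ! j) * v j) = ?\<psi> d j * ?B j * (y - x)"
      by simp
    then show ?thesis unfolding 1 2 by (simp add: algebra_simps)
  qed simp
  have rec: "bspline t (Suc d) j x = u j * ?B j + v (Suc j) * ?B (Suc j)" for j
    by (simp add: u_def v_def)
  have "(\<Sum>j<n. ?\<psi> (Suc d) j * bspline t (Suc d) j x) =
      (\<Sum>j<n. ?\<psi> (Suc d) j * u j * ?B j) + (\<Sum>j<n. ?\<psi> (Suc d) j * v (Suc j) * ?B (Suc j))"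
    unfolding rec sum.distrib[symmetric] by (intro sum.cong refl) (simp only: distrib_left mult.assoc)
  also have "(\<Sum>j<n. ?\<psi> (Suc d) j * u j * ?B j) = (\<Sum>j\<in>{1..<n}. ?\<psi> (Suc d) j * u j * ?B j)"
    using B0 by (intro sum.mono_neutral_right) (auto simp: Suc_le_eq)
  also have "(\<Sum>j<n. ?\<psi> (Suc d) j * v (Suc j) * ?B (Suc j)) =
      (\<Sum>j\<in>{1..<Suc n}. ?\<psi> (Suc d) (j - 1) * v j * ?B j)"
    using sum.shift_bounds_Suc_ivl[of "\<lambda>j. ?\<psi> (Suc d) (j - 1) * v j * ?B j" 0 n]
    by (simp add: atLeast0LessThan)
  also have "\<dots> = (\<Sum>j\<in>{1..<n}. ?\<psi> (Suc d) (j - 1) * v j * ?B j)"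
    using Bn n by simp
  also have "(\<Sum>j\<in>{1..<n}. ?\<psi> (Suc d) j * u j * ?B j) + \<dots> = (y - x) * (\<Sum>j\<in>{1..<n}. ?\<psi> d j * ?B j)"
    unfolding sum.distrib[symmetric] sum_distrib_left by (intro sum.cong refl comb) auto
  also have "(\<Sum>j\<in>{1..<n}. ?\<psi> d j * ?B j) = (\<Sum>j<Suc n. ?\<psi> d j * ?B j)"
    using B0 Bn by (intro sum.mono_neutral_left) (auto simp: Suc_le_eq less_Suc_eq)
  also have "\<dots> = (y - x) ^ d"
    using Suc.IH Suc.prems n by simp
  finally show ?case using n by simp
qed

section \<open>Univariate splines and truncated powers\<close>

locale knot_line =
  fixes d \<mu> N :: nat and z :: "nat \<Rightarrow> real"
  assumes mu: "1 \<le> \<mu>" "\<mu> \<le> d + 1" and N: "0 < N"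
    and step: "\<And>k. k < N \<Longrightarrow> z k < z (k + 1)"
begin

definition t :: "real list" where "t = knots d \<mu> N z"
definition nsplines :: nat where "nsplines = d + 1 + (N - 1) * \<mu>"
definition B :: "nat \<Rightarrow> real \<Rightarrow> real" where "B = bspline t d"

lemma z_less: "a < b \<Longrightarrow> b \<le> N \<Longrightarrow> z a < z b"
proof (induction b)
  case (Suc b)
  then show ?case using step[of b] by (cases "a = b") auto
qed simp

lemma z_le: "a \<le> b \<Longrightarrow> b \<le> N \<Longrightarrow> z a \<le> z b"
  using z_less[of a b] by (cases "a = b") auto

lemma length_t: "length t = nsplines + d + 1"
proof -
  have "length (concat (map (\<lambda>k. replicate \<mu> (z k)) [1..<N])) = (N - 1) * \<mu>"
    by (simp add: length_concat o_def sum_list_triv)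
  then show ?thesis by (simp add: t_def knots_def nsplines_def)
qed

text \<open>
  Truncated subtraction lets this single formula cover the repeated first knot as well.
\<close>

lemma nth_t:
  assumes "j < length t"
  shows "t ! j = z (min N ((j + \<mu> - (d + 1)) div \<mu>))"
proof -
  let ?m = "concat (map (\<lambda>k. replicate \<mu> (z k)) [1..<N])"
  have len: "length ?m = (N - 1) * \<mu>"
    by (simp add: length_concat o_def sum_list_triv)
  consider "j < d + 1" | "d + 1 \<le> j" "j < d + 1 + (N - 1) * \<mu>" | "d + 1 + (N - 1) * \<mu> \<le> j" by linarith
  then show ?thesis
  proof cases
    case 1
    then have "(j + \<mu> - (d + 1)) div \<mu> = 0" using mu by (intro div_less) auto
    then show ?thesis using 1 by (simp add: t_def knots_def nth_append del: replicate_Suc)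
  next
    case 2
    have e: "(j + \<mu> - (d + 1)) div \<mu> = (j - (d + 1)) div \<mu> + 1"
    proof -
      from 2(1) have "j + \<mu> - (d + 1) = (j - (d + 1)) + \<mu>" by linarith
      moreover have "(i + \<mu>) div \<mu> = i div \<mu> + 1" for i using mu(1) by simp
      ultimately show ?thesis by (simp only:)
    qed
    have "(j - (d + 1)) div \<mu> < N - 1" using 2 mu by (simp add: less_mult_imp_div_less)
    moreover have lt: "j - (d + 1) < (N - 1) * \<mu>" using 2 by linarith
    moreover have "t ! j = ?m ! (j - (d + 1))"
      using 2 lt len by (simp add: t_def knots_def nth_append del: replicate_Suc)
    moreover have "?m ! (j - (d + 1)) = z (1 + (j - (d + 1)) div \<mu>)"
      using nth_concat_map_replicate[of "j - (d + 1)" "N - 1" \<mu> z 1] 2 N by simp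
    ultimately show ?thesis unfolding e by simp
  next
    case 3
    have "N * \<mu> \<le> j + \<mu> - (d + 1)" using 3 mu N by (cases N) (auto simp: algebra_simps)
    then have "N \<le> (j + \<mu> - (d + 1)) div \<mu>" using mu by (simp add: less_eq_div_iff_mult_less_eq)
    moreover have nlt: "\<not> j - (d + 1) < (N - 1) * \<mu>" using 3 by linarith
    moreover have "t ! j = replicate (d + 1) (z N) ! (j - (d + 1) - (N - 1) * \<mu>)"
      using 3 nlt len by (simp add: t_def knots_def nth_append del: replicate_Suc)
    moreover have "j - (d + 1) - (N - 1) * \<mu> < d + 1"
      using assms 3 by (simp add: length_t nsplines_def)
    ultimately show ?thesis by (simp add: min_def del: replicate_Suc)
  qed
qed

lemma t_sorted: "a \<le> b \<Longrightarrow> b < length t \<Longrightarrow> t ! a \<le> t ! b"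
  by (simp add: nth_t) (intro z_le min.mono div_le_mono; simp)

lemma t_break: "k < N \<Longrightarrow> t ! (d + k * \<mu>) = z k" "k < N \<Longrightarrow> t ! (d + k * \<mu> + 1) = z (k + 1)"
  and t_break_len: "k < N \<Longrightarrow> d + k * \<mu> + 1 < length t" "k < N \<Longrightarrow> d + k * \<mu> < nsplines"
proof -
  assume k: "k < N"
  then have le: "k * \<mu> \<le> (N - 1) * \<mu>" by (intro mult_le_mono) auto
  then show l: "d + k * \<mu> + 1 < length t" and "d + k * \<mu> < nsplines"
    unfolding length_t nsplines_def by linarith+
  have "(d + k * \<mu> + \<mu> - (d + 1)) div \<mu> = k"
    using mu by (intro div_nat_eq_range) (simp_all add: add_mult_distrib)
  then show "t ! (d + k * \<mu>) = z k" using l k by (simp add: nth_t)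
  have "(d + k * \<mu> + 1 + \<mu> - (d + 1)) div \<mu> = k + 1"
    using mu by (intro div_nat_eq_range) (simp_all add: add_mult_distrib)
  then show "t ! (d + k * \<mu> + 1) = z (k + 1)" using l k by (simp add: nth_t)
qed

text \<open>
  With this multiplicity pattern, the splines that do not vanish on the element
  \<open>(z k, z (k + 1))\<close> are exactly those with index in this window. All later support arguments are
  arithmetic with such windows.
\<close>

definition touches :: "nat \<Rightarrow> nat set" where
  "touches k = {k * \<mu>..k * \<mu> + d}"

lemma touches_subset: "k < N \<Longrightarrow> touches k \<subseteq> {..<nsplines}"
  using t_break_len(2)[of k] by (auto simp: touches_def)

lemma B_left:
  assumes "k < N" "x < z (k + 1)" "k * \<mu> + d < j" "j < nsplines" shows "B j x = 0"
proof (rule ccontr)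
  assume "B j x \<noteq> 0"
  with bspline_support[OF t_sorted, of j d x] assms(4) have "t ! j \<le> x"
    by (simp add: B_def length_t)
  moreover have "t ! (d + k * \<mu> + 1) \<le> t ! j" using assms by (intro t_sorted) (auto simp: length_t)
  ultimately show False using assms t_break[of k] by simp
qed

lemma B_right:
  assumes "k < N" "z k \<le> x" "j < k * \<mu>" shows "B j x = 0"
proof (rule ccontr)
  assume "B j x \<noteq> 0"
  moreover have "d + k * \<mu> < length t" using t_break_len[OF assms(1)] by simp
  ultimately have "x < t ! (j + d + 1)" using bspline_support[OF t_sorted, of j d x] assms(3)
    by (simp add: B_def)
  moreover have "t ! (j + d + 1) \<le> t ! (d + k * \<mu>)" using assms t_break_len[OF assms(1)]
    by (intro t_sorted) auto
  ultimately show False using assms t_break[of k] by simp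
qed

lemma B_not_touching:
  assumes "k < N" "x \<in> {z k..<z (k + 1)}" "j < nsplines" "j \<notin> touches k" shows "B j x = 0"
  using B_left[of k x j] B_right[of k x j] assms by (auto simp: touches_def)

lemma B_outside:
  assumes "j < nsplines" "x \<notin> {z 0..<z N}" shows "B j x = 0"
proof (rule ccontr)
  assume "B j x \<noteq> 0"
  with bspline_support[OF t_sorted, of j d x] assms(1) have "t ! j \<le> x" "x < t ! (j + d + 1)"
    by (simp_all add: B_def length_t)
  moreover have "z 0 \<le> t ! j" "t ! (j + d + 1) \<le> z N"
    using assms(1) by (auto simp: nth_t length_t intro!: z_le)
  ultimately show False using assms(2) by auto
qed

lemma element_exists:
  assumes "x \<in> {z 0..<z N}"
  obtains k where "k < N" "x \<in> {z k..<z (k + 1)}"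
proof -
  define k where "k = (LEAST k. x < z (k + 1))"
  have ex: "x < z (N - 1 + 1)" using assms N by simp
  have 1: "x < z (k + 1)" unfolding k_def by (rule LeastI[of "\<lambda>k. x < z (k + 1)", OF ex])
  have 2: "k \<le> N - 1" unfolding k_def by (rule Least_le, rule ex)
  have 3: "z k \<le> x"
  proof (cases k)
    case 0 then show ?thesis using assms by simp
  next
    case (Suc k')
    then have "\<not> x < z (k' + 1)" unfolding k_def by (metis lessI not_less_Least)
    then show ?thesis using Suc by simp
  qed
  show thesis using that[of k] 1 2 3 N by auto
qed

text \<open>
  Comparing coefficients of \<open>(y - c)\<close>-powers in the Marsden identity writes the powers of \<open>c - x\<close> as
  combinations of B-splines, where the coefficients are those of a product of linear factors.
\<close>

lemma marsden_coeff:
  assumes "x \<in> {z 0..<z N}"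
  shows "(\<Sum>j<nsplines. coeff (\<Prod>i=1..d. [:c - t ! (j + i), 1:]) e * B j x) = real (d choose e) * (c - x) ^ (d - e)"
proof -
  obtain k where k: "k < N" "x \<in> {z k..<z (k + 1)}" using element_exists[OF assms] .
  have "[:c - x, 1:] ^ d = (\<Sum>j<nsplines. smult (B j x) (\<Prod>i=1..d. [:c - t ! (j + i), 1:]))"
  proof (rule poly_ext)
    fix y
    have "(\<Sum>j<nsplines. (\<Prod>i=1..d. (c + y) - t ! (j + i)) * bspline t d j x) = (c + y - x) ^ d"
      using marsden_identity[OF t_sorted, of d "d + k * \<mu>" x "c + y"] k t_break[OF k(1)] t_break_len[OF k(1)]
      by (simp add: length_t)
    then show "poly ([:c - x, 1:] ^ d) y = poly (\<Sum>j<nsplines. smult (B j x) (\<Prod>i=1..d. [:c - t ! (j + i), 1:])) y"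
      by (simp add: poly_sum poly_prod B_def algebra_simps)
  qed
  then have "coeff ([:c - x, 1:] ^ d) e = coeff (\<Sum>j<nsplines. smult (B j x) (\<Prod>i=1..d. [:c - t ! (j + i), 1:])) e"
    by simp
  then show ?thesis
    by (cases "e \<le> d")
      (simp_all add: coeff_sum coeff_linear_poly_power mult.commute coeff_eq_0 degree_linear_power binomial_eq_0)
qed

text \<open>
  Truncated powers \<open>(x - z k)\<^sub>+\<^sup>i\<close>, with the exponents that the smoothness at a breakpoint of
  multiplicity \<open>\<mu>\<close> leaves free (all exponents at \<open>z 0\<close>). They form a second basis of the spline space, and for nested
  breakpoints the coarse ones are literally among the fine ones.
\<close>

definition tpow :: "nat \<times> nat \<Rightarrow> real \<Rightarrow> real" where
  "tpow = (\<lambda>(k, i) x. if z k \<le> x \<and> x < z N then (x - z k) ^ i else 0)"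

definition tpow_index :: "(nat \<times> nat) set" where
  "tpow_index = {0} \<times> {..d} \<union> {1..<N} \<times> {d + 1 - \<mu>..d}"

lemma finite_tpow_index: "finite tpow_index" by (simp add: tpow_index_def)

lemma card_tpow_index: "card tpow_index = nsplines"
proof -
  have "card tpow_index = card ({0::nat} \<times> {..d}) + card ({1..<N} \<times> {d + 1 - \<mu>..d})"
    unfolding tpow_index_def by (intro card_Un_disjoint) auto
  then show ?thesis using mu by (simp add: nsplines_def card_cartesian_product)
qed

text \<open>
  Expand around \<open>c = z k\<close>. For a spline whose support contains \<open>z k\<close> in its interior, all \<open>\<mu>\<close> copies of
  this knot occur among the factors, so the coefficients of order below \<open>\<mu>\<close> vanish. The splines to the
  left of \<open>z k\<close> vanish for \<open>x \<ge> z k\<close>, hence only those starting at \<open>z k\<close> or later remain.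
\<close>

lemma tpow_expansion:
  assumes "(k, i) \<in> tpow_index"
  shows "\<exists>\<gamma>. \<forall>x. tpow (k, i) x = (\<Sum>j\<in>{j. j < nsplines \<and> (k = 0 \<or> (k - 1) * \<mu> + d < j)}. \<gamma> j * B j x)"
proof -
  have k: "k < N" "i \<le> d" and ki: "k = 0 \<or> d - i < \<mu>" using assms N mu by (auto simp: tpow_index_def)
  define \<psi> where "\<psi> j = (\<Prod>a=1..d. [:z k - t ! (j + a), 1:])" for j
  define b where "b = (-1) ^ i * real (d choose (d - i))"
  have b: "b \<noteq> 0" using k by (simp add: b_def)
  define \<gamma> where "\<gamma> j = coeff (\<psi> j) (d - i) / b" for j
  have cross: "coeff (\<psi> j) (d - i) = 0" if "0 < k" "k * \<mu> \<le> j" "j \<le> (k - 1) * \<mu> + d" for j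
  proof -
    \<comment> \<open>The factors contributed by the copies of the knot \<open>z k\<close>.\<close>
    define A where "A = {d + 1 + (k - 1) * \<mu> - j..d + k * \<mu> - j}"
    have kmu: "k * \<mu> = (k - 1) * \<mu> + \<mu>" using that(1) by (cases k) auto
    have A: "A \<subseteq> {1..d}" using that kmu by (auto simp: A_def)
    have cA: "card A = \<mu>" using that kmu by (simp add: A_def)
    have tA: "t ! (j + a) = z k" if a: "a \<in> A" for a
    proof -
      have 1: "d + 1 + (k - 1) * \<mu> \<le> j + a" "j + a \<le> d + k * \<mu>"
        using a that(1) \<open>j \<le> (k - 1) * \<mu> + d\<close> kmu by (auto simp: A_def)
      then have "(j + a + \<mu> - (d + 1)) div \<mu> = k" using kmu mu
        by (intro div_nat_eq_range) linarith+
      then show ?thesis using 1 k t_break_len[OF k(1)] by (simp add: nth_t)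
    qed
    have "\<psi> j = (\<Prod>a\<in>A. [:z k - t ! (j + a), 1:]) * (\<Prod>a\<in>{1..d} - A. [:z k - t ! (j + a), 1:])"
      unfolding \<psi>_def using A by (subst prod.subset_diff[of A]) (auto simp: mult.commute)
    also have "(\<Prod>a\<in>A. [:z k - t ! (j + a), 1:]) = monom 1 \<mu>"
      using tA cA by (simp add: monom_altdef)
    finally have "\<psi> j = monom 1 \<mu> * (\<Prod>a\<in>{1..d} - A. [:z k - t ! (j + a), 1:])"
      by simp
    then show ?thesis using ki that(1) by (simp add: coeff_monom_mult)
  qed
  have "tpow (k, i) x = (\<Sum>j\<in>{j. j < nsplines \<and> (k = 0 \<or> (k - 1) * \<mu> + d < j)}. \<gamma> j * B j x)" for x
  proof (cases "z k \<le> x \<and> x < z N")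
    case True
    then have x: "x \<in> {z 0..<z N}" using z_le[of 0 k] k by auto
    have "(\<Sum>j\<in>{j. j < nsplines \<and> (k = 0 \<or> (k - 1) * \<mu> + d < j)}. \<gamma> j * B j x) = (\<Sum>j<nsplines. \<gamma> j * B j x)"
    proof (intro sum.mono_neutral_left ballI)
      fix j assume j: "j \<in> {..<nsplines} - {j. j < nsplines \<and> (k = 0 \<or> (k - 1) * \<mu> + d < j)}"
      show "\<gamma> j * B j x = 0"
      proof (cases "j < k * \<mu>")
        case True
        with B_right[OF k(1)] \<open>z k \<le> x \<and> x < z N\<close> show ?thesis by simp
      next
        case False
        with cross[of j] j show ?thesis by (auto simp: \<gamma>_def)
      qed
    qed auto
    also have "\<dots> = (\<Sum>j<nsplines. coeff (\<psi> j) (d - i) * B j x) / b"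
      by (simp add: \<gamma>_def sum_divide_distrib)
    also have "(\<Sum>j<nsplines. coeff (\<psi> j) (d - i) * B j x) = real (d choose (d - i)) * (z k - x) ^ i"
      unfolding \<psi>_def marsden_coeff[OF x] using k by simp
    also have "\<dots> = b * (x - z k) ^ i"
      unfolding b_def power_minus[of "x - z k" i, simplified] by simp
    finally show ?thesis using b True by (simp add: tpow_def)
  next
    case False
    have "B j x = 0" if j: "j < nsplines" "k = 0 \<or> (k - 1) * \<mu> + d < j" for j
    proof (cases "k = 0 \<or> z N \<le> x")
      case True
      then show ?thesis using B_outside[OF j(1)] False by auto
    next
      case F: False
      then show ?thesis using B_left[of "k - 1" x j] j k False by auto
    qed
    then show ?thesis using False by (auto simp: tpow_def)
  qed
  then show ?thesis by blast
qed

lemma indep_family_monomials: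
  assumes "infinite X"
  shows "indep_family X {..d} (\<lambda>i x. (x - c) ^ i)"
proof (rule indep_familyI)
  fix a :: "nat \<Rightarrow> real" and i assume a: "\<And>x. x \<in> X \<Longrightarrow> (\<Sum>j\<le>d. a j * (x - c) ^ j) = 0" and i: "i \<in> {..d}"
  define p where "p = (\<Sum>j\<le>d. monom (a j) j)"
  have "poly p (x - c) = 0" if "x \<in> X" for x
    using a[OF that] by (simp add: p_def poly_sum poly_monom)
  then have "(\<lambda>x. x - c) ` X \<subseteq> {y. poly p y = 0}" by auto
  moreover have "infinite ((\<lambda>x. x - c) ` X)" using assms by (simp add: finite_image_iff inj_on_def)
  ultimately have "p = 0" using poly_roots_finite finite_subset by blast
  then have "coeff p i = 0" by simp
  then show "a i = 0" using i by (simp add: p_def coeff_sum if_distrib cong: if_cong)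
qed

text \<open>
  On the element \<open>k\<close> only truncated powers at \<open>z 0, \<dots>, z k\<close> are visible, so their coefficients can be
  read off element by element from the left. Stopping at \<open>K\<close> gives the form needed for splines that
  vanish to the left of a breakpoint.
\<close>

lemma tpow_triangular:
  assumes "K \<le> N" and a: "\<And>x. x < z K \<Longrightarrow> (\<Sum>q\<in>tpow_index. a q * tpow q x) = 0"
  shows "\<forall>(k, i)\<in>tpow_index. k < K \<longrightarrow> a (k, i) = 0"
proof -
  have "\<forall>i. (k, i) \<in> tpow_index \<longrightarrow> a (k, i) = 0" if "k < K" for k
    using that
  proof (induction k rule: less_induct)
    case (less k)
    have kN: "k < N" using less.prems assms by simp
    define I where "I = {i. (k, i) \<in> tpow_index}"
    have I: "I \<subseteq> {..d}" by (auto simp: I_def tpow_index_def)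
    let ?X = "{z k..<z (k + 1)}"
    have inf: "infinite ?X" using step[OF kN] by (simp add: infinite_Ico)
    have "(\<Sum>i\<in>I. a (k, i) * (x - z k) ^ i) = 0" if x: "x \<in> ?X" for x
    proof -
      have xK: "x < z K" using x less.prems z_le[of "k + 1" K] assms by auto
      have xN: "x < z N" using xK z_le[of K N] assms by simp
      have "(\<Sum>q\<in>tpow_index. a q * tpow q x) = (\<Sum>q\<in>Pair k ` I. a q * tpow q x)"
      proof (intro sum.mono_neutral_right ballI)
        fix q assume q: "q \<in> tpow_index - Pair k ` I"
        obtain k' i where q': "q = (k', i)" by (cases q)
        then have ne: "k' \<noteq> k" using q by (auto simp: I_def)
        show "a q * tpow q x = 0"
        proof (cases "k' < k")
          case True
          then show ?thesis using less.IH[of k'] less.prems q q' by auto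
        next
          case False
          have "k' < N" using q q' N by (auto simp: tpow_index_def)
          then have "z (k + 1) \<le> z k'" using False ne by (intro z_le) auto
          then show ?thesis using x by (simp add: q' tpow_def)
        qed
      qed (auto simp: I_def finite_tpow_index)
      also have "\<dots> = (\<Sum>i\<in>I. a (k, i) * (x - z k) ^ i)"
        using x xN by (subst sum.reindex) (auto simp: inj_on_def tpow_def)
      finally show ?thesis using a[OF xK] by simp
    qed
    moreover have "indep_family ?X I (\<lambda>i x. (x - z k) ^ i)"
      using indep_family_mono[OF indep_family_monomials[OF inf]] I by auto
    ultimately have "a (k, i) = 0" if "i \<in> I" for i
      using indep_familyD[of ?X I _ "\<lambda>i. a (k, i)"] that by blast
    then show ?case by (auto simp: I_def)
  qed
  then show ?thesis by auto
qed

lemma indep_family_tpow: "indep_family UNIV tpow_index tpow"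
proof (rule indep_familyI)
  fix a q assume "\<And>x. x \<in> UNIV \<Longrightarrow> (\<Sum>q\<in>tpow_index. a q * tpow q x) = 0" "q \<in> tpow_index"
  moreover from this have "fst q < N" using N by (auto simp: tpow_index_def)
  ultimately show "a q = 0" using tpow_triangular[of N a] by (cases q) auto
qed

lemma tpow_in_span:
  assumes "q \<in> tpow_index"
  shows "\<exists>\<gamma>. \<forall>x. tpow q x = (\<Sum>j<nsplines. \<gamma> j * B j x)"
proof -
  obtain k i where q: "q = (k, i)" by (cases q)
  obtain \<gamma> where \<gamma>: "\<And>x. tpow (k, i) x = (\<Sum>j\<in>{j. j < nsplines \<and> (k = 0 \<or> (k - 1) * \<mu> + d < j)}. \<gamma> j * B j x)"
    using tpow_expansion assms q by blast
  have "tpow q x = (\<Sum>j<nsplines. (if k = 0 \<or> (k - 1) * \<mu> + d < j then \<gamma> j else 0) * B j x)" for x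
    unfolding q \<gamma> by (intro sum.mono_neutral_cong_left) auto
  then show ?thesis
    by (intro exI[of _ "\<lambda>j. if k = 0 \<or> (k - 1) * \<mu> + d < j then \<gamma> j else 0"] allI)
qed

text \<open>
  There are as many truncated powers as B-splines and they are independent, so by exchange the
  B-splines are independent as well and lie in the span of the truncated powers. The latter is the
  smoothness of B-splines at the breakpoints, obtained without differentiating.
\<close>

lemma indep_family_B: "indep_family UNIV {..<nsplines} B"
  and B_in_span_tpow: "\<exists>K. \<forall>j<nsplines. \<forall>x. B j x = (\<Sum>q\<in>tpow_index. K j q * tpow q x)"
proof -
  obtain M where M: "\<And>q x. q \<in> tpow_index \<Longrightarrow> tpow q x = (\<Sum>j<nsplines. M q j * B j x)"
    using tpow_in_span by metis
  note ex = indep_family_exchange[OF finite_lessThan finite_tpow_index _ indep_family_tpow M]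
  show "indep_family UNIV {..<nsplines} B" "\<exists>K. \<forall>j<nsplines. \<forall>x. B j x = (\<Sum>q\<in>tpow_index. K j q * tpow q x)"
    using ex by (auto simp: card_tpow_index)
qed

text \<open>
  Local linear independence: on an infinite subset of an element, the \<open>d + 1\<close> B-splines that do not
  vanish there generate the \<open>d + 1\<close> monomials.
\<close>

lemma indep_family_touches:
  assumes k: "k < N" and X: "infinite X" "X \<subseteq> {z k..<z (k + 1)}"
  shows "indep_family X (touches k) B"
proof -
  have "\<exists>M. \<forall>x\<in>X. (x - z 0) ^ i = (\<Sum>j\<in>touches k. M j * B j x)" if i: "i \<in> {..d}" for i
  proof -
    obtain M where M: "\<And>x. tpow (0, i) x = (\<Sum>j<nsplines. M j * B j x)"
    proof -
      have "(0, i) \<in> tpow_index" using i by (simp add: tpow_index_def)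
      from tpow_in_span[OF this] show thesis using that by blast
    qed
    have "(x - z 0) ^ i = (\<Sum>j\<in>touches k. M j * B j x)" if "x \<in> X" for x
    proof -
      have "z 0 \<le> x" "x < z N" using that X(2) z_le[of 0 k] z_le[of "k + 1" N] k by fastforce+
      moreover have "(\<Sum>j<nsplines. M j * B j x) = (\<Sum>j\<in>touches k. M j * B j x)"
        using touches_subset[OF k] B_not_touching[OF k] X(2) that
        by (intro sum.mono_neutral_right) auto
      ultimately show ?thesis using M[of x] by (simp add: tpow_def)
    qed
    then show ?thesis by blast
  qed
  then obtain M where M: "\<And>i x. i \<in> {..d} \<Longrightarrow> x \<in> X \<Longrightarrow> (x - z 0) ^ i = (\<Sum>j\<in>touches k. M i j * B j x)"
    by metis
  show ?thesis
    by (rule indep_family_exchange(1)[OF _ _ _ indep_family_monomials[OF X(1)] M])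
      (auto simp: touches_def)
qed

lemma B_local_indep:
  assumes k: "k < N" and X: "infinite X" "X \<subseteq> {z k..<z (k + 1)}"
    and a: "\<And>x. x \<in> X \<Longrightarrow> (\<Sum>j<nsplines. a j * B j x) = 0" and j: "j \<in> touches k"
  shows "a j = 0"
proof -
  have "(\<Sum>j\<in>touches k. a j * B j x) = 0" if "x \<in> X" for x
  proof -
    have "(\<Sum>j<nsplines. a j * B j x) = (\<Sum>j\<in>touches k. a j * B j x)"
      using touches_subset[OF k] B_not_touching[OF k] X(2) that
      by (intro sum.mono_neutral_right) auto
    then show ?thesis using a[OF that] by simp
  qed
  from indep_familyD[OF indep_family_touches[OF k X] this j] show ?thesis .
qed

end

section \<open>Refinement of the breakpoints\<close>

locale knot_refinement = coarse: knot_line d \<mu> N z + fine: knot_line d \<mu> N' z'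
  for d \<mu> N z N' z' +
  fixes M :: nat
  assumes M: "0 < M" and N': "N' = M * N" and z': "\<And>k. k \<le> N \<Longrightarrow> z' (M * k) = z k"
begin

lemma fine_element:
  assumes "e < N'"
  shows "e div M < N" "z (e div M) \<le> z' e" "z' (e + 1) \<le> z (e div M + 1)"
proof -
  show k: "e div M < N" using assms N' M by (simp add: less_mult_imp_div_less mult.commute)
  have "M * (e div M) \<le> e" by simp
  with fine.z_le[of "M * (e div M)" e] z'[of "e div M"] k assms show "z (e div M) \<le> z' e" by simp
  have "e + 1 \<le> M * (e div M + 1)" using M
    by (metis Suc_eq_plus1 Suc_leI dividend_less_times_div mult_Suc_right add.commute)
  moreover have "M * (e div M + 1) \<le> N'" unfolding N' using k by (intro mult_le_mono) auto
  ultimately have "z' (e + 1) \<le> z' (M * (e div M + 1))" by (intro fine.z_le)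
  then show "z' (e + 1) \<le> z (e div M + 1)" using z'[of "e div M + 1"] k by simp
qed

lemma tpow_fine:
  assumes "(k, i) \<in> coarse.tpow_index"
  shows "coarse.tpow (k, i) = fine.tpow (M * k, i)" "(M * k, i) \<in> fine.tpow_index"
proof -
  have k: "k < N" using assms coarse.N by (auto simp: coarse.tpow_index_def)
  show "coarse.tpow (k, i) = fine.tpow (M * k, i)"
  proof -
    have "z' N' = z N" using z'[of N] by (simp add: N')
    then show ?thesis using z'[of k] k by (simp add: coarse.tpow_def fine.tpow_def cong: if_cong)
  qed
  show "(M * k, i) \<in> fine.tpow_index"
  proof -
    have "M * k < N'" using k M by (simp add: N')
    then show ?thesis
      using assms M by (auto simp: coarse.tpow_index_def fine.tpow_index_def Suc_le_eq)
  qed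
qed

text \<open>
  Through the truncated powers, of which the coarse ones are also fine ones.
\<close>

lemma refinement_exists:
  "\<exists>R. \<forall>j<coarse.nsplines. \<forall>x. coarse.B j x = (\<Sum>h<fine.nsplines. R j h * fine.B h x)"
proof -
  obtain K where K: "\<And>j x. j < coarse.nsplines \<Longrightarrow> coarse.B j x = (\<Sum>q\<in>coarse.tpow_index. K j q * coarse.tpow q x)"
    using coarse.B_in_span_tpow by blast
  have "\<exists>g. \<forall>x. coarse.tpow q x = (\<Sum>h<fine.nsplines. g h * fine.B h x)" if "q \<in> coarse.tpow_index" for q
    using that tpow_fine fine.tpow_in_span by (cases q) metis
  then obtain g where g: "\<And>q x. q \<in> coarse.tpow_index \<Longrightarrow> coarse.tpow q x = (\<Sum>h<fine.nsplines. g q h * fine.B h x)"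
    by metis
  have "coarse.B j x = (\<Sum>h<fine.nsplines. (\<Sum>q\<in>coarse.tpow_index. K j q * g q h) * fine.B h x)"
    if "j < coarse.nsplines" for j x
  proof -
    have "coarse.B j x = (\<Sum>q\<in>coarse.tpow_index. \<Sum>h<fine.nsplines. K j q * g q h * fine.B h x)"
      using that by (simp add: K g sum_distrib_left mult.assoc)
    also have "\<dots> = (\<Sum>h<fine.nsplines. (\<Sum>q\<in>coarse.tpow_index. K j q * g q h) * fine.B h x)"
      by (subst sum.swap) (simp add: sum_distrib_right)
    finally show ?thesis .
  qed
  then show ?thesis by (intro exI[of _ "\<lambda>j h. \<Sum>q\<in>coarse.tpow_index. K j q * g q h"]) blast
qed

text \<open>
  The two-scale coefficients.
\<close>

definition R :: "nat \<Rightarrow> nat \<Rightarrow> real" where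
  "R = (SOME R. \<forall>j<coarse.nsplines. \<forall>x. coarse.B j x = (\<Sum>h<fine.nsplines. R j h * fine.B h x))"

lemma R: "j < coarse.nsplines \<Longrightarrow> coarse.B j x = (\<Sum>h<fine.nsplines. R j h * fine.B h x)"
  using someI_ex[OF refinement_exists] unfolding R_def by blast

lemma R_touches:
  assumes j: "j < coarse.nsplines" and e: "e < N'" "h \<in> fine.touches e" and R0: "R j h \<noteq> 0"
  shows "j \<in> coarse.touches (e div M)"
proof (rule ccontr)
  assume nt: "j \<notin> coarse.touches (e div M)"
  have "(\<Sum>h<fine.nsplines. R j h * fine.B h x) = 0" if "x \<in> {z' e..<z' (e + 1)}" for x
    using coarse.B_not_touching[OF fine_element(1)[OF e(1)], of x] fine_element[OF e(1)] j nt that R[OF j, of x]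
    by auto
  moreover have "infinite {z' e..<z' (e + 1)}" using fine.step[OF e(1)] by (simp add: infinite_Ico)
  ultimately have "R j h = 0" using fine.B_local_indep[OF e(1) _ order_refl _ e(2)] by blast
  with R0 show False ..
qed

text \<open>
  At a common breakpoint \<open>c\<close>, the coarse splines with \<open>c\<close> inside their support are determined by their
  coefficients on the fine splines with \<open>c\<close> inside their support. Indeed, if these coefficients of a
  combination \<open>f\<close> vanish, then cutting \<open>f\<close> off to the left of \<open>c\<close> gives another fine spline \<open>fR\<close>.
  Therefore \<open>f\<close> to the right of \<open>c\<close> starts with the truncated powers at \<open>c\<close>, which are combinations of
  coarse splines that do not reach to the left of \<open>c\<close>. Local independence of the coarse splines on the
  element to the right of \<open>c\<close> then forces \<open>f = 0\<close>.
\<close>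

lemma R_crossing_indep:
  assumes k: "0 < k" "k < N"
  shows "indep_family {M * k * \<mu>..(M * k - 1) * \<mu> + d} {k * \<mu>..(k - 1) * \<mu> + d} R"
proof (rule indep_familyI)
  let ?C = "{k * \<mu>..(k - 1) * \<mu> + d}" and ?C' = "{M * k * \<mu>..(M * k - 1) * \<mu> + d}"
  fix c j0 assume c: "\<And>h. h \<in> ?C' \<Longrightarrow> (\<Sum>j\<in>?C. c j * R j h) = 0" and j0: "j0 \<in> ?C"
  have k': "0 < M * k" "M * k < N'" using k M N' by auto
  have zk: "z' (M * k) = z k" using z' k by simp
  have Csub: "?C \<subseteq> coarse.touches k" by (auto simp: coarse.touches_def intro: order_trans)
  then have CnB: "?C \<subseteq> {..<coarse.nsplines}" using coarse.touches_subset[OF k(2)] by simp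
  define e where "e h = (\<Sum>j\<in>?C. c j * R j h)" for h
  define f where "f x = (\<Sum>j\<in>?C. c j * coarse.B j x)" for x
  have f: "f x = (\<Sum>h<fine.nsplines. e h * fine.B h x)" for x
  proof -
    have "f x = (\<Sum>j\<in>?C. \<Sum>h<fine.nsplines. c j * R j h * fine.B h x)"
      unfolding f_def using CnB by (intro sum.cong) (auto simp: R sum_distrib_left mult.assoc)
    also have "\<dots> = (\<Sum>h<fine.nsplines. e h * fine.B h x)"
      by (subst sum.swap) (simp add: e_def sum_distrib_right)
    finally show ?thesis .
  qed
  define e' where "e' h = (if (M * k - 1) * \<mu> + d < h then e h else 0)" for h
  define fR where "fR x = (\<Sum>h<fine.nsplines. e' h * fine.B h x)" for x
  \<comment> \<open>\<open>fR\<close> is \<open>f\<close> cut off to the left of \<open>z k\<close>: the crossing fine coefficients vanish.\<close>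
  have fR0: "fR x = 0" if "x < z k" for x
  proof -
    have "fine.B h x = 0" if "h < fine.nsplines" "(M * k - 1) * \<mu> + d < h" for h
      using fine.B_left[of "M * k - 1" x h] that k' \<open>x < z k\<close> zk by simp
    then show ?thesis by (auto simp: fR_def e'_def intro!: sum.neutral)
  qed
  have fRf: "fR x = f x" if "z k \<le> x" for x
    unfolding fR_def f
  proof (intro sum.cong refl)
    fix h assume "h \<in> {..<fine.nsplines}"
    show "e' h * fine.B h x = e h * fine.B h x"
      using fine.B_right[of "M * k" x h] c[of h] that zk k' by (cases "h < M * k * \<mu>") (auto simp: e'_def e_def)
  qed
  obtain K where K: "\<And>h x. h < fine.nsplines \<Longrightarrow> fine.B h x = (\<Sum>q\<in>fine.tpow_index. K h q * fine.tpow q x)"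
    using fine.B_in_span_tpow by blast
  define g where "g q = (\<Sum>h<fine.nsplines. e' h * K h q)" for q
  have fRg: "fR x = (\<Sum>q\<in>fine.tpow_index. g q * fine.tpow q x)" for x
  proof -
    have "fR x = (\<Sum>h<fine.nsplines. \<Sum>q\<in>fine.tpow_index. e' h * K h q * fine.tpow q x)"
      by (simp add: fR_def K sum_distrib_left mult.assoc)
    also have "\<dots> = (\<Sum>q\<in>fine.tpow_index. g q * fine.tpow q x)"
      by (subst sum.swap) (simp add: g_def sum_distrib_right)
    finally show ?thesis .
  qed
  have g0: "\<forall>(k', i)\<in>fine.tpow_index. k' < M * k \<longrightarrow> g (k', i) = 0"
    using fR0 fRg zk k' by (intro fine.tpow_triangular) auto
  define I where "I = {d + 1 - \<mu>..d}"
  have Iidx: "(k, i) \<in> coarse.tpow_index" if "i \<in> I" for i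
    using that k by (auto simp: I_def coarse.tpow_index_def)
  let ?X = "{z' (M * k)..<z' (M * k + 1)}"
  have X: "?X \<subseteq> {z k..<z (k + 1)}" using fine_element(3)[OF k'(2)] zk M by auto
  have Xinf: "infinite ?X" using fine.step[OF k'(2)] by (simp add: infinite_Ico)
  have f_loc: "f x = (\<Sum>i\<in>I. g (M * k, i) * coarse.tpow (k, i) x)" if x: "x \<in> ?X" for x
  proof -
    have "f x = (\<Sum>q\<in>fine.tpow_index. g q * fine.tpow q x)" using fRf fRg x zk by simp
    also have "\<dots> = (\<Sum>q\<in>Pair (M * k) ` I. g q * fine.tpow q x)"
    proof (intro sum.mono_neutral_right ballI)
      show "finite fine.tpow_index" by (rule fine.finite_tpow_index)
      show "Pair (M * k) ` I \<subseteq> fine.tpow_index" using k' by (auto simp: I_def fine.tpow_index_def)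
      fix q assume q: "q \<in> fine.tpow_index - Pair (M * k) ` I"
      obtain k2 i where q': "q = (k2, i)" by (cases q)
      have k2: "k2 \<noteq> M * k" "k2 < N'" using q q' k' by (auto simp: I_def fine.tpow_index_def)
      show "g q * fine.tpow q x = 0"
      proof (cases "k2 < M * k")
        case True then show ?thesis using g0 q q' by auto
      next
        case False
        then have "z' (M * k + 1) \<le> z' k2" using k2 by (intro fine.z_le) auto
        then show ?thesis using x by (simp add: q' fine.tpow_def)
      qed
    qed
    also have "\<dots> = (\<Sum>i\<in>I. g (M * k, i) * coarse.tpow (k, i) x)"
      using tpow_fine(1)[OF Iidx] by (subst sum.reindex) (auto simp: inj_on_def)
    finally show ?thesis .
  qed
  obtain \<gamma> where \<gamma>: "\<And>i x. i \<in> I \<Longrightarrow> coarse.tpow (k, i) x =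
      (\<Sum>j\<in>{j. j < coarse.nsplines \<and> (k = 0 \<or> (k - 1) * \<mu> + d < j)}. \<gamma> i j * coarse.B j x)"
    using coarse.tpow_expansion[OF Iidx] by metis
  define b where "b j = (\<Sum>i\<in>I. g (M * k, i) * \<gamma> i j)" for j
  define a where "a j = (if j \<in> ?C then c j else 0) - (if (k - 1) * \<mu> + d < j then b j else 0)" for j
  have "(\<Sum>j<coarse.nsplines. a j * coarse.B j x) = 0" if x: "x \<in> ?X" for x
  proof -
    have 1: "(\<Sum>j<coarse.nsplines. (if j \<in> ?C then c j else 0) * coarse.B j x) = f x"
      unfolding f_def using CnB by (intro sum.mono_neutral_cong_right) auto
    have "(\<Sum>j<coarse.nsplines. (if (k - 1) * \<mu> + d < j then b j else 0) * coarse.B j x) =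
        (\<Sum>j\<in>{j. j < coarse.nsplines \<and> (k = 0 \<or> (k - 1) * \<mu> + d < j)}. b j * coarse.B j x)"
      using k by (intro sum.mono_neutral_cong_right) auto
    also have "\<dots> = (\<Sum>i\<in>I. g (M * k, i) * coarse.tpow (k, i) x)"
      unfolding b_def sum_distrib_right by (subst sum.swap) (simp add: \<gamma> sum_distrib_left mult.assoc)
    finally show ?thesis using 1 f_loc[OF x] by (simp add: a_def left_diff_distrib sum_subtractf)
  qed
  from coarse.B_local_indep[OF k(2) Xinf X this, of j0] Csub j0 have "a j0 = 0" by auto
  then show "c j0 = 0" using j0 by (simp add: a_def)
qed

end

section \<open>Tensor-product splines, truncation and THB-splines\<close>

lemma in_span_image_iff:
  fixes f :: "'a \<Rightarrow> real" and b :: "'j \<Rightarrow> 'a \<Rightarrow> real"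
  assumes "finite A"
  shows "f \<in> span (b ` A) \<longleftrightarrow> (\<exists>a. f = (\<Sum>j\<in>A. a j *\<^sub>R b j))"
proof
  show "f \<in> span (b ` A) \<Longrightarrow> \<exists>a. f = (\<Sum>j\<in>A. a j *\<^sub>R b j)"
  proof (induction rule: real_vector.span_induct_alt)
    case base
    show ?case by (intro exI[of _ "\<lambda>_. 0"]) (simp add: sum.neutral)
  next
    case (step c x y)
    then obtain a k where a: "y = (\<Sum>j\<in>A. a j *\<^sub>R b j)" and k: "k \<in> A" "x = b k" by blast
    have "(\<Sum>j\<in>A. (a j + (if j = k then c else 0)) *\<^sub>R b j) =
        (\<Sum>j\<in>A. a j *\<^sub>R b j) + (\<Sum>j\<in>A. if j = k then c *\<^sub>R b j else 0)"
      unfolding sum.distrib[symmetric] by (intro sum.cong) (auto simp: scaleR_add_left)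
    also have "\<dots> = c *\<^sub>R x + y" using assms k a by (simp add: add.commute)
    finally show ?case by metis
  qed
qed (auto intro!: span_sum span_scale intro: span_base)

locale thb_setting =
  fixes S :: "'n::finite spline_data" and \<eta> :: real and \<Psi> :: "nat \<Rightarrow> (real ^ 'n) set"
  assumes hierarchy: "spline_hierarchy \<eta> S"
    and domains: "domain_hierarchy S \<Psi>"
begin

abbreviation "L \<equiv> depth S"
abbreviation "levels \<equiv> {1..depth S}"
abbreviation "d \<equiv> deg S"
abbreviation "\<mu> \<equiv> kmult S"

abbreviation "spline1 m i \<equiv> bspline (level_knots S m i) (d i)"
abbreviation "spline m \<equiv> tensor_bspline S m"

definition spline_index :: "nat \<Rightarrow> ('n \<Rightarrow> nat) set" where
  "spline_index m = {j. \<forall>i. j i < d i + 1 + (nint S m i - 1) * \<mu> i}"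

text \<open>
  The indices of the univariate splines that do not vanish on the element \<open>k\<close> of their own level.
\<close>

definition touches1 :: "'n \<Rightarrow> nat \<Rightarrow> nat set" where
  "touches1 i k = {k * \<mu> i..k * \<mu> i + d i}"

text \<open>
  Supports and domains of all levels are compared on the finest mesh: \<open>ancestor m e\<close> is the level-\<open>m\<close>
  element containing the finest element \<open>e\<close> in one direction.
\<close>

definition ancestor :: "nat \<Rightarrow> nat \<Rightarrow> nat" where
  "ancestor m e = e div 2 ^ (L - m)"

definition elements :: "('n \<Rightarrow> nat) set" where
  "elements = {e. \<forall>i. e i < nint S L i}"

definition element :: "('n \<Rightarrow> nat) \<Rightarrow> (real ^ 'n) set" where
  "element e = box (\<chi> i. brk S L i (e i)) (\<chi> i. brk S L i (e i + 1))"

text \<open>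
  The support of a level-\<open>m\<close> spline, as a set of finest elements.
\<close>

definition touched :: "nat \<Rightarrow> ('n \<Rightarrow> nat) \<Rightarrow> ('n \<Rightarrow> nat) set" where
  "touched m j = {e \<in> elements. \<forall>i. j i \<in> touches1 i (ancestor m (e i))}"

lemma L: "1 \<le> L" using hierarchy by (simp add: spline_hierarchy_def)

lemma knot_line: "m \<in> levels \<Longrightarrow> knot_line (d i) (\<mu> i) (nint S m i) (brk S m i)"
  using hierarchy unfolding spline_hierarchy_def by unfold_locales auto

lemma spline1_eq: "m \<in> levels \<Longrightarrow> spline1 m i = knot_line.B (d i) (\<mu> i) (nint S m i) (brk S m i)"
  by (simp add: knot_line.B_def[OF knot_line] knot_line.t_def[OF knot_line] level_knots_def)

lemma spline_index_eq: "m \<in> levels \<Longrightarrow> spline_index m = {j. \<forall>i. j i \<in> {..<knot_line.nsplines (d i) (\<mu> i) (nint S m i)}}"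
  by (simp add: spline_index_def knot_line.nsplines_def[OF knot_line])

lemma touches1_eq: "m \<in> levels \<Longrightarrow> touches1 i k = knot_line.touches (d i) (\<mu> i) k"
  by (simp add: touches1_def knot_line.touches_def[OF knot_line])

lemma bsplines_eq:
  assumes "m \<in> levels"
  shows "bsplines S m = spline m ` spline_index m"
proof -
  have "length (level_knots S m i) - (d i + 1) = d i + 1 + (nint S m i - 1) * \<mu> i" for i
    using knot_line.length_t[OF knot_line[OF assms], of i]
    by (simp add: level_knots_def knot_line.t_def[OF knot_line[OF assms]] knot_line.nsplines_def[OF knot_line[OF assms]])
  then show ?thesis by (simp add: bsplines_def spline_index_def)
qed

lemma finite_spline_index: "finite (spline_index m)"
proof -
  have "spline_index m = PiE UNIV (\<lambda>i. {..<d i + 1 + (nint S m i - 1) * \<mu> i})"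
    by (auto simp: spline_index_def PiE_def)
  then show ?thesis by (simp add: finite_PiE)
qed

lemma nested_levels:
  assumes "l \<in> levels" "m \<in> levels" "l \<le> m"
  shows "nint S m i = 2 ^ (m - l) * nint S l i"
    and "k \<le> nint S l i \<Longrightarrow> brk S m i (2 ^ (m - l) * k) = brk S l i k"
proof -
  have "nint S m i = 2 ^ (m - l) * nint S l i \<and>
      (\<forall>k \<le> nint S l i. brk S m i (2 ^ (m - l) * k) = brk S l i k)"
    using assms(3,2)
  proof (induction m rule: dec_induct)
    case base
    then show ?case by simp
  next
    case (step m)
    then have m: "m \<in> {1..<L}" and IH: "nint S m i = 2 ^ (m - l) * nint S l i"
      "\<And>k. k \<le> nint S l i \<Longrightarrow> brk S m i (2 ^ (m - l) * k) = brk S l i k"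
      using assms by auto
    have b: "nint S (m + 1) i = 2 * nint S m i" "\<And>k. k \<le> nint S m i \<Longrightarrow> brk S (m + 1) i (2 * k) = brk S m i k"
      using m hierarchy unfolding spline_hierarchy_def by blast+
    have e: "Suc m - l = Suc (m - l)" using step by simp
    have "brk S (Suc m) i (2 ^ (Suc m - l) * k) = brk S l i k" if "k \<le> nint S l i" for k
      using IH(2)[OF that] b(2)[of "2 ^ (m - l) * k"] that IH(1) by (simp add: e mult.assoc)
    then show ?case using b(1) IH(1) e by simp
  qed
  then show "nint S m i = 2 ^ (m - l) * nint S l i"
    "k \<le> nint S l i \<Longrightarrow> brk S m i (2 ^ (m - l) * k) = brk S l i k" by blast+
qed

lemma knot_refinement:
  assumes "l \<in> levels" "m \<in> levels" "l \<le> m"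
  shows "knot_refinement (d i) (\<mu> i) (nint S l i) (brk S l i) (nint S m i) (brk S m i) (2 ^ (m - l))"
  using knot_line[OF assms(1)] knot_line[OF assms(2)] nested_levels[OF assms]
  by (intro knot_refinement.intro knot_refinement_axioms.intro) auto

lemma L_level: "L \<in> levels" using L by simp

lemma ancestor_element:
  assumes "m \<in> levels" "e < nint S L i"
  shows "ancestor m e < nint S m i" "brk S m i (ancestor m e) \<le> brk S L i e"
    "brk S L i (e + 1) \<le> brk S m i (ancestor m e + 1)"
  using knot_refinement.fine_element[OF knot_refinement[OF assms(1) L_level, where i = i], of e] assms
  by (auto simp: ancestor_def)

lemma ancestor_ancestor: "l \<le> m \<Longrightarrow> m \<le> L \<Longrightarrow> ancestor m e div 2 ^ (m - l) = ancestor l e"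
  by (simp add: ancestor_def div_mult2_eq[symmetric] power_add[symmetric])

lemma brk_mono: "m \<in> levels \<Longrightarrow> a \<le> b \<Longrightarrow> b \<le> nint S m i \<Longrightarrow> brk S m i a \<le> brk S m i b"
  using knot_line.z_le[OF knot_line] .

lemma brk_less: "m \<in> levels \<Longrightarrow> a < b \<Longrightarrow> b \<le> nint S m i \<Longrightarrow> brk S m i a < brk S m i b"
  using knot_line.z_less[OF knot_line] .

lemma brk_ends: "m \<in> levels \<Longrightarrow> brk S m i 0 = 0" "m \<in> levels \<Longrightarrow> brk S m i (nint S m i) = 1"
  using hierarchy unfolding spline_hierarchy_def by blast+

lemma spline_not_touched:
  assumes m: "m \<in> levels" and j: "j \<in> spline_index m" and e: "e \<in> elements" "e \<notin> touched m j"
    and x: "\<And>i. brk S L i (e i) \<le> x $ i \<and> x $ i < brk S L i (e i + 1)"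
  shows "spline m j x = 0"
proof -
  from e obtain i where i: "j i \<notin> touches1 i (ancestor m (e i))" by (auto simp: touched_def)
  have eL: "e i < nint S L i" using e by (simp add: elements_def)
  have "spline1 m i (j i) (x $ i) = 0"
    unfolding spline1_eq[OF m]
    by (rule knot_line.B_not_touching[OF knot_line[OF m] ancestor_element(1)[OF m eL]])
      (use i j x[of i] ancestor_element[OF m eL] in \<open>auto simp: spline_index_eq[OF m] touches1_eq[OF m]\<close>)
  then show ?thesis by (auto simp: tensor_bspline_def intro!: prod_zero)
qed

lemma spline_nonzero_element:
  assumes m: "m \<in> levels" and j: "j \<in> spline_index m" and nz: "spline m j x \<noteq> 0"
  obtains e where "e \<in> touched m j" "\<And>i. brk S L i (e i) \<le> x $ i \<and> x $ i < brk S L i (e i + 1)"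
proof -
  have nz1: "spline1 m i (j i) (x $ i) \<noteq> 0" for i
    using nz by (auto simp: tensor_bspline_def)
  have "x $ i \<in> {brk S m i 0..<brk S m i (nint S m i)}" for i
    using knot_line.B_outside[OF knot_line[OF m, where i = i], where j = "j i" and x = "x $ i"] nz1[of i] j
    unfolding spline1_eq[OF m] spline_index_eq[OF m] by blast
  then have "x $ i \<in> {brk S L i 0..<brk S L i (nint S L i)}" for i
    using brk_ends m L_level by simp
  then have "\<exists>k<nint S L i. x $ i \<in> {brk S L i k..<brk S L i (k + 1)}" for i
    using knot_line.element_exists[OF knot_line[OF L_level]] by metis
  then obtain e where e: "\<And>i. e i < nint S L i" "\<And>i. x $ i \<in> {brk S L i (e i)..<brk S L i (e i + 1)}"
    by metis
  then have "e \<in> elements" by (simp add: elements_def)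
  moreover have "e \<in> touched m j"
    using spline_not_touched[OF m j \<open>e \<in> elements\<close>, of x] e nz by auto
  ultimately show thesis using that e by auto
qed

text \<open>
  The sets \<open>U i\<close> may be any infinite subsets of the sides of the element, so that one statement serves
  both whole elements and small open boxes inside them.
\<close>

lemma local_indep:
  assumes m: "m \<in> levels" and e: "e \<in> elements"
    and U: "\<And>i. infinite (U i)" "\<And>i. U i \<subseteq> {brk S L i (e i)..<brk S L i (e i + 1)}"
    and c: "\<And>x. (\<And>i. x $ i \<in> U i) \<Longrightarrow> (\<Sum>j\<in>spline_index m. c j * spline m j x) = 0"
    and j: "e \<in> touched m j"
  shows "c j = 0"
proof -
  let ?T = "{j. \<forall>i. j i \<in> touches1 i (ancestor m (e i))}"
  have eL: "e i < nint S L i" for i using e by (simp add: elements_def)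
  have TJ: "?T \<subseteq> spline_index m"
    using knot_line.touches_subset[OF knot_line[OF m] ancestor_element(1)[OF m eL]]
    by (auto simp: spline_index_eq[OF m] touches1_eq[OF m])
  have ind: "indep_family (U i) (touches1 i (ancestor m (e i))) (spline1 m i)" for i
    unfolding spline1_eq[OF m] touches1_eq[OF m]
  proof (rule knot_line.indep_family_touches[OF knot_line[OF m] ancestor_element(1)[OF m eL] U(1)])
    have "{brk S L i (e i)..<brk S L i (e i + 1)} \<subseteq> {brk S m i (ancestor m (e i))..<brk S m i (ancestor m (e i) + 1)}"
      using ancestor_element(2,3)[OF m eL] by (intro ivl_subset[THEN iffD2] disjI2) blast
    then show "U i \<subseteq> {brk S m i (ancestor m (e i))..<brk S m i (ancestor m (e i) + 1)}"
      using U(2)[of i] by (rule order_trans[rotated])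
  qed
  have "indep_family {x. \<forall>i. x i \<in> U i} ?T (\<lambda>j x. \<Prod>i\<in>UNIV. spline1 m i (j i) (x i))"
    by (rule indep_family_tensor[OF _ ind]) (simp add: touches1_def)
  moreover have "(\<Sum>j\<in>?T. c j * (\<Prod>i\<in>UNIV. spline1 m i (j i) (x i))) = 0" if x: "x \<in> {x. \<forall>i. x i \<in> U i}" for x
  proof -
    let ?x = "\<chi> i. x i"
    have xU: "?x $ i \<in> U i" for i using x by simp
    have "(\<Sum>j\<in>?T. c j * (\<Prod>i\<in>UNIV. spline1 m i (j i) (x i))) = (\<Sum>j\<in>?T. c j * spline m j ?x)"
      by (simp add: tensor_bspline_def)
    also have "\<dots> = (\<Sum>j\<in>spline_index m. c j * spline m j ?x)"
    proof (intro sum.mono_neutral_left finite_spline_index TJ ballI)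
      fix j assume "j \<in> spline_index m - ?T"
      then show "c j * spline m j ?x = 0"
        using spline_not_touched[OF m _ e, of j ?x] xU U(2) by (fastforce simp: touched_def)
    qed
    finally show ?thesis using c[of ?x] xU by simp
  qed
  ultimately show ?thesis using j by (intro indep_familyD[of _ ?T]) (auto simp: touched_def)
qed

lemma element_coords: "x \<in> element e \<longleftrightarrow> (\<forall>i. brk S L i (e i) < x $ i \<and> x $ i < brk S L i (e i + 1))"
  by (simp add: element_def mem_box_cart)

lemma local_indep_element:
  assumes m: "m \<in> levels"
    and c: "\<And>x. x \<in> element e \<Longrightarrow> (\<Sum>j\<in>spline_index m. c j * spline m j x) = 0"
    and j: "e \<in> touched m j"
  shows "c j = 0"
proof (rule local_indep[OF m _ _ _ _ j])
  show e: "e \<in> elements" using j by (simp add: touched_def)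
  let ?U = "\<lambda>i. {brk S L i (e i)<..<brk S L i (e i + 1)}"
  show "infinite (?U i)" for i
    using brk_less[OF L_level, of "e i" "e i + 1" i] e by (simp add: elements_def infinite_Ioo Suc_le_eq)
  show "?U i \<subseteq> {brk S L i (e i)..<brk S L i (e i + 1)}" for i by auto
  fix x assume "\<And>i. x $ i \<in> ?U i"
  then show "(\<Sum>j\<in>spline_index m. c j * spline m j x) = 0" by (intro c) (simp add: element_coords)
qed

lemma indep_family_spline:
  assumes m: "m \<in> levels"
  shows "indep_family UNIV (spline_index m) (spline m)"
proof (rule indep_familyI)
  fix c j assume c: "\<And>x. x \<in> UNIV \<Longrightarrow> (\<Sum>j\<in>spline_index m. c j * spline m j x) = 0" and j: "j \<in> spline_index m"
  have "indep_family {x. \<forall>i::'n. x i \<in> (UNIV :: real set)} (spline_index m) (\<lambda>j x. \<Prod>i\<in>UNIV. spline1 m i (j i) (x i))"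
    unfolding spline_index_eq[OF m] spline1_eq[OF m]
    by (intro indep_family_tensor knot_line.indep_family_B[OF knot_line[OF m]]) auto
  moreover have "(\<Sum>j\<in>spline_index m. c j * (\<Prod>i\<in>UNIV. spline1 m i (j i) (x i))) = 0" for x
    using c[of "\<chi> i. x i"] by (simp add: tensor_bspline_def)
  ultimately show "c j = 0" using j by (intro indep_familyD[of _ "spline_index m"]) auto
qed

lemma restr_UNIV: "restr UNIV f = f" by (simp add: restr_def)

lemma inj_on_spline: "m \<in> levels \<Longrightarrow> inj_on (spline m) (spline_index m)"
  and independent_bsplines: "m \<in> levels \<Longrightarrow> independent (bsplines S m)"
  using indep_family_spline[of m] indep_family_iff[OF finite_spline_index, of UNIV m "spline m"]
  by (simp_all add: restr_UNIV bsplines_eq)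

definition comb :: "nat \<Rightarrow> (('n \<Rightarrow> nat) \<Rightarrow> real) \<Rightarrow> real ^ 'n \<Rightarrow> real" where
  "comb m a = (\<Sum>j\<in>spline_index m. a j *\<^sub>R spline m j)"

lemma comb_apply: "comb m a x = (\<Sum>j\<in>spline_index m. a j * spline m j x)"
  by (simp add: comb_def sum_fun_apply scaleR_fun_apply)

lemma representation_comb:
  assumes m: "m \<in> levels" and j: "j \<in> spline_index m"
  shows "representation (bsplines S m) (comb m a) (spline m j) = a j"
proof -
  let ?B = "bsplines S m"
  note ind = independent_bsplines[OF m]
  have inB: "spline m k \<in> ?B" if "k \<in> spline_index m" for k using that by (simp add: bsplines_eq[OF m])
  have "representation ?B (comb m a) (spline m j) =
      (\<Sum>k\<in>spline_index m. representation ?B (a k *\<^sub>R spline m k) (spline m j))"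
    unfolding comb_def
    by (subst real_vector.representation_sum[OF ind]) (auto intro: span_scale span_base inB)
  also have "\<dots> = (\<Sum>k\<in>spline_index m. if k = j then a k else 0)"
  proof (intro sum.cong refl)
    fix k assume k: "k \<in> spline_index m"
    have "representation ?B (a k *\<^sub>R spline m k) (spline m j) = a k * (if spline m j = spline m k then 1 else 0)"
      using real_vector.representation_scale[OF ind span_base[OF inB[OF k]], of "a k"]
        real_vector.representation_basis[OF ind inB[OF k]] by simp
    then show "representation ?B (a k *\<^sub>R spline m k) (spline m j) = (if k = j then a k else 0)"
      using inj_on_spline[OF m] k j by (auto simp: inj_on_eq_iff)
  qed
  also have "\<dots> = a j" using j finite_spline_index by simp
  finally show ?thesis .
qed

definition covered :: "nat \<Rightarrow> ('n \<Rightarrow> nat) set \<Rightarrow> bool" where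
  "covered l E \<longleftrightarrow> (\<forall>e\<in>E. element e \<subseteq> \<Psi> l)"

text \<open>
  The closed support is the union of the closures of the touched elements: by local independence a
  spline cannot vanish on any open part of an element that it touches.
\<close>

lemma supp_spline_subset_iff:
  assumes m: "m \<in> levels" and j: "j \<in> spline_index m" and A: "closed A"
  shows "supp (spline m j) \<subseteq> A \<longleftrightarrow> (\<forall>e\<in>touched m j. element e \<subseteq> A)"
proof
  assume sub: "supp (spline m j) \<subseteq> A"
  show "\<forall>e\<in>touched m j. element e \<subseteq> A"
  proof
    fix e assume e: "e \<in> touched m j"
    then have elements: "e \<in> elements" by (simp add: touched_def)
    have "element e \<subseteq> closure {x. spline m j x \<noteq> 0}"
    proof
      fix x assume x: "x \<in> element e"
      show "x \<in> closure {x. spline m j x \<noteq> 0}"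
      proof (rule ccontr)
        assume n: "x \<notin> closure {x. spline m j x \<noteq> 0}"
        have "open (element e - closure {x. spline m j x \<noteq> 0})"
          by (intro open_Diff) (auto simp: element_def)
        then obtain a b where ab: "x \<in> box a b" "box a b \<subseteq> element e - closure {x. spline m j x \<noteq> 0}"
          using x n by (metis Diff_iff open_contains_box)
        have z: "spline m j y = 0" if "y \<in> box a b" for y
          using that ab(2) closure_subset[of "{x. spline m j x \<noteq> 0}"]
          by (metis (mono_tags) Diff_iff mem_Collect_eq subsetD)
        define U where "U i = {a $ i<..<b $ i}" for i
        have ne: "a $ i < b $ i" for i using ab(1) unfolding mem_box_cart by (meson less_trans)
        have yU: "y \<in> box a b \<longleftrightarrow> (\<forall>i. y $ i \<in> U i)" for y by (auto simp: mem_box_cart U_def)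
        have Ui: "U i \<subseteq> {brk S L i (e i)..<brk S L i (e i + 1)}" for i
        proof
          fix s assume s: "s \<in> U i"
          let ?y = "\<chi> k. if k = i then s else x $ k"
          have "?y \<in> box a b" using ab(1) s by (auto simp: mem_box_cart U_def)
          then have "?y \<in> element e" using ab(2) by blast
          then show "s \<in> {brk S L i (e i)..<brk S L i (e i + 1)}"
            unfolding element_coords by (auto dest!: spec[of _ i])
        qed
        \<comment> \<open>A single spline is a combination with one coefficient equal to 1.\<close>
        have "(if j = j then 1 else 0 :: real) = 0"
        proof (rule local_indep[OF m elements _ Ui _ e, where c = "\<lambda>k. if k = j then 1 else 0"])
          show "infinite (U i)" for i using ne[of i] by (simp add: U_def infinite_Ioo)
          fix y assume "\<And>i. y $ i \<in> U i"
          then have "spline m j y = 0" using z yU by blast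
          moreover have "(\<Sum>k\<in>spline_index m. (if k = j then 1 else 0) * spline m k y) = spline m j y"
            using j finite_spline_index by (simp add: if_distrib[of "\<lambda>u. u * _"] cong: if_cong)
          ultimately show "(\<Sum>k\<in>spline_index m. (if k = j then 1 else 0) * spline m k y) = 0" by simp
        qed
        then show False by simp
      qed
    qed
    then have "element e \<subseteq> supp (spline m j)"
      unfolding supp_def by (intro interior_maximal) (auto simp: element_def)
    then show "element e \<subseteq> A" using sub by blast
  qed
next
  assume element: "\<forall>e\<in>touched m j. element e \<subseteq> A"
  have "x \<in> A" if nz: "spline m j x \<noteq> 0" for x
  proof -
    obtain e where e: "e \<in> touched m j" "\<And>i. brk S L i (e i) \<le> x $ i \<and> x $ i < brk S L i (e i + 1)"
      by (rule spline_nonzero_element[OF m j nz]) blast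
    have "brk S L i (e i) < brk S L i (e i + 1)" for i
      using e(2)[of i] by linarith
    then have ne: "element e \<noteq> {}" by (simp add: element_def interval_ne_empty_cart)
    have "x \<in> cbox (\<chi> i. brk S L i (e i)) (\<chi> i. brk S L i (e i + 1))"
      using e(2) by (auto simp: mem_box_cart intro: less_imp_le)
    also have "\<dots> = closure (element e)" using ne closure_box unfolding element_def by blast
    also have "\<dots> \<subseteq> A" using element e(1) A by (intro closure_minimal) auto
    finally show ?thesis .
  qed
  then have "closure {x. spline m j x \<noteq> 0} \<subseteq> A" using A by (intro closure_minimal) auto
  then show "supp (spline m j) \<subseteq> A" unfolding supp_def using interior_subset by blast
qed

lemma closed_domain: "m \<in> levels \<Longrightarrow> closed (\<Psi> m)"
  using domains by (simp add: domain_hierarchy_def)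

lemma domain_mono: "l \<in> levels \<Longrightarrow> m \<in> levels \<Longrightarrow> l \<le> m \<Longrightarrow> \<Psi> m \<subseteq> \<Psi> l"
proof -
  assume lm: "l \<in> levels" "m \<in> levels" "l \<le> m"
  show ?thesis
    using lm(3,2)
  proof (induction m rule: dec_induct)
    case (step m)
    then have "m \<in> {1..<L}" using lm(1) by auto
    then have "\<Psi> (m + 1) \<subseteq> \<Psi> m" using domains unfolding domain_hierarchy_def by blast
    then show ?case using step lm(1) by fastforce
  qed simp
qed

lemma trunc_comb:
  assumes m: "m \<in> levels"
  shows "trunc S \<Psi> m (comb m a) = comb m (\<lambda>j. if covered m (touched m j) then 0 else a j)"
proof -
  have ex: "bsplines_ex S \<Psi> m m = spline m ` {j \<in> spline_index m. \<not> covered m (touched m j)}"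
    using supp_spline_subset_iff[OF m _ closed_domain[OF m]]
    by (auto simp: bsplines_ex_def bsplines_in_def bsplines_eq[OF m] covered_def)
  have "trunc S \<Psi> m (comb m a) = (\<Sum>j\<in>{j \<in> spline_index m. \<not> covered m (touched m j)}. a j *\<^sub>R spline m j)"
    unfolding trunc_def ex
    by (subst sum.reindex) (auto intro: inj_on_subset[OF inj_on_spline[OF m]] simp: representation_comb[OF m])
  also have "\<dots> = comb m (\<lambda>j. if covered m (touched m j) then 0 else a j)"
    unfolding comb_def using finite_spline_index by (intro sum.mono_neutral_cong_left) auto
  finally show ?thesis .
qed

text \<open>
  The level-\<open>m\<close> splines whose coefficients live on B-splines with support in the class \<open>G\<close>. For a class
  closed under shrinking the support, these spaces grow with the level and are preserved by truncation;
  this turns statements about iterated truncation into membership statements.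
\<close>

definition spline_space :: "nat \<Rightarrow> (('n \<Rightarrow> nat) set \<Rightarrow> bool) \<Rightarrow> (real ^ 'n \<Rightarrow> real) set" where
  "spline_space m G = span (spline m ` {j \<in> spline_index m. G (touched m j)})"

lemma in_spline_space_iff: "f \<in> spline_space m G \<longleftrightarrow> (\<exists>a. f = comb m a \<and> (\<forall>j\<in>spline_index m. \<not> G (touched m j) \<longrightarrow> a j = 0))"
proof -
  have fin: "finite {j \<in> spline_index m. G (touched m j)}" using finite_spline_index by simp
  have 1: "(\<Sum>j\<in>{j \<in> spline_index m. G (touched m j)}. a j *\<^sub>R spline m j) =
      comb m (\<lambda>j. if G (touched m j) then a j else 0)" for a
    unfolding comb_def using finite_spline_index by (intro sum.mono_neutral_cong_left) auto
  have 2: "comb m a = comb m (\<lambda>j. if G (touched m j) then a j else 0)"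
    if "\<forall>j\<in>spline_index m. \<not> G (touched m j) \<longrightarrow> a j = 0" for a
    unfolding comb_def using that by (intro sum.cong) auto
  have "f \<in> spline_space m G \<longleftrightarrow> (\<exists>a. f = comb m (\<lambda>j. if G (touched m j) then a j else 0))"
    unfolding spline_space_def in_span_image_iff[OF fin] 1 ..
  also have "\<dots> \<longleftrightarrow> (\<exists>a. f = comb m a \<and> (\<forall>j\<in>spline_index m. \<not> G (touched m j) \<longrightarrow> a j = 0))"
  proof
    assume "\<exists>a. f = comb m (\<lambda>j. if G (touched m j) then a j else 0)"
    then obtain a where "f = comb m (\<lambda>j. if G (touched m j) then a j else 0)" ..
    then show "\<exists>a. f = comb m a \<and> (\<forall>j\<in>spline_index m. \<not> G (touched m j) \<longrightarrow> a j = 0)"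
      by (intro exI[of _ "\<lambda>j. if G (touched m j) then a j else 0"]) simp
  next
    assume "\<exists>a. f = comb m a \<and> (\<forall>j\<in>spline_index m. \<not> G (touched m j) \<longrightarrow> a j = 0)"
    then obtain a where "f = comb m a" "\<forall>j\<in>spline_index m. \<not> G (touched m j) \<longrightarrow> a j = 0" by blast
    then show "\<exists>a. f = comb m (\<lambda>j. if G (touched m j) then a j else 0)"
      using 2[of a] by metis
  qed
  finally show ?thesis .
qed

lemma spline_space_diff: "f \<in> spline_space m G \<Longrightarrow> g \<in> spline_space m G \<Longrightarrow> f - g \<in> spline_space m G"
  and spline_space_add: "f \<in> spline_space m G \<Longrightarrow> g \<in> spline_space m G \<Longrightarrow> f + g \<in> spline_space m G"
  and spline_space_scale: "f \<in> spline_space m G \<Longrightarrow> c *\<^sub>R f \<in> spline_space m G"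
  and spline_space_sum: "(\<And>i. i \<in> I \<Longrightarrow> h i \<in> spline_space m G) \<Longrightarrow> (\<Sum>i\<in>I. h i) \<in> spline_space m G"
  and spline_space_zero: "0 \<in> spline_space m G"
  unfolding spline_space_def by (simp_all add: span_diff span_add span_scale span_sum span_zero)

lemma spline_space_imp: "(\<And>X. G X \<Longrightarrow> G' X) \<Longrightarrow> spline_space m G \<subseteq> spline_space m G'"
  unfolding spline_space_def by (intro span_mono) auto

lemma spline_in_spline_space: "j \<in> spline_index m \<Longrightarrow> G (touched m j) \<Longrightarrow> spline m j \<in> spline_space m G"
  unfolding spline_space_def by (auto intro: span_base)

definition refinement_coeff :: "nat \<Rightarrow> nat \<Rightarrow> 'n \<Rightarrow> nat \<Rightarrow> nat \<Rightarrow> real" where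
  "refinement_coeff l m i = knot_refinement.R (d i) (\<mu> i) (nint S l i) (brk S l i) (nint S m i) (brk S m i)"

lemma refinement_coeff_touches:
  assumes "l \<in> levels" "m \<in> levels" "l \<le> m" "j < d i + 1 + (nint S l i - 1) * \<mu> i" "refinement_coeff l m i j h \<noteq> 0"
    and "e < nint S L i" "h \<in> touches1 i (ancestor m e)"
  shows "j \<in> touches1 i (ancestor l e)"
proof -
  have "j \<in> knot_line.touches (d i) (\<mu> i) (ancestor m e div 2 ^ (m - l))"
    by (rule knot_refinement.R_touches[OF knot_refinement[OF assms(1-3)], of _ i])
      (use assms ancestor_element in \<open>auto simp: refinement_coeff_def knot_line.nsplines_def[OF knot_line] touches1_eq[OF assms(1), symmetric]\<close>)
  then show ?thesis using assms by (simp add: touches1_eq[of l] ancestor_ancestor)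
qed

lemma spline_refinement:
  assumes "l \<in> levels" "m \<in> levels" "l \<le> m" "j \<in> spline_index l"
  shows "spline l j = comb m (\<lambda>h. \<Prod>i\<in>UNIV. refinement_coeff l m i (j i) (h i))"
proof
  fix x
  have Jm: "spline_index m = PiE UNIV (\<lambda>i. {..<knot_line.nsplines (d i) (\<mu> i) (nint S m i)})"
    by (auto simp: spline_index_eq[OF assms(2)] PiE_def)
  have "spline l j x = (\<Prod>i\<in>UNIV. \<Sum>h<knot_line.nsplines (d i) (\<mu> i) (nint S m i). refinement_coeff l m i (j i) h * spline1 m i h (x $ i))"
    unfolding tensor_bspline_def
    using knot_refinement.R[OF knot_refinement[OF assms(1-3)]] assms(4)
    by (intro prod.cong) (auto simp: spline1_eq[OF assms(1)] spline1_eq[OF assms(2)] refinement_coeff_def spline_index_eq[OF assms(1)])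
  also have "\<dots> = (\<Sum>h\<in>spline_index m. \<Prod>i\<in>UNIV. refinement_coeff l m i (j i) (h i) * spline1 m i (h i) (x $ i))"
    unfolding Jm by (rule prod_sum_PiE) auto
  also have "\<dots> = comb m (\<lambda>h. \<Prod>i\<in>UNIV. refinement_coeff l m i (j i) (h i)) x"
    by (simp add: comb_apply prod.distrib tensor_bspline_def)
  finally show "spline l j x = comb m (\<lambda>h. \<Prod>i\<in>UNIV. refinement_coeff l m i (j i) (h i)) x" .
qed

text \<open>
  By local independence, the expansion of a function that vanishes on an element uses no spline
  touching that element.
\<close>

lemma touched_refinement:
  assumes "l \<in> levels" "m \<in> levels" "l \<le> m" "j \<in> spline_index l" "(\<Prod>i\<in>UNIV. refinement_coeff l m i (j i) (h i)) \<noteq> 0"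
  shows "touched m h \<subseteq> touched l j"
proof
  fix e assume e: "e \<in> touched m h"
  have "j i \<in> touches1 i (ancestor l (e i))" for i
    by (rule refinement_coeff_touches[OF assms(1-3)]) (use assms(4,5) e in \<open>auto simp: touched_def elements_def spline_index_def\<close>)
  then show "e \<in> touched l j" using e by (simp add: touched_def)
qed

lemma spline_space_level_mono:
  assumes "l \<in> levels" "m \<in> levels" "l \<le> m" and G: "antimono G"
  shows "spline_space l G \<subseteq> spline_space m G"
proof -
  have "spline l j \<in> spline_space m G" if "j \<in> spline_index l" "G (touched l j)" for j
    unfolding in_spline_space_iff
  proof (intro exI conjI ballI impI)
    show "spline l j = comb m (\<lambda>h. \<Prod>i\<in>UNIV. refinement_coeff l m i (j i) (h i))"
      by (rule spline_refinement[OF assms(1-3) that(1)])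
    fix h assume h: "\<not> G (touched m h)"
    show "(\<Prod>i\<in>UNIV. refinement_coeff l m i (j i) (h i)) = 0"
    proof (rule ccontr)
      assume "(\<Prod>i\<in>UNIV. refinement_coeff l m i (j i) (h i)) \<noteq> 0"
      then have "touched m h \<subseteq> touched l j" by (rule touched_refinement[OF assms(1-3) that(1)])
      from antimonoD[OF G this] h that(2) show False by simp
    qed
  qed
  then have "spline l ` {j \<in> spline_index l. G (touched l j)} \<subseteq> spline_space m G" by auto
  then show ?thesis unfolding spline_space_def[of l] by (intro span_minimal) (auto simp: spline_space_def)
qed

lemma trunc_in_spline_space:
  assumes "m \<in> levels" "f \<in> spline_space m G" shows "trunc S \<Psi> m f \<in> spline_space m G"
  using assms trunc_comb[OF assms(1)] by (fastforce simp: in_spline_space_iff)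

text \<open>
  Truncation removes only components supported in the domain \<open>\<Omega>\<^sub>m\<close>.
\<close>

lemma trunc_diff_in_spline_space:
  assumes m: "m \<in> levels" and f: "f \<in> spline_space m (\<lambda>_. True)" and G: "\<And>X. X \<subseteq> elements \<Longrightarrow> covered m X \<Longrightarrow> G X"
  shows "trunc S \<Psi> m f - f \<in> spline_space m G"
proof -
  obtain a where a: "f = comb m a" using f by (auto simp: in_spline_space_iff)
  have "trunc S \<Psi> m f - f = comb m (\<lambda>j. if covered m (touched m j) then - a j else 0)"
    unfolding a trunc_comb[OF m] unfolding comb_def sum_subtractf[symmetric]
    by (intro sum.cong) auto
  then show ?thesis using G unfolding in_spline_space_iff
    by (intro exI[of _ "\<lambda>j. if covered m (touched m j) then - a j else 0"]) (auto simp: touched_def)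
qed

fun trunc_chain :: "nat \<Rightarrow> (real ^ 'n \<Rightarrow> real) \<Rightarrow> nat \<Rightarrow> real ^ 'n \<Rightarrow> real" where
  "trunc_chain k f 0 = f"
| "trunc_chain k f (Suc n) = trunc S \<Psi> (k + Suc n) (trunc_chain k f n)"

text \<open>
  The function that the B-spline \<open>j\<close> of level \<open>k\<close> becomes after truncation at all finer levels.
\<close>

definition thb_spline :: "nat \<Rightarrow> ('n \<Rightarrow> nat) \<Rightarrow> real ^ 'n \<Rightarrow> real" where
  "thb_spline k j = trunc_chain k (spline k j) (L - k)"

lemma trunc_chain_in_spline_space:
  assumes G: "antimono G" and k: "k \<in> levels" "k + n \<le> L"
    and f: "trunc_chain k f n0 \<in> spline_space (k + n0) G" "n0 \<le> n"
  shows "trunc_chain k f n \<in> spline_space (k + n) G"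
  using f(2) k(2)
proof (induction n rule: dec_induct)
  case (step n)
  then have "trunc_chain k f n \<in> spline_space (k + n) G" by simp
  then have "trunc_chain k f n \<in> spline_space (k + Suc n) G"
    using spline_space_level_mono[of "k + n" "k + Suc n" G] G k step.prems by auto
  then show ?case using trunc_in_spline_space k step.prems by simp
qed (use f in simp)

lemma thb_spline_in_spline_space:
  assumes "k \<in> levels" "j \<in> spline_index k" "antimono G" "G (touched k j)"
  shows "thb_spline k j \<in> spline_space L G"
  using trunc_chain_in_spline_space[OF assms(3,1), of "L - k" "spline k j" 0] assms spline_in_spline_space[of j k G]
  by (simp add: thb_spline_def)

text \<open>
  Modulo components supported in the refined domains, nothing is changed by truncation.
\<close>

lemma thb_spline_diff_in_spline_space:
  assumes k: "k \<in> levels" and j: "j \<in> spline_index k" and G: "antimono G"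
    and Gin: "\<And>m X. m \<in> levels \<Longrightarrow> k < m \<Longrightarrow> X \<subseteq> elements \<Longrightarrow> covered m X \<Longrightarrow> G X"
  shows "thb_spline k j - spline k j \<in> spline_space L G"
proof -
  have "trunc_chain k (spline k j) n - spline k j \<in> spline_space (k + n) G" if "k + n \<le> L" for n
    using that
  proof (induction n)
    case 0
    show ?case using spline_space_zero[of k G] by (simp add: zero_fun_def)
  next
    case (Suc n)
    let ?f = "trunc_chain k (spline k j) n"
    have lv: "k + n \<in> levels" "k + Suc n \<in> levels" using k Suc.prems by auto
    have "?f - spline k j \<in> spline_space (k + Suc n) G"
    proof (rule subsetD[OF spline_space_level_mono[OF lv _ G]])
      show "?f - spline k j \<in> spline_space (k + n) G" by (rule Suc.IH) (use Suc.prems in linarith)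
    qed simp
    moreover have "?f \<in> spline_space (k + Suc n) (\<lambda>_. True)"
    proof -
      have "?f \<in> spline_space (k + n) (\<lambda>_. True)"
        using trunc_chain_in_spline_space[OF _ k, of "\<lambda>_. True" n "spline k j" 0] spline_in_spline_space[OF j, of "\<lambda>_. True"] Suc.prems
        by (simp add: monotone_on_def)
      then show ?thesis using spline_space_level_mono[OF lv, of "\<lambda>_. True"] by (auto simp: monotone_on_def)
    qed
    then have "trunc S \<Psi> (k + Suc n) ?f - ?f \<in> spline_space (k + Suc n) G"
      using Gin[OF lv(2)] by (intro trunc_diff_in_spline_space lv) auto
    ultimately have "(trunc S \<Psi> (k + Suc n) ?f - ?f) + (?f - spline k j) \<in> spline_space (k + Suc n) G"
      by (rule spline_space_add[rotated])
    moreover have "(f - g) + (g - h) = f - h" for f g h :: "real ^ 'n \<Rightarrow> real" by (rule ext) simp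
    ultimately show ?case by (simp only: trunc_chain.simps)
  qed
  from this[of "L - k"] k show ?thesis by (simp add: thb_spline_def)
qed

lemma element_subset_domain_1:
  assumes e: "e \<in> elements" shows "element e \<subseteq> \<Psi> 1"
proof -
  have "element e \<subseteq> closure unit_cube"
      proof
        fix x assume x: "x \<in> element e"
        have "0 \<le> brk S L i (e i)" "brk S L i (e i + 1) \<le> 1" for i
          using brk_mono[OF L_level, of 0 "e i" i] brk_mono[OF L_level, of "e i + 1" "nint S L i" i]
            brk_ends[OF L_level, of i] e by (simp_all add: elements_def Suc_le_eq less_imp_le)
        then have "0 < x $ i \<and> x $ i < 1" for i
          using x le_less_trans less_le_trans unfolding element_coords by blast
        then have "x \<in> unit_cube" by (simp add: unit_cube_def mem_box_cart)
        then show "x \<in> closure unit_cube" using closure_subset by blast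
      qed
  moreover have "\<Psi> 1 = closure unit_cube" using domains by (simp add: domain_hierarchy_def)
  ultimately show ?thesis by simp
qed

text \<open>
  Independence passes to subfamilies, so it is enough to bound the THB-spline basis from above by a
  family that is indexed without reference to supports of truncated functions.
\<close>

lemma thb_subset: "thb S \<Psi> \<subseteq> {thb_spline k j | k j. k \<in> levels \<and> j \<in> spline_index k \<and> covered k (touched k j)}"
proof -
  have ins: "{B \<in> bsplines S m. supp B \<subseteq> \<Psi> m} \<subseteq> {spline m j | j. j \<in> spline_index m \<and> covered m (touched m j)}"
    if m: "m \<in> levels" for m
    using supp_spline_subset_iff[OF m _ closed_domain[OF m]]
    by (auto simp: bsplines_eq[OF m] covered_def)
  have "thb_upto S \<Psi> m \<subseteq>
    {trunc_chain k (spline k j) (m - k) | k j. k \<in> {1..m} \<and> j \<in> spline_index k \<and> covered k (touched k j)}"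
    if "m \<le> L" "1 \<le> m" for m
    using that(2,1)
  proof (induction m rule: dec_induct)
    case base
    have 1: "1 \<in> levels" using L by simp
    have "covered 1 (touched 1 j)" for j
      using element_subset_domain_1 by (auto simp: covered_def touched_def)
    then show ?case using bsplines_eq[OF 1] by (fastforce simp: numeral_eq_Suc)
  next
    case (step m)
    have lv: "Suc m \<in> levels" using step by auto
    obtain m' where m': "m = Suc m'" using step by (cases m) auto
    have "trunc S \<Psi> (Suc m) f \<in>
      {trunc_chain k (spline k j) (Suc m - k) | k j. k \<in> {1..Suc m} \<and> j \<in> spline_index k \<and> covered k (touched k j)}"
      if "f \<in> thb_upto S \<Psi> m" for f
    proof -
      from that step obtain k j where k: "f = trunc_chain k (spline k j) (m - k)" "k \<in> {1..m}" "j \<in> spline_index k" "covered k (touched k j)"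
        by (auto 0 3)
      then have "trunc S \<Psi> (Suc m) f = trunc_chain k (spline k j) (Suc m - k)"
        by (simp add: Suc_diff_le)
      then show ?thesis using k by (auto intro!: exI[of _ k] exI[of _ j])
    qed
    moreover have "bsplines_in S \<Psi> (Suc m) (Suc m) \<subseteq>
      {trunc_chain k (spline k j) (Suc m - k) | k j. k \<in> {1..Suc m} \<and> j \<in> spline_index k \<and> covered k (touched k j)}"
    proof
      fix f assume "f \<in> bsplines_in S \<Psi> (Suc m) (Suc m)"
      then obtain j where j: "f = spline (Suc m) j" "j \<in> spline_index (Suc m)" "covered (Suc m) (touched (Suc m) j)"
        using ins[OF lv] by (auto simp: bsplines_in_def)
      then show "f \<in> {trunc_chain k (spline k j) (Suc m - k) | k j. k \<in> {1..Suc m} \<and> j \<in> spline_index k \<and> covered k (touched k j)}"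
        by (auto intro!: exI[of _ "Suc m"] exI[of _ j])
    qed
    ultimately show ?case unfolding m' thb_upto.simps by blast
  qed
  from this[of L] L show ?thesis unfolding thb_def thb_spline_def by auto
qed

lemma vanishing_in_spline_space:
  assumes f: "f \<in> spline_space L (\<lambda>_. True)" and E: "E \<subseteq> elements" and z: "\<And>e x. e \<in> E \<Longrightarrow> x \<in> element e \<Longrightarrow> f x = 0"
  shows "f \<in> spline_space L (\<lambda>X. X \<inter> E = {})"
proof -
  obtain a where a: "f = comb L a" using f by (auto simp: in_spline_space_iff)
  have "a j = 0" if "e \<in> touched L j" "e \<in> E" for j e
    using local_indep_element[OF L_level _ that(1), of a] z[OF that(2)] unfolding a comb_apply by blast
  then show ?thesis unfolding in_spline_space_iff a by blast
qed

lemma spline_space_vanishing: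
  assumes m: "m \<in> levels" and f: "f \<in> spline_space m (\<lambda>X. X \<inter> E = {})" and e: "e \<in> E" "e \<in> elements"
    and x: "\<And>i. brk S L i (e i) \<le> x $ i \<and> x $ i < brk S L i (e i + 1)"
  shows "f x = 0"
proof -
  obtain a where a: "f = comb m a" "\<And>j. j \<in> spline_index m \<Longrightarrow> touched m j \<inter> E \<noteq> {} \<Longrightarrow> a j = 0"
    using f by (auto simp: in_spline_space_iff)
  have "a j * spline m j x = 0" if "j \<in> spline_index m" for j
    using spline_not_touched[OF m that e(2) _ x] a(2)[OF that] e(1) by (cases "e \<in> touched m j") auto
  then show ?thesis unfolding a(1) comb_apply by (intro sum.neutral) blast
qed

end

section \<open>Boxes and refinement domains\<close>

locale box_setting = thb_setting S \<eta> \<Psi> for S :: "'n::finite spline_data" and \<eta> \<Psi> +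
  assumes deg_pos: "\<And>i. 1 \<le> deg S i"
    and compatible: "qbox_compatible S (deg S) \<Psi>"
begin

text \<open>
  The level-\<open>k\<close> box containing a finest element, by its index.
\<close>

definition box_of :: "nat \<Rightarrow> ('n \<Rightarrow> nat) \<Rightarrow> 'n \<Rightarrow> nat" where
  "box_of k e = (\<lambda>i. ancestor k (e i) div d i)"

definition box_elements :: "nat \<Rightarrow> ('n \<Rightarrow> nat) \<Rightarrow> ('n \<Rightarrow> nat) set" where
  "box_elements k r = {e \<in> elements. box_of k e = r}"

lemma box_elements_subset: "box_elements k r \<subseteq> elements" by (auto simp: box_elements_def)

lemma div_d_bounds: "x div d i = r \<Longrightarrow> r * d i \<le> x \<and> x < (r + 1) * d i"
  using deg_pos[of i] by (auto simp: dividend_less_div_times div_times_less_eq_dividend)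

lemma box_range:
  assumes k: "k \<in> levels" and r: "r < nint S k i div d i"
  shows "(r + 1) * d i \<le> nint S k i"
proof -
  obtain R where R: "nint S k i = d i * R" using compatible k unfolding qbox_compatible_def by blast
  then have "r + 1 \<le> R" using r deg_pos[of i] by simp
  then show ?thesis unfolding R by (metis mult.commute mult_le_mono1)
qed

lemma box_of_is_qbox:
  assumes k: "k \<in> levels" and e: "e \<in> elements"
  shows "is_qbox S d k (box_of k e)"
proof -
  have "ancestor k (e i) div d i < nint S k i div d i" for i
  proof -
    obtain R where R: "nint S k i = d i * R" using compatible k unfolding qbox_compatible_def by blast
    have "ancestor k (e i) < R * d i" using ancestor_element(1)[OF k, of "e i" i] e R by (simp add: elements_def mult.commute)
    then show ?thesis using R deg_pos[of i] by (simp add: less_mult_imp_div_less)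
  qed
  then show ?thesis using k by (simp add: is_qbox_def box_of_def)
qed

lemma brk_less_iff:
  "m \<in> levels \<Longrightarrow> a \<le> nint S m i \<Longrightarrow> b \<le> nint S m i \<Longrightarrow> brk S m i a < brk S m i b \<longleftrightarrow> a < b"
  using brk_less[of m a b i] brk_mono[of m b a i] by force

lemma region_coords: "x \<in> region S d k r \<longleftrightarrow>
    (\<forall>i. brk S k i (r i * d i) < x $ i \<and> x $ i < brk S k i ((r i + 1) * d i))"
  by (simp add: region_def mem_box_cart)

lemma closure_region_coords:
  assumes "x \<in> closure (region S d k r)"
  shows "brk S k i (r i * d i) \<le> x $ i \<and> x $ i \<le> brk S k i ((r i + 1) * d i)"
proof -
  have "closure (region S d k r) \<subseteq> cbox (\<chi> i. brk S k i (r i * d i)) (\<chi> i. brk S k i ((r i + 1) * d i))"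
    unfolding region_def by (intro closure_minimal box_subset_cbox closed_cbox)
  then show ?thesis using assms by (auto simp: mem_box_cart)
qed

lemma region_elements:
  assumes q: "is_qbox S d k r" and x: "x \<in> region S d k r"
  obtains e where "e \<in> box_elements k r" "\<And>i. brk S L i (e i) \<le> x $ i \<and> x $ i < brk S L i (e i + 1)"
proof -
  have k: "k \<in> levels" and rr: "\<And>i. (r i + 1) * d i \<le> nint S k i"
    using q box_range by (auto simp: is_qbox_def)
  have "\<exists>e. e < nint S L i \<and> brk S L i e \<le> x $ i \<and> x $ i < brk S L i (e + 1) \<and> ancestor k e div d i = r i" for i
  proof -
    have xi: "brk S k i (r i * d i) < x $ i" "x $ i < brk S k i ((r i + 1) * d i)"
      using x by (auto simp: region_coords)
    have le: "r i * d i \<le> nint S k i" using rr[of i] by simp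
    have "0 \<le> x $ i" using xi brk_mono[OF k, of 0 "r i * d i" i] brk_ends[OF k, of i] le by simp
    moreover have "x $ i < 1" using xi brk_mono[OF k rr[of i] order_refl] brk_ends[OF k, of i] by simp
    ultimately have "x $ i \<in> {brk S L i 0..<brk S L i (nint S L i)}" using brk_ends[OF L_level] by simp
    then obtain e where e: "e < nint S L i" "x $ i \<in> {brk S L i e..<brk S L i (e + 1)}"
      using knot_line.element_exists[OF knot_line[OF L_level]] by metis
    note a = ancestor_element[OF k e(1)]
    have "brk S k i (ancestor k e) < brk S k i ((r i + 1) * d i)" using a(2) e(2) xi by simp
    then have 1: "ancestor k e < (r i + 1) * d i" using brk_less_iff[OF k _ rr[of i]] a(1) by simp
    have "brk S k i (r i * d i) < brk S k i (ancestor k e + 1)" using a(3) e(2) xi by simp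
    then have "r i * d i < ancestor k e + 1" using brk_less_iff[OF k le] a(1) by simp
    then have "ancestor k e div d i = r i" using 1 by (intro div_nat_eq_range) auto
    then show ?thesis using e by auto
  qed
  then obtain e where e: "\<And>i. e i < nint S L i \<and> brk S L i (e i) \<le> x $ i \<and> x $ i < brk S L i (e i + 1) \<and> ancestor k (e i) div d i = r i"
    by metis
  then show thesis using that[of e] by (auto simp: box_elements_def elements_def box_of_def)
qed

lemma element_subset_region:
  assumes k: "k \<in> levels" and e: "e \<in> box_elements k r"
  shows "element e \<subseteq> region S d k r"
proof
  fix x assume x: "x \<in> element e"
  have q: "is_qbox S d k r" using box_of_is_qbox[OF k, of e] e by (auto simp: box_elements_def)
  show "x \<in> region S d k r"
    unfolding region_coords
  proof
    fix i
    have eL: "e i < nint S L i" using e by (simp add: box_elements_def elements_def)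
    have rr: "(r i + 1) * d i \<le> nint S k i" using q box_range k by (auto simp: is_qbox_def)
    have ed: "ancestor k (e i) div d i = r i" using e by (auto simp: box_elements_def box_of_def)
    note a = ancestor_element[OF k eL] and b = div_d_bounds[OF ed]
    have "brk S k i (r i * d i) \<le> brk S k i (ancestor k (e i))" using a(1) b by (intro brk_mono k) auto
    moreover have "brk S k i (ancestor k (e i) + 1) \<le> brk S k i ((r i + 1) * d i)"
      using b rr by (intro brk_mono k) auto
    ultimately show "brk S k i (r i * d i) < x $ i \<and> x $ i < brk S k i ((r i + 1) * d i)"
      using a x unfolding element_coords by (meson le_less_trans less_le_trans)
  qed
qed

lemma element_nonempty: "e \<in> elements \<Longrightarrow> element e \<noteq> {}"
  using brk_less[OF L_level] by (simp add: element_def interval_ne_empty_cart elements_def Suc_le_eq)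

lemma regions_disjoint:
  assumes "is_qbox S d k r" "is_qbox S d k s" and x: "x \<in> region S d k r" "x \<in> closure (region S d k s)"
  shows "r = s"
proof
  fix i
  have k: "k \<in> levels" and rr: "(r i + 1) * d i \<le> nint S k i" and ss: "(s i + 1) * d i \<le> nint S k i"
    using assms box_range by (auto simp: is_qbox_def)
  have xr: "brk S k i (r i * d i) < x $ i" "x $ i < brk S k i ((r i + 1) * d i)"
    using x(1) by (auto simp: region_coords)
  have xs: "brk S k i (s i * d i) \<le> x $ i" "x $ i \<le> brk S k i ((s i + 1) * d i)"
    using closure_region_coords[OF x(2)] by auto
  have "s i * d i < (r i + 1) * d i"
    using brk_less_iff[OF k _ rr, of "s i * d i"] ss xr xs by auto
  moreover have "r i * d i < (s i + 1) * d i"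
    using brk_less_iff[OF k _ ss, of "r i * d i"] rr xr xs by auto
  ultimately show "r i = s i" using mult_less_cancel2 by (metis Suc_eq_plus1 less_Suc_eq_le order_antisym)
qed

text \<open>
  An element meets the closure of a box only if it belongs to that box, as open boxes of one level are
  disjoint. So whether an element lies in the next domain depends only on its box.
\<close>

lemma domain_boxes:
  assumes k: "k \<in> levels" "k < L"
  obtains R where "R \<subseteq> {r. is_qbox S d k r}" "\<Psi> (k + 1) = (\<Union>r\<in>R. closure (region S d k r))"
    "\<And>e. e \<in> elements \<Longrightarrow> element e \<subseteq> \<Psi> (k + 1) \<longleftrightarrow> box_of k e \<in> R"
proof -
  have "k \<in> {1..<L}" using k by simp
  then obtain R where R: "R \<subseteq> {r. is_qbox S d k r}" "\<Psi> (k + 1) = (\<Union>r\<in>R. closure (region S d k r))"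
    using compatible unfolding qbox_compatible_def by blast
  have "element e \<subseteq> \<Psi> (k + 1) \<longleftrightarrow> box_of k e \<in> R" if e: "e \<in> elements" for e
  proof
    assume sub: "element e \<subseteq> \<Psi> (k + 1)"
    obtain x where x: "x \<in> element e" using element_nonempty[OF e] by blast
    then obtain s where s: "s \<in> R" "x \<in> closure (region S d k s)" using sub R(2) by blast
    have "x \<in> region S d k (box_of k e)" using element_subset_region[OF k(1), of e "box_of k e"] x e by (auto simp: box_elements_def)
    then show "box_of k e \<in> R" using regions_disjoint[OF box_of_is_qbox[OF k(1) e], of s x] s R(1) by auto
  next
    assume "box_of k e \<in> R"
    then show "element e \<subseteq> \<Psi> (k + 1)"
      using element_subset_region[OF k(1), of e "box_of k e"] e closure_subset unfolding R(2) by (fastforce simp: box_elements_def)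
  qed
  then show thesis using that R by blast
qed

lemma ancestor_Suc: "k < L \<Longrightarrow> ancestor (k + 1) e div 2 = ancestor k e"
  using ancestor_ancestor[of k "k + 1" e] by simp

lemma box_of_Suc: "k < L \<Longrightarrow> box_of k e i = box_of (k + 1) e i div 2"
  unfolding box_of_def ancestor_Suc[symmetric] div_mult2_eq[symmetric] by (simp add: mult.commute)

lemma box_elements_children: "k < L \<Longrightarrow> box_elements k r = (\<Union>s\<in>{s. \<forall>i. s i div 2 = r i}. box_elements (k + 1) s)"
  by (auto simp: box_elements_def box_of_Suc fun_eq_iff)

lemma region_parent:
  assumes "k \<in> levels" "k < L" "is_qbox S d (k + 1) s"
  shows "region S d (k + 1) s \<subseteq> region S d k (\<lambda>i. s i div 2)" "is_qbox S d k (\<lambda>i. s i div 2)"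
proof -
  have k1: "k + 1 \<in> levels" using assms by auto
  have ss: "(s i + 1) * d i \<le> nint S (k + 1) i" for i using assms(3) box_range[OF k1] by (simp add: is_qbox_def)
  have n2: "nint S (k + 1) i = 2 * nint S k i" for i using nested_levels(1)[OF assms(1) k1] by simp
  have b2: "c \<le> nint S k i \<Longrightarrow> brk S (k + 1) i (2 * c) = brk S k i c" for c i
    using nested_levels(2)[OF assms(1) k1, of c i] by simp
  have bnd: "(s i div 2 + 1) * d i \<le> nint S k i" for i
  proof -
    obtain R where R: "nint S k i = d i * R" using compatible assms(1) unfolding qbox_compatible_def by blast
    have "(s i + 1) * d i \<le> (2 * R) * d i" using ss[of i] unfolding n2 R by (simp add: mult.commute mult.left_commute)
    then have "s i + 1 \<le> 2 * R" using deg_pos[of i] by (metis One_nat_def Suc_le_lessD mult_le_cancel2)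
    then have "s i div 2 + 1 \<le> R" by linarith
    then show ?thesis unfolding R by (metis mult.commute mult_le_mono1)
  qed
  have "s i div 2 < nint S k i div d i" for i
    using bnd[of i] deg_pos[of i] less_eq_div_iff_mult_less_eq[of "d i" "s i div 2 + 1" "nint S k i"]
    by linarith
  then show "is_qbox S d k (\<lambda>i. s i div 2)" using assms(1) by (simp add: is_qbox_def)
  show "region S d (k + 1) s \<subseteq> region S d k (\<lambda>i. s i div 2)"
  proof
    fix x assume x: "x \<in> region S d (k + 1) s"
    show "x \<in> region S d k (\<lambda>i. s i div 2)"
      unfolding region_coords
    proof
      fix i
      have "2 * (s i div 2) \<le> s i" "s i + 1 \<le> 2 * (s i div 2 + 1)" by presburger+
      then have le: "2 * (s i div 2 * d i) \<le> s i * d i" "(s i + 1) * d i \<le> 2 * ((s i div 2 + 1) * d i)"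
        using mult_le_mono1[of _ _ "d i"] by (metis mult.assoc)+
      have lo: "brk S k i (s i div 2 * d i) \<le> brk S (k + 1) i (s i * d i)"
        using brk_mono[OF k1 le(1), of i] b2[of "s i div 2 * d i" i] bnd[of i] ss[of i] by simp
      have hi: "brk S (k + 1) i ((s i + 1) * d i) \<le> brk S k i ((s i div 2 + 1) * d i)"
        using brk_mono[OF k1 le(2), of i] b2[OF bnd[of i]] bnd[of i] n2[of i] by simp
      show "brk S k i (s i div 2 * d i) < x $ i \<and> x $ i < brk S k i ((s i div 2 + 1) * d i)"
        using lo hi x unfolding region_coords by (meson le_less_trans less_le_trans)
    qed
  qed
qed

lemma covered_mono: "l \<in> levels \<Longrightarrow> m \<in> levels \<Longrightarrow> l \<le> m \<Longrightarrow> covered m X \<Longrightarrow> covered l X"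
  using domain_mono unfolding covered_def by blast

abbreviation apart :: "('n \<Rightarrow> nat) set \<Rightarrow> ('n \<Rightarrow> nat) set \<Rightarrow> bool" where
  "apart E \<equiv> \<lambda>X. X \<inter> E = {}"

lemma antimono_apart: "antimono (apart E)" by (auto simp: monotone_on_def)

lemma comb_inj:
  assumes "m \<in> levels" "comb m a = comb m b" "j \<in> spline_index m" shows "a j = b j"
  using representation_comb[OF assms(1,3)] assms(2) by metis

lemma spline_space_apart_Union:
  assumes m: "m \<in> levels" and ne: "\<E> \<noteq> {}" and f: "\<And>E. E \<in> \<E> \<Longrightarrow> f \<in> spline_space m (apart E)"
  shows "f \<in> spline_space m (apart (\<Union>\<E>))"
proof -
  obtain E0 where "E0 \<in> \<E>" using ne by blast
  then have "f \<in> spline_space m (apart E0)" by (rule f)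
  then obtain a where a: "f = comb m a" by (auto simp: in_spline_space_iff)
  have "a j = 0" if j: "j \<in> spline_index m" "E \<in> \<E>" "touched m j \<inter> E \<noteq> {}" for j E
  proof -
    obtain b where "f = comb m b" "\<forall>j\<in>spline_index m. touched m j \<inter> E \<noteq> {} \<longrightarrow> b j = 0"
      using f[OF j(2)] unfolding in_spline_space_iff by (elim exE conjE)
    then show ?thesis using comb_inj[OF m, of a b j] a j by simp
  qed
  then show ?thesis unfolding in_spline_space_iff a by (intro exI[of _ a]) blast
qed

section \<open>Splines around the corner shared by a box and its child\<close>

text \<open>
  A level-\<open>(k + 1)\<close> box with index \<open>s\<close> in one direction is the left (\<open>s\<close> even) or right (\<open>s\<close> odd) half of
  its level-\<open>k\<close> parent, and shares with it exactly one end point. This is the number of that breakpoint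
  on the finest mesh; in units of level-\<open>k\<close> boxes it is \<open>(s + 1) div 2\<close>.
\<close>

definition corner_pos :: "nat \<Rightarrow> 'n \<Rightarrow> nat \<Rightarrow> nat" where
  "corner_pos k i s = 2 ^ (L - k) * ((s + 1) div 2 * d i)"

text \<open>
  The end point lies strictly inside \<open>(0, 1)\<close> and the spline is nonzero on both sides of it.
\<close>

definition crosses_corner :: "nat \<Rightarrow> nat \<Rightarrow> 'n \<Rightarrow> nat \<Rightarrow> nat \<Rightarrow> bool" where
  "crosses_corner k m i s h \<longleftrightarrow> 0 < corner_pos k i s \<and> corner_pos k i s < nint S L i \<and>
     h \<in> touches1 i (ancestor m (corner_pos k i s - 1)) \<and> h \<in> touches1 i (ancestor m (corner_pos k i s))"

text \<open>
  The spline is nonzero somewhere on the child box \<open>s\<close>.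
\<close>

definition touches_child :: "nat \<Rightarrow> nat \<Rightarrow> 'n \<Rightarrow> nat \<Rightarrow> nat \<Rightarrow> bool" where
  "touches_child k m i s h \<longleftrightarrow> (\<exists>e<nint S L i. ancestor (k + 1) e div d i = s \<and> h \<in> touches1 i (ancestor m e))"

text \<open>
  The finest element just outside the parent at the shared end point.
\<close>

definition beyond_corner :: "nat \<Rightarrow> 'n \<Rightarrow> nat \<Rightarrow> nat" where
  "beyond_corner k i s = (if even s then corner_pos k i s - 1 else corner_pos k i s)"

lemma mu_pos: "1 \<le> \<mu> i" using hierarchy by (simp add: spline_hierarchy_def)

lemma mult_minus_one_div: "0 < c \<Longrightarrow> 0 < M \<Longrightarrow> (M * c - 1) div M = c - 1" for M c :: nat
  by (cases c) (auto intro!: div_nat_eq_range simp: algebra_simps)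

lemma ancestor_corner_pos: "ancestor k (corner_pos k i s) = (s + 1) div 2 * d i"
    "0 < corner_pos k i s \<Longrightarrow> ancestor k (corner_pos k i s - 1) = (s + 1) div 2 * d i - 1"
  and ancestor_Suc_corner_pos: "k < L \<Longrightarrow> ancestor (k + 1) (corner_pos k i s) = 2 * ((s + 1) div 2 * d i)"
    "k < L \<Longrightarrow> 0 < corner_pos k i s \<Longrightarrow> ancestor (k + 1) (corner_pos k i s - 1) = 2 * ((s + 1) div 2 * d i) - 1"
proof -
  show "ancestor k (corner_pos k i s) = (s + 1) div 2 * d i" by (simp add: ancestor_def corner_pos_def)
  show "0 < corner_pos k i s \<Longrightarrow> ancestor k (corner_pos k i s - 1) = (s + 1) div 2 * d i - 1"
    unfolding ancestor_def corner_pos_def by (intro mult_minus_one_div) auto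
  assume "k < L"
  then have e: "corner_pos k i s = 2 ^ (L - (k + 1)) * (2 * ((s + 1) div 2 * d i))"
    unfolding corner_pos_def mult.assoc[symmetric] power_Suc2[symmetric] by (simp add: Suc_diff_Suc)
  show "ancestor (k + 1) (corner_pos k i s) = 2 * ((s + 1) div 2 * d i)" by (simp add: ancestor_def e)
  show "0 < corner_pos k i s \<Longrightarrow> ancestor (k + 1) (corner_pos k i s - 1) = 2 * ((s + 1) div 2 * d i) - 1"
    unfolding ancestor_def e by (intro mult_minus_one_div) auto
qed

text \<open>
  A spline of degree \<open>d\<close> touches at most \<open>d + 1\<close> consecutive elements, and boxes have \<open>d\<close> elements
  per direction; so a spline touching a box reaches no further than the neighbouring boxes.
\<close>

lemma touches1_near: "h \<in> touches1 i x \<Longrightarrow> h \<in> touches1 i y \<Longrightarrow> x \<le> y + d i"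
proof (rule ccontr)
  assume h: "h \<in> touches1 i x" "h \<in> touches1 i y" and "\<not> x \<le> y + d i"
  then have "(y + d i + 1) * \<mu> i \<le> x * \<mu> i" by (intro mult_le_mono1) simp
  also have "\<dots> \<le> y * \<mu> i + d i" using h by (auto simp: touches1_def)
  finally have "(d i + 1) * \<mu> i \<le> d i" by (simp add: algebra_simps)
  moreover have "(d i + 1) * 1 \<le> (d i + 1) * \<mu> i" using mu_pos by (intro mult_le_mono2)
  ultimately show False by simp
qed

lemma touches1_convex:
  assumes "h \<in> touches1 i x" "h \<in> touches1 i y" "x \<le> w" "w \<le> y"
  shows "h \<in> touches1 i w"
proof -
  have "x * \<mu> i \<le> w * \<mu> i" "w * \<mu> i \<le> y * \<mu> i" using assms by (intro mult_le_mono1; simp)+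
  then show ?thesis using assms(1,2) unfolding touches1_def atLeastAtMost_iff by linarith
qed

text \<open>
  A spline touching the child box reaches at most \<open>d\<close> elements further. In the direction away from the
  shared end point this stays inside the parent, so the spline can leave the parent only across that
  end point, and then only into the adjacent box.
\<close>

lemma crosses_corner_if_leaving:
  assumes k: "k \<in> levels" "k < L" and e: "e1 < nint S L i" "e2 < nint S L i"
    and h: "h \<in> touches1 i (ancestor (k + 1) e1)" "h \<in> touches1 i (ancestor (k + 1) e2)"
    and s: "ancestor (k + 1) e1 div d i = s" "ancestor k e2 div d i \<noteq> s div 2"
  shows "crosses_corner k (k + 1) i s h" "ancestor k (beyond_corner k i s) div d i = ancestor k e2 div d i"
proof -
  define D x1 x2 where "D = d i" and "x1 = ancestor (k + 1) e1" and "x2 = ancestor (k + 1) e2"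
  define r where "r = s div 2"
  define w where "w = r * D"
  have D: "0 < D" using deg_pos[of i] by (simp add: D_def)
  have k1: "k + 1 \<in> levels" using k by auto
  have near: "x1 \<le> x2 + D" "x2 \<le> x1 + D" using touches1_near h by (auto simp: D_def x1_def x2_def)
  have x1: "s * D \<le> x1" "x1 < s * D + D" using div_d_bounds[OF s(1)] by (auto simp: x1_def D_def)
  have e2k: "ancestor k e2 div d i = x2 div (2 * D)"
    using ancestor_Suc[OF k(2), of e2] by (simp add: x2_def D_def div_mult2_eq)
  have "x2 < 2 * w \<or> 2 * w + 2 * D \<le> x2"
  proof (rule ccontr)
    assume "\<not> ?thesis"
    then have "x2 div (2 * D) = r" by (intro div_nat_eq_range) (auto simp: w_def)
    then show False using s(2) e2k by (simp add: r_def)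
  qed
  then consider (left) "even s" "x2 < 2 * w" "2 * w \<le> x1" "2 * w \<le> x2 + D"
    | (right) "odd s" "2 * w + 2 * D \<le> x2" "x1 < 2 * w + 2 * D" "x2 < 2 * w + 3 * D"
  proof (cases "even s")
    case True
    then have "s * D = 2 * w" by (auto simp: w_def r_def)
    then show ?thesis using that x1 near \<open>x2 < 2 * w \<or> 2 * w + 2 * D \<le> x2\<close> True by linarith
  next
    case False
    then have "s * D = (2 * r + 1) * D" by (simp add: r_def)
    then have "s * D = 2 * w + D" by (simp add: w_def)
    then show ?thesis using that x1 near \<open>x2 < 2 * w \<or> 2 * w + 2 * D \<le> x2\<close> False by linarith
  qed
  then have "crosses_corner k (k + 1) i s h \<and> ancestor k (beyond_corner k i s) div d i = ancestor k e2 div d i"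
  proof cases
    case left
    then have c: "(s + 1) div 2 * d i = w" by (auto simp: w_def r_def D_def)
    have w0: "0 < w" using left by linarith
    then have c0: "0 < corner_pos k i s" using w0 unfolding corner_pos_def c by simp
    have r0: "0 < r" using w0 by (cases r) (auto simp: w_def)
    have wr: "2 * w = (r - 1) * (2 * D) + 2 * D" using r0 by (cases r) (auto simp: w_def)
    have "w < nint S k i"
      using ancestor_element(1)[OF k1 e(1)] left nested_levels(1)[OF k(1) k1, of i] by (simp add: x1_def)
    then have "corner_pos k i s < nint S L i" using nested_levels(1)[OF k(1) L_level] k unfolding corner_pos_def c by simp
    moreover have "h \<in> touches1 i (2 * w)" "h \<in> touches1 i (2 * w - 1)"
      by (rule touches1_convex[OF h(2,1)]; use left in \<open>simp add: x1_def x2_def\<close>; linarith)+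
    ultimately have cr: "crosses_corner k (k + 1) i s h"
      using c0 unfolding crosses_corner_def ancestor_Suc_corner_pos(1)[OF k(2)] ancestor_Suc_corner_pos(2)[OF k(2) c0] c by blast
    have "x2 div (2 * D) = r - 1" using left wr by (intro div_nat_eq_range) linarith+
    moreover have "ancestor k (corner_pos k i s - 1) div d i = r - 1"
    proof -
      have "w = (r - 1) * D + D" using r0 by (cases r) (auto simp: w_def)
      then have "(w - 1) div D = r - 1" using D w0 by (intro div_nat_eq_range) linarith+
      then show ?thesis using ancestor_corner_pos(2)[OF c0] unfolding c by (simp add: D_def)
    qed
    ultimately show ?thesis using cr left e2k by (simp add: beyond_corner_def)
  next
    case right
    then have c: "(s + 1) div 2 * d i = w + D" by (auto simp: w_def r_def D_def elim!: oddE)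
    have c0: "0 < corner_pos k i s" using D unfolding corner_pos_def c by simp
    have "w + D < nint S k i"
      using ancestor_element(1)[OF k1 e(2)] right nested_levels(1)[OF k(1) k1, of i] by (simp add: x2_def)
    then have "corner_pos k i s < nint S L i" using nested_levels(1)[OF k(1) L_level] k unfolding corner_pos_def c by simp
    moreover have "h \<in> touches1 i (2 * (w + D))" "h \<in> touches1 i (2 * (w + D) - 1)"
      by (rule touches1_convex[OF h]; use right in \<open>simp add: x1_def x2_def\<close>; linarith)+
    ultimately have cr: "crosses_corner k (k + 1) i s h"
      using c0 unfolding crosses_corner_def ancestor_Suc_corner_pos(1)[OF k(2)] ancestor_Suc_corner_pos(2)[OF k(2) c0] c by blast
    have "x2 div (2 * D) = r + 1" using right by (intro div_nat_eq_range) (auto simp: w_def)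
    moreover have "ancestor k (corner_pos k i s) div d i = r + 1"
    proof -
      have "(w + D) div D = r + 1" using D by (simp add: w_def)
      then show ?thesis using ancestor_corner_pos(1)[of k i s] unfolding c by (simp add: D_def)
    qed
    ultimately show ?thesis using cr right e2k by (simp add: beyond_corner_def)
  qed
  then show "crosses_corner k (k + 1) i s h" "ancestor k (beyond_corner k i s) div d i = ancestor k e2 div d i" by auto
qed

lemma crosses_corner_touches_child:
  assumes "k \<in> levels" "k < L" "crosses_corner k m i s h"
  shows "touches_child k m i s h"
proof -
  have c0: "0 < corner_pos k i s" and cL: "corner_pos k i s < nint S L i" using assms(3) by (auto simp: crosses_corner_def)
  have D: "0 < d i" using deg_pos[of i] by simp
  show ?thesis
  proof (cases "even s")
    case True
    then have "ancestor (k + 1) (corner_pos k i s) div d i = s"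
      using ancestor_Suc_corner_pos(1)[OF assms(2), of i s] D by auto
    then show ?thesis using assms(3) unfolding touches_child_def crosses_corner_def by blast
  next
    case False
    then have "2 * ((s + 1) div 2 * d i) = s * d i + d i" by (auto elim!: oddE)
    then have "ancestor (k + 1) (corner_pos k i s - 1) div d i = s"
      using ancestor_Suc_corner_pos(2)[OF assms(2) c0] D by (simp only:) (intro div_nat_eq_range; linarith)
    moreover have "corner_pos k i s - 1 < nint S L i" using cL by simp
    ultimately show ?thesis using assms(3) unfolding touches_child_def crosses_corner_def by blast
  qed
qed

definition nsplines :: "nat \<Rightarrow> 'n \<Rightarrow> nat" where "nsplines m i = d i + 1 + (nint S m i - 1) * \<mu> i"

lemma touches_child_refinement:
  assumes "k \<in> levels" "k \<le> m" "m \<in> levels" "j < nsplines k i" "refinement_coeff k m i j h \<noteq> 0"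
  shows "touches_child k m i s h \<Longrightarrow> touches_child k k i s j" "crosses_corner k m i s h \<Longrightarrow> crosses_corner k k i s j"
  using refinement_coeff_touches[OF assms(1,3,2) _ assms(5)] assms(4) unfolding touches_child_def crosses_corner_def nsplines_def
  by (blast, auto)

text \<open>
  Among the splines touching the child box, the refinement matrix from level \<open>k\<close> to the finest level is
  injective on the splines that cross the shared end point and on those that do not. The first case is
  a property of refinement at a breakpoint. In the second, the crossing fine splines do not enter,
  hence vanishing coefficients mean that the combination vanishes on the child box, where local
  independence applies.
\<close>

lemma refinement_coeff_corner_indep:
  assumes k: "k \<in> levels" "k < L"
  shows "indep_family {h. h < nsplines L i \<and> touches_child k L i s h \<and> (crosses_corner k L i s h \<longleftrightarrow> P)}
    {j. j < nsplines k i \<and> touches_child k k i s j \<and> (crosses_corner k k i s j \<longleftrightarrow> P)} (refinement_coeff k L i)"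
    (is "indep_family ?H ?J _")
proof -
  have nsplines: "nsplines m i = knot_line.nsplines (d i) (\<mu> i) (nint S m i)" if "m \<in> levels" for m
    using that by (simp add: nsplines_def knot_line.nsplines_def[OF knot_line])
  have kL: "k \<le> L" using k by simp
  interpret knot_refinement "d i" "\<mu> i" "nint S k i" "brk S k i" "nint S L i" "brk S L i" "2 ^ (L - k)"
    by (rule knot_refinement[OF k(1) L_level kL])
  have refinement_coeff: "refinement_coeff k L i = R" by (simp add: refinement_coeff_def)
  have ancestor_L: "ancestor L e = e" for e by (simp add: ancestor_def)
  show ?thesis
  proof (cases P)
    case P: True
    show ?thesis
    proof (cases "0 < corner_pos k i s \<and> corner_pos k i s < nint S L i")
      case False
      then have "?J = {}" using P by (auto simp: crosses_corner_def)
      then show ?thesis unfolding indep_family_def by blast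
    next
      case True
      define c where "c = (s + 1) div 2 * d i"
      have cp: "corner_pos k i s = 2 ^ (L - k) * c" by (simp add: corner_pos_def c_def)
      have c: "0 < c" "c < nint S k i"
        using True N' by (auto simp: cp)
      have "?J \<subseteq> {c * \<mu> i..(c - 1) * \<mu> i + d i}"
        using P True ancestor_corner_pos(1)[of k i s] ancestor_corner_pos(2)[of k i s] by (auto simp: crosses_corner_def touches1_def c_def)
      moreover have "{2 ^ (L - k) * c * \<mu> i..(2 ^ (L - k) * c - 1) * \<mu> i + d i} \<subseteq> ?H"
      proof
        fix h assume h: "h \<in> {2 ^ (L - k) * c * \<mu> i..(2 ^ (L - k) * c - 1) * \<mu> i + d i}"
        have 1: "(corner_pos k i s - 1) * \<mu> i \<le> corner_pos k i s * \<mu> i" by (intro mult_le_mono1) simp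
        have cr: "crosses_corner k L i s h"
          using h True 1 unfolding crosses_corner_def touches1_def ancestor_L cp[symmetric] atLeastAtMost_iff by linarith
        have "h \<in> fine.touches (corner_pos k i s)"
          using cr by (simp add: crosses_corner_def touches1_eq[OF L_level] ancestor_L)
        then have "h < nsplines L i" using fine.touches_subset[of "corner_pos k i s"] True nsplines[OF L_level] by auto
        then show "h \<in> ?H" using cr crosses_corner_touches_child[OF k] P by auto
      qed
      ultimately show ?thesis
        unfolding refinement_coeff by (intro indep_family_mono[OF R_crossing_indep[OF c]]) auto
    qed
  next
    case P: False
    show ?thesis
    proof (rule indep_familyI)
      fix c j0 assume c: "\<And>h. h \<in> ?H \<Longrightarrow> (\<Sum>j\<in>?J. c j * refinement_coeff k L i j h) = 0" and j0: "j0 \<in> ?J"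
      define u where "u h = (\<Sum>j\<in>?J. c j * R j h)" for h
      have u0: "u h = 0" if h: "h < nsplines L i" "touches_child k L i s h" for h
      proof (cases "crosses_corner k L i s h")
        case False
        then show ?thesis using c[of h] h P by (simp add: u_def refinement_coeff)
      next
        case True
        then have "R j h = 0" if "j \<in> ?J" for j
          using touches_child_refinement(2)[OF k(1) kL L_level, of j i h s] that P by (auto simp: refinement_coeff)
        then show ?thesis by (simp add: u_def)
      qed
      obtain e where e: "e < nint S L i" "ancestor (k + 1) e div d i = s" "j0 \<in> touches1 i (ancestor k e)"
        using j0 by (auto simp: touches_child_def)
      let ?X = "{brk S L i e..<brk S L i (e + 1)}"
      have "(\<Sum>j<coarse.nsplines. (if j \<in> ?J then c j else 0) * coarse.B j x) = 0" if x: "x \<in> ?X" for x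
      proof -
        have "(\<Sum>j<coarse.nsplines. (if j \<in> ?J then c j else 0) * coarse.B j x) = (\<Sum>j\<in>?J. c j * coarse.B j x)"
          using nsplines[OF k(1)] by (intro sum.mono_neutral_cong_right) auto
        also have "\<dots> = (\<Sum>j\<in>?J. \<Sum>h<fine.nsplines. c j * R j h * fine.B h x)"
          using nsplines[OF k(1)] by (intro sum.cong) (auto simp: R sum_distrib_left mult.assoc)
        also have "\<dots> = (\<Sum>h<fine.nsplines. u h * fine.B h x)"
          by (subst sum.swap) (simp add: u_def sum_distrib_right)
        also have "\<dots> = 0"
        proof (intro sum.neutral ballI)
          fix h assume h: "h \<in> {..<fine.nsplines}"
          show "u h * fine.B h x = 0"
          proof (cases "h \<in> fine.touches e")
            case True
            then have "touches_child k L i s h"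
              using e unfolding touches_child_def touches1_eq[OF L_level] ancestor_L by blast
            then show ?thesis using u0[of h] h nsplines[OF L_level] by simp
          next
            case False
            then show ?thesis using fine.B_not_touching[OF e(1) x] h by simp
          qed
        qed
        finally show ?thesis .
      qed
      moreover have "infinite ?X" using fine.step[OF e(1)] by (simp add: infinite_Ico)
      moreover have "?X \<subseteq> {brk S k i (ancestor k e)..<brk S k i (ancestor k e + 1)}"
        using ancestor_element[OF k(1) e(1)] by (intro ivl_subset[THEN iffD2] disjI2) blast
      ultimately have "(if j0 \<in> ?J then c j0 else 0) = 0"
        using coarse.B_local_indep[OF ancestor_element(1)[OF k(1) e(1)], of ?X "\<lambda>j. if j \<in> ?J then c j else 0" j0]
          e(3) touches1_eq[OF k(1)] by blast
      then show "c j0 = 0" using j0 by simp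
    qed
  qed
qed

section \<open>Independence of THB-splines on boxes\<close>

text \<open>
  The THB-splines that stem from a level \<open>\<ge> k\<close>, by level and index of the B-spline they stem from.
\<close>

definition thb_index :: "nat \<Rightarrow> (nat \<times> ('n \<Rightarrow> nat)) set" where
  "thb_index k = {(m, j). m \<in> levels \<and> k \<le> m \<and> j \<in> spline_index m \<and> covered m (touched m j)}"

lemma finite_thb_index: "finite (thb_index k)"
proof (rule finite_subset)
  show "thb_index k \<subseteq> Sigma levels spline_index" by (auto simp: thb_index_def)
qed (simp add: finite_spline_index)

lemma spline_in_span: "j \<in> spline_index k \<Longrightarrow> spline k j \<in> spline_space k (\<lambda>_. True)"
  by (rule spline_in_spline_space) auto

lemma antimono_True: "antimono (\<lambda>_. True)"
  by (simp add: monotone_on_def)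

text \<open>
  If truncating at the next level does not remove the spline from \<open>F\<close>, some component survives there.
\<close>

lemma corner_witness:
  assumes k: "k \<in> levels" "k < L" and j: "j \<in> spline_index k" and thb_spline: "thb_spline k j \<notin> spline_space L (apart F)"
  obtains h where "h \<in> spline_index (k + 1)" "touched (k + 1) h \<inter> F \<noteq> {}" "\<not> covered (k + 1) (touched (k + 1) h)"
    "touched (k + 1) h \<subseteq> touched k j"
proof -
  have k1: "k + 1 \<in> levels" using k by auto
  let ?c = "\<lambda>h. \<Prod>i\<in>UNIV. refinement_coeff k (k + 1) i (j i) (h i)"
  have ch: "trunc_chain k (spline k j) 1 = comb (k + 1) (\<lambda>h. if covered (k + 1) (touched (k + 1) h) then 0 else ?c h)"
    using spline_refinement[OF k(1) k1 _ j] trunc_comb[OF k1, of ?c] by simp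
  have n: "trunc_chain k (spline k j) 1 \<notin> spline_space (k + 1) (apart F)"
    using trunc_chain_in_spline_space[OF antimono_apart k(1), of "L - k" "spline k j" 1] thb_spline k by (auto simp: thb_spline_def)
  obtain h where h: "h \<in> spline_index (k + 1)" "\<not> apart F (touched (k + 1) h)"
    "\<not> covered (k + 1) (touched (k + 1) h)" "?c h \<noteq> 0"
  proof (rule ccontr)
    assume "\<not> thesis"
    then have "\<forall>h\<in>spline_index (k + 1). \<not> apart F (touched (k + 1) h) \<longrightarrow>
        (if covered (k + 1) (touched (k + 1) h) then 0 else ?c h) = 0"
      using that by auto
    then have "trunc_chain k (spline k j) 1 \<in> spline_space (k + 1) (apart F)"
      unfolding ch in_spline_space_iff by (intro exI conjI) (rule refl)
    then show False using n by contradiction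
  qed
  then show thesis using that touched_refinement[OF k(1) k1 _ j h(4)] by auto
qed

text \<open>
  If \<open>G\<close> contains every support inside a finer domain, THB-splines of level \<open>k\<close> may be replaced by the
  B-splines they stem from, modulo functions of class \<open>G\<close>.
\<close>

lemma level_part_in_spline_space:
  assumes k: "k \<in> levels" and I: "finite I" and K: "Pair k ` K \<subseteq> I" "K \<subseteq> spline_index k"
    and G: "antimono G"
    and Gin: "\<And>m X. m \<in> levels \<Longrightarrow> k < m \<Longrightarrow> covered m X \<Longrightarrow> G X"
    and f: "(\<Sum>p\<in>I. a p *\<^sub>R thb_spline (fst p) (snd p)) \<in> spline_space L G"
    and rest: "\<And>p. p \<in> I - Pair k ` K \<Longrightarrow> thb_spline (fst p) (snd p) \<in> spline_space L G"
  shows "(\<Sum>j\<in>K. a (k, j) *\<^sub>R spline k j) \<in> spline_space L G"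
proof -
  let ?T = "\<lambda>p. a p *\<^sub>R thb_spline (fst p) (snd p)"
  have inj: "inj_on (Pair k) K" by (simp add: inj_on_def)
  have "sum ?T I = sum ?T (I - Pair k ` K) + sum ?T (Pair k ` K)"
    by (rule sum.subset_diff[OF K(1) I])
  then have "sum ?T (Pair k ` K) = sum ?T I - sum ?T (I - Pair k ` K)"
    by (simp only: add_diff_cancel_left')
  also have "\<dots> \<in> spline_space L G" by (intro spline_space_diff[OF f] spline_space_sum spline_space_scale rest)
  also have "sum ?T (Pair k ` K) = (\<Sum>j\<in>K. a (k, j) *\<^sub>R thb_spline k j)"
    by (simp only: sum.reindex[OF inj] o_def fst_conv snd_conv)
  finally have "(\<Sum>j\<in>K. a (k, j) *\<^sub>R thb_spline k j) \<in> spline_space L G" .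
  moreover have "(\<Sum>j\<in>K. a (k, j) *\<^sub>R (thb_spline k j - spline k j)) \<in> spline_space L G"
    using K Gin by (intro spline_space_sum spline_space_scale thb_spline_diff_in_spline_space k G) auto
  ultimately have "(\<Sum>j\<in>K. a (k, j) *\<^sub>R thb_spline k j) - (\<Sum>j\<in>K. a (k, j) *\<^sub>R (thb_spline k j - spline k j)) \<in> spline_space L G"
    by (rule spline_space_diff)
  then show ?thesis
    unfolding sum_subtractf[symmetric] scaleR_diff_right[symmetric] diff_diff_eq2 add_diff_cancel_left' .
qed

text \<open>
  The key step. Let \<open>r\<close> be a level-\<open>k\<close> box that is refined and \<open>s\<close> one of its children, with region \<open>F\<close>.
  A spline touching \<open>F\<close> that is not supported in \<open>\<Omega>\<^sub>k\<^sub>+\<^sub>1\<close> is called bad here, and \<open>G\<close> is the class of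
  supports that are not bad. Bad components are never truncated at any level, and no THB-spline of a
  finer level has any; hence a combination of THB-splines vanishing on \<open>F\<close> yields a combination of
  level-\<open>k\<close> B-splines without bad components on the finest level.

  A spline touching \<open>F\<close> leaves the parent box only across the corner that \<open>F\<close> shares with its parent.
  Whether it is bad thus depends only on the set \<open>A\<close> of directions in which it crosses the corner, and
  remains so if \<open>A\<close> grows. Refinement can only shrink \<open>A\<close>. Looking at the level-\<open>k\<close> splines with
  nonzero coefficient and largest possible \<open>A\<close>, their components with the same \<open>A\<close> get no contributions
  from other splines. Within one class \<open>A\<close> the refinement matrix is a tensor product of injective
  matrices, so the coefficients vanish.
\<close>

lemma corner:
  assumes k: "k \<in> levels" "k < L" and r: "covered (k + 1) (box_elements k r)" and s: "\<And>i. s i div 2 = r i"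
    and I: "finite I" "I \<subseteq> thb_index k"
    and f: "(\<Sum>p\<in>I. a p *\<^sub>R thb_spline (fst p) (snd p)) \<in> spline_space L (apart (box_elements (k + 1) s))"
    and j: "(k, j) \<in> I" "thb_spline k j \<notin> spline_space L (apart (box_elements (k + 1) s))"
  shows "a (k, j) = 0"
proof (rule ccontr)
  assume aj: "a (k, j) \<noteq> 0"
  define F where "F = box_elements (k + 1) s"
  have k1: "k + 1 \<in> levels" and kL: "k \<le> L" using k by auto
  define G where "G X \<longleftrightarrow> \<not> (X \<inter> F \<noteq> {} \<and> \<not> covered (k + 1) X)" for X
  have G: "antimono G" by (auto simp: monotone_on_def G_def covered_def)
  have G_apart: "spline_space L (apart F) \<subseteq> spline_space L G" by (rule spline_space_imp) (auto simp: G_def)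
  have G_covered: "G X" if "m \<in> levels" "k < m" "covered m X" for m X
    using covered_mono[OF k1 that(1) _ that(3)] that(2) by (simp add: G_def)
  define K where "K = {j. (k, j) \<in> I \<and> thb_spline k j \<notin> spline_space L (apart F)}"
  have KJ: "K \<subseteq> spline_index k" using I by (auto simp: K_def thb_index_def)
  have coarse: "(\<Sum>j\<in>K. a (k, j) *\<^sub>R spline k j) \<in> spline_space L G"
  proof (rule level_part_in_spline_space[OF k(1) I(1) _ KJ G G_covered])
    show "Pair k ` K \<subseteq> I" by (auto simp: K_def)
    show "(\<Sum>p\<in>I. a p *\<^sub>R thb_spline (fst p) (snd p)) \<in> spline_space L G" using f G_apart by (auto simp: F_def)
  next
    fix p assume p: "p \<in> I - Pair k ` K"
    obtain m i where mi: "p = (m, i)" by (cases p)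
    have m: "m \<in> levels" "k \<le> m" "i \<in> spline_index m" "covered m (touched m i)" using p I mi by (auto simp: thb_index_def)
    show "thb_spline (fst p) (snd p) \<in> spline_space L G"
    proof (cases "m = k")
      case True
      then have "thb_spline k i \<in> spline_space L (apart F)" using p mi by (auto simp: K_def)
      then show ?thesis using True mi G_apart by auto
    next
      case False
      then show ?thesis using thb_spline_in_spline_space[OF m(1,3) G G_covered[OF m(1) _ m(4)]] m(2) mi by simp
    qed
  qed
  have coarse_comb: "(\<Sum>j\<in>K. a (k, j) *\<^sub>R spline k j) =
      comb L (\<lambda>h. \<Sum>j\<in>K. a (k, j) * (\<Prod>i\<in>UNIV. refinement_coeff k L i (j i) (h i)))"
  proof
    fix x
    have "(\<Sum>j\<in>K. a (k, j) *\<^sub>R spline k j) x = (\<Sum>j\<in>K. a (k, j) * spline k j x)"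
      by (simp add: sum_fun_apply scaleR_fun_apply)
    also have "\<dots> = (\<Sum>j\<in>K. \<Sum>h\<in>spline_index L. a (k, j) * (\<Prod>i\<in>UNIV. refinement_coeff k L i (j i) (h i)) * spline L h x)"
      using KJ spline_refinement[OF k(1) L_level kL]
      by (intro sum.cong) (auto simp: comb_apply sum_distrib_left mult.assoc)
    also have "\<dots> = comb L (\<lambda>h. \<Sum>j\<in>K. a (k, j) * (\<Prod>i\<in>UNIV. refinement_coeff k L i (j i) (h i))) x"
      by (subst sum.swap) (simp add: comb_apply sum_distrib_right)
    finally show "(\<Sum>j\<in>K. a (k, j) *\<^sub>R spline k j) x =
      comb L (\<lambda>h. \<Sum>j\<in>K. a (k, j) * (\<Prod>i\<in>UNIV. refinement_coeff k L i (j i) (h i))) x" .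
  qed
  have bad0: "(\<Sum>j\<in>K. a (k, j) * (\<Prod>i\<in>UNIV. refinement_coeff k L i (j i) (h i))) = 0" if h: "h \<in> spline_index L" "\<not> G (touched L h)" for h
  proof -
    obtain b where b: "comb L (\<lambda>h. \<Sum>j\<in>K. a (k, j) * (\<Prod>i\<in>UNIV. refinement_coeff k L i (j i) (h i))) = comb L b"
      "\<forall>j\<in>spline_index L. \<not> G (touched L j) \<longrightarrow> b j = 0"
      using coarse unfolding coarse_comb in_spline_space_iff by (elim exE conjE)
    then show ?thesis using comb_inj[OF L_level b(1) h(1)] h by simp
  qed
  \<comment> \<open>A counterexample \<open>j0\<close> crossing the corner in as many directions as possible, a bad component \<open>h\<close> of it on the next level, and elements \<open>e1\<close>, \<open>e2\<close> showing that \<open>h\<close> is bad.\<close>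
  define A where "A j = {i. crosses_corner k k i (s i) (j i)}" for j
  have "\<exists>j. (j \<in> K \<and> a (k, j) \<noteq> 0) \<and> (\<forall>j'. j' \<in> K \<and> a (k, j') \<noteq> 0 \<longrightarrow> card (A j') \<le> card (A j))"
  proof (rule ex_has_greatest_nat)
    show "j \<in> K \<and> a (k, j) \<noteq> 0" using j aj by (simp add: K_def F_def)
    show "\<forall>y. y \<in> K \<and> a (k, y) \<noteq> 0 \<longrightarrow> card (A y) < Suc (card (UNIV :: 'n set))"
      by (auto intro: card_mono simp: less_Suc_eq_le)
  qed
  then obtain j0 where j0: "j0 \<in> K" "a (k, j0) \<noteq> 0"
    and max: "\<And>j'. j' \<in> K \<Longrightarrow> a (k, j') \<noteq> 0 \<Longrightarrow> card (A j') \<le> card (A j0)"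
    by blast
  have "thb_spline k j0 \<notin> spline_space L (apart F)" "j0 \<in> spline_index k" using j0 KJ by (auto simp: K_def)
  then obtain h where h: "h \<in> spline_index (k + 1)" "touched (k + 1) h \<inter> F \<noteq> {}"
    "\<not> covered (k + 1) (touched (k + 1) h)" "touched (k + 1) h \<subseteq> touched k j0"
    using corner_witness[OF k] by metis
  obtain e1 where e1: "e1 \<in> touched (k + 1) h" "e1 \<in> F" using h(2) by blast
  obtain e2 where e2: "e2 \<in> touched (k + 1) h" "\<not> element e2 \<subseteq> \<Psi> (k + 1)" using h(3) by (auto simp: covered_def)
  obtain R where R: "\<And>e. e \<in> elements \<Longrightarrow> element e \<subseteq> \<Psi> (k + 1) \<longleftrightarrow> box_of k e \<in> R" using domain_boxes[OF k] by metis
  have e1L: "e1 i < nint S L i" and e2L: "e2 i < nint S L i" for i using e1 e2 by (auto simp: touched_def elements_def)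
  have e1s: "ancestor (k + 1) (e1 i) div d i = s i" for i using e1(2) by (auto simp: F_def box_elements_def box_of_def)
  have leave: "crosses_corner k (k + 1) i (s i) (h i)" "ancestor k (beyond_corner k i (s i)) div d i = box_of k e2 i"
    if "box_of k e2 i \<noteq> r i" for i
    using crosses_corner_if_leaving[OF k e1L[of i] e2L[of i], of "h i" "s i"] e1 e2 e1s[of i] that s[of i]
    by (auto simp: touched_def box_of_def)
  have outer_L: "beyond_corner k i (s i) < nint S L i" if "crosses_corner k (k + 1) i (s i) (h i)" for i
    using that by (auto simp: crosses_corner_def beyond_corner_def)
  \<comment> \<open>The inclusion of supports for \<open>h\<close> and \<open>j0\<close> holds in each direction separately.\<close>
  have h_j0: "j0 i \<in> touches1 i (ancestor k e)" if "e < nint S L i" "h i \<in> touches1 i (ancestor (k + 1) e)" for i e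
  proof -
    have "e1(i := e) \<in> touched (k + 1) h" using that e1(1) by (auto simp: touched_def elements_def)
    then have "e1(i := e) \<in> touched k j0" using h(4) by blast
    then have "j0 i \<in> touches1 i (ancestor k ((e1(i := e)) i))" unfolding touched_def by blast
    then show ?thesis by simp
  qed
  have h_A: "i \<in> A j0" if "crosses_corner k (k + 1) i (s i) (h i)" for i
    using that h_j0[of _ i] unfolding A_def crosses_corner_def by auto
  \<comment> \<open>The type \<open>A j0\<close> alone makes a finest spline bad: in the directions in which \<open>h\<close> reaches the uncovered element \<open>e2\<close> by leaving the parent box, \<open>h'\<close> crosses as well and reaches an element of the same level-\<open>k\<close> box.\<close>
  have bad: "\<not> G (touched L h')"
    if t: "\<And>i. touches_child k L i (s i) (h' i)" and c: "\<And>i. i \<in> A j0 \<Longrightarrow> crosses_corner k L i (s i) (h' i)" for h'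
  proof -
    obtain e where e: "\<And>i. e i < nint S L i" "\<And>i. ancestor (k + 1) (e i) div d i = s i"
      "\<And>i. h' i \<in> touches1 i (ancestor L (e i))"
      using t unfolding touches_child_def by metis
    define e' where "e' i = (if box_of k e2 i \<noteq> r i then beyond_corner k i (s i) else e i)" for i
    have "e' i < nint S L i \<and> h' i \<in> touches1 i (ancestor L (e' i)) \<and> ancestor k (e' i) div d i = box_of k e2 i" for i
    proof (cases "box_of k e2 i \<noteq> r i")
      case True
      then show ?thesis
        using leave[OF True] outer_L[OF leave(1)[OF True]] c[OF h_A[OF leave(1)[OF True]]]
        by (auto simp: e'_def beyond_corner_def crosses_corner_def)
    next
      case False
      have "ancestor k (e i) div d i = s i div 2"
        using box_of_Suc[OF k(2), of e i] e(2)[of i] by (simp add: box_of_def)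
      then show ?thesis using False e s by (auto simp: e'_def)
    qed
    then have e': "e' \<in> touched L h'" "box_of k e' = box_of k e2" by (auto simp: touched_def elements_def box_of_def)
    have "e2 \<in> elements" "e' \<in> elements" using e2 e' by (auto simp: touched_def)
    then have "\<not> element e' \<subseteq> \<Psi> (k + 1)" using R e2(2) e'(2) by simp
    moreover have "e \<in> touched L h'" "e \<in> F" using e by (auto simp: touched_def elements_def F_def box_elements_def box_of_def)
    ultimately show ?thesis using e'(1) unfolding G_def covered_def by blast
  qed
  let ?H = "\<lambda>i. {h. h < nsplines L i \<and> touches_child k L i (s i) h \<and> (crosses_corner k L i (s i) h \<longleftrightarrow> i \<in> A j0)}"
  let ?J = "\<lambda>i. {j. j < nsplines k i \<and> touches_child k k i (s i) j \<and> (crosses_corner k k i (s i) j \<longleftrightarrow> i \<in> A j0)}"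
  define c where "c j = (if j \<in> K then a (k, j) else 0)" for j
  have "indep_family {h. \<forall>i. h i \<in> ?H i} {j. \<forall>i. j i \<in> ?J i} (\<lambda>j h. \<Prod>i\<in>UNIV. refinement_coeff k L i (j i) (h i))"
    by (intro indep_family_tensor refinement_coeff_corner_indep k) simp
  moreover have "(\<Sum>j\<in>{j. \<forall>i. j i \<in> ?J i}. c j * (\<Prod>i\<in>UNIV. refinement_coeff k L i (j i) (h' i))) = 0"
    if h': "h' \<in> {h. \<forall>i. h i \<in> ?H i}" for h'
  proof -
    have h'J: "h' \<in> spline_index L" using h' by (auto simp: spline_index_def nsplines_def)
    have "(\<Sum>j\<in>{j. \<forall>i. j i \<in> ?J i}. c j * (\<Prod>i\<in>UNIV. refinement_coeff k L i (j i) (h' i))) =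
      (\<Sum>j\<in>spline_index k. c j * (\<Prod>i\<in>UNIV. refinement_coeff k L i (j i) (h' i)))"
    proof (intro sum.mono_neutral_left finite_spline_index ballI)
      show "{j. \<forall>i. j i \<in> ?J i} \<subseteq> spline_index k" by (auto simp: spline_index_def nsplines_def)
      fix j' assume j': "j' \<in> spline_index k - {j. \<forall>i. j i \<in> ?J i}"
      show "c j' * (\<Prod>i\<in>UNIV. refinement_coeff k L i (j' i) (h' i)) = 0"
      proof (rule ccontr)
        assume "c j' * (\<Prod>i\<in>UNIV. refinement_coeff k L i (j' i) (h' i)) \<noteq> 0"
        then have cj: "c j' \<noteq> 0" and nz: "\<And>i. refinement_coeff k L i (j' i) (h' i) \<noteq> 0" by auto
        have j'K: "j' \<in> K" "a (k, j') \<noteq> 0" using cj by (auto simp: c_def split: if_splits)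
        have jn: "j' i < nsplines k i" for i using j' by (auto simp: spline_index_def nsplines_def)
        have t: "touches_child k k i (s i) (j' i)" for i
          using touches_child_refinement(1)[OF k(1) kL L_level jn nz] h' by auto
        \<comment> \<open>A nonzero entry of the refinement matrix makes \<open>j'\<close> cross wherever \<open>h'\<close> does; maximality turns this into equality of types.\<close>
        have "A j0 \<subseteq> A j'"
          using touches_child_refinement(2)[OF k(1) kL L_level jn nz] h' by (auto simp: A_def)
        moreover have "card (A j') \<le> card (A j0)" using max j'K by blast
        ultimately have "A j0 = A j'" by (intro card_seteq) auto
        then have "j' \<in> {j. \<forall>i. j i \<in> ?J i}" using t jn by (auto simp: A_def)
        then show False using j' by blast
      qed
    qed
    also have "\<dots> = (\<Sum>j\<in>K. a (k, j) * (\<Prod>i\<in>UNIV. refinement_coeff k L i (j i) (h' i)))"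
      using KJ finite_spline_index by (intro sum.mono_neutral_cong_right) (auto simp: c_def)
    also have "\<dots> = 0" using h' by (intro bad0 h'J bad) auto
    finally show ?thesis .
  qed
  moreover have "j0 \<in> {j. \<forall>i. j i \<in> ?J i}"
  proof -
    have "touches_child k k i (s i) (j0 i)" for i
      unfolding touches_child_def using e1L[of i] e1s[of i] e1(1) h(4) by (auto simp: touched_def)
    then show ?thesis using j0(1) KJ by (auto simp: A_def spline_index_def nsplines_def)
  qed
  ultimately have "c j0 = 0" by (rule indep_familyD)
  then show False using j0 by (simp add: c_def)
qed

lemma thb_spline_in_span: "k \<in> levels \<Longrightarrow> j \<in> spline_index k \<Longrightarrow> thb_spline k j \<in> spline_space L (\<lambda>_. True)"
  by (rule thb_spline_in_spline_space[OF _ _ antimono_True]) auto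

text \<open>
  Descending induction on the level. If the box is not refined, only THB-splines of level \<open>k\<close> are visible
  on it and coincide there with B-splines. If it is refined, the corner argument on each child
  eliminates level \<open>k\<close>, and the induction hypothesis for the child does the rest. A THB-spline that does
  not vanish on the box does not vanish on some child.
\<close>

lemma indep_from_level:
  assumes "k \<in> levels" and "finite I" "I \<subseteq> thb_index k"
    and "(\<Sum>p\<in>I. a p *\<^sub>R thb_spline (fst p) (snd p)) \<in> spline_space L (apart (box_elements k r))"
    and "p \<in> I" "thb_spline (fst p) (snd p) \<notin> spline_space L (apart (box_elements k r))"
  shows "a p = 0"
  using assms
proof (induction "L - k" arbitrary: k r I p rule: less_induct)
  case less
  note k = less.prems(1) and I = less.prems(2,3) and f = less.prems(4) and p = less.prems(5,6)
  have lev: "m \<in> levels" "k \<le> m" "j \<in> spline_index m" "covered m (touched m j)" if "(m, j) \<in> I" for m j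
    using that I by (auto simp: thb_index_def)
  show ?case
  proof (cases "k < L \<and> covered (k + 1) (box_elements k r)")
    case False
    have not_in: "\<not> element e \<subseteq> \<Psi> (k + 1)" if e: "e \<in> box_elements k r" for e
    proof (cases "k < L")
      case True
      obtain R where R: "\<And>e. e \<in> elements \<Longrightarrow> element e \<subseteq> \<Psi> (k + 1) \<longleftrightarrow> box_of k e \<in> R"
        using domain_boxes[OF k True] by metis
      obtain e' where e': "e' \<in> box_elements k r" "\<not> element e' \<subseteq> \<Psi> (k + 1)" using False True by (auto simp: covered_def)
      then show ?thesis using R e by (auto simp: box_elements_def)
    next
      case F: False
      then have "\<Psi> (k + 1) = {}" using domains k by (auto simp: domain_hierarchy_def)
      then show ?thesis using element_nonempty e by (auto simp: box_elements_def)
    qed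
    have apart: "apart (box_elements k r) X" if "m \<in> levels" "k < m" "covered m X" for m X
    proof -
      have "k + 1 \<in> levels" using that by auto
      then have "covered (k + 1) X" using covered_mono[of "k + 1" m X] that by auto
      then show ?thesis using not_in by (auto simp: covered_def)
    qed
    have fine: "thb_spline m j \<in> spline_space L (apart (box_elements k r))" if "(m, j) \<in> I" "m \<noteq> k" for m j
      using lev[OF that(1)] that(2) apart[of m "touched m j"] by (intro thb_spline_in_spline_space antimono_apart) auto
    define K where "K = {j. (k, j) \<in> I}"
    have KJ: "K \<subseteq> spline_index k" using lev by (auto simp: K_def)
    have coarse: "(\<Sum>j\<in>K. a (k, j) *\<^sub>R spline k j) \<in> spline_space L (apart (box_elements k r))"
    proof (rule level_part_in_spline_space[OF k I(1) _ KJ antimono_apart apart f])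
      fix p assume "p \<in> I - Pair k ` K"
      then show "thb_spline (fst p) (snd p) \<in> spline_space L (apart (box_elements k r))"
        using fine[of "fst p" "snd p"] by (cases p) (auto simp: K_def)
    qed (auto simp: K_def)
    obtain m j where mj: "p = (m, j)" by (cases p)
    have m: "m = k" using fine[of m j] p mj by auto
    have jK: "j \<in> K" and jJ: "j \<in> spline_index k" using p mj m lev by (auto simp: K_def)
    have "\<not> apart (box_elements k r) (touched k j)"
      using thb_spline_in_spline_space[OF k jJ antimono_apart] p mj m by auto
    then obtain e where e: "e \<in> touched k j" "e \<in> box_elements k r" by blast
    have "(if j \<in> K then a (k, j) else 0) = 0"
    proof (rule local_indep_element[OF k _ e(1), where c = "\<lambda>j. if j \<in> K then a (k, j) else 0"])
      fix x assume x: "x \<in> element e"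
      have "(\<Sum>j\<in>K. a (k, j) *\<^sub>R spline k j) x = 0"
        using x e(2) box_elements_subset by (intro spline_space_vanishing[OF L_level coarse e(2)]) (auto simp: element_coords less_imp_le)
      then show "(\<Sum>j\<in>spline_index k. (if j \<in> K then a (k, j) else 0) * spline k j x) = 0"
        using KJ finite_spline_index sum.mono_neutral_cong_right[of "spline_index k" K
            "\<lambda>j. (if j \<in> K then a (k, j) else 0) * spline k j x" "\<lambda>j. a (k, j) * spline k j x"]
        by (simp add: sum_fun_apply scaleR_fun_apply)
    qed
    then show ?thesis using jK mj m by simp
  next
    case True
    then have kL: "k < L" and ins: "covered (k + 1) (box_elements k r)" by auto
    have k1: "k + 1 \<in> levels" using kL by auto
    let ?C = "{s. \<forall>i. s i div 2 = r i}"
    have neC: "?C \<noteq> {}" by (auto intro!: exI[of _ "\<lambda>i. 2 * r i"])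
    have "\<exists>s\<in>?C. thb_spline (fst p) (snd p) \<notin> spline_space L (apart (box_elements (k + 1) s))"
    proof (rule ccontr)
      assume "\<not> ?thesis"
      then have "thb_spline (fst p) (snd p) \<in> spline_space L (apart (\<Union>(box_elements (k + 1) ` ?C)))"
        using neC by (intro spline_space_apart_Union L_level) auto
      then show False using p(2) box_elements_children[OF kL, of r] by simp
    qed
    then obtain s where s: "\<And>i. s i div 2 = r i" and ps: "thb_spline (fst p) (snd p) \<notin> spline_space L (apart (box_elements (k + 1) s))"
      by auto
    have sub: "box_elements (k + 1) s \<subseteq> box_elements k r" using box_elements_children[OF kL, of r] s by auto
    have fs: "(\<Sum>p\<in>I. a p *\<^sub>R thb_spline (fst p) (snd p)) \<in> spline_space L (apart (box_elements (k + 1) s))"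
      using f spline_space_imp[of "apart (box_elements k r)" "apart (box_elements (k + 1) s)" L] sub by blast
    have lvl_k: "a (k, j) *\<^sub>R thb_spline k j \<in> spline_space L (apart (box_elements (k + 1) s))" if "(k, j) \<in> I" for j
    proof (cases "thb_spline k j \<in> spline_space L (apart (box_elements (k + 1) s))")
      case False
      then have "a (k, j) = 0" using corner[OF k kL ins s I fs that] by blast
      then show ?thesis using spline_space_zero by (simp only: scaleR_zero_left)
    qed (rule spline_space_scale)
    obtain m j where mj: "p = (m, j)" by (cases p)
    show ?thesis
    proof (cases "m = k")
      case True
      then show ?thesis using corner[OF k kL ins s I fs, of j] p ps mj by simp
    next
      case False
      define I' where "I' = I \<inter> thb_index (k + 1)"
      have II: "I - I' = {q \<in> I. fst q = k}" using I by (force simp: I'_def thb_index_def)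
      let ?T = "\<lambda>p. a p *\<^sub>R thb_spline (fst p) (snd p)"
      have "sum ?T I = sum ?T (I - I') + sum ?T I'"
        using I(1) by (intro sum.subset_diff) (auto simp: I'_def)
      then have "sum ?T I' = sum ?T I - sum ?T (I - I')" by (simp only: add_diff_cancel_left')
      also have "\<dots> \<in> spline_space L (apart (box_elements (k + 1) s))"
        unfolding II using lvl_k by (intro spline_space_diff[OF fs] spline_space_sum) auto
      finally have f': "sum ?T I' \<in> spline_space L (apart (box_elements (k + 1) s))" .
      have "p \<in> I'" using p(1) lev[of m j] mj False by (auto simp: I'_def thb_index_def)
      then show ?thesis
        using less.hyps[OF _ k1 _ _ f' _ ps] I kL by (auto simp: I'_def)
    qed
  qed
qed

section \<open>Regular and well-behaved boxes\<close>

text \<open>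
  For such a box, truncation at level \<open>k\<close> removes everything older from it.
\<close>

definition saturated :: "nat \<Rightarrow> ('n \<Rightarrow> nat) \<Rightarrow> bool" where
  "saturated k r \<longleftrightarrow> (\<forall>h\<in>spline_index k. touched k h \<inter> box_elements k r \<noteq> {} \<longrightarrow> covered k (touched k h))"

lemma saturated_lower_levels:
  assumes k: "k \<in> levels" and r: "saturated k r" and l: "l \<in> levels" "l < k" and j: "j \<in> spline_index l"
  shows "thb_spline l j \<in> spline_space L (apart (box_elements k r))"
proof -
  obtain n where n: "k = l + Suc n" using l less_imp_Suc_add by auto
  have "trunc_chain l (spline l j) n \<in> spline_space (l + n) (\<lambda>_. True)"
    using trunc_chain_in_spline_space[OF antimono_True l(1), of n "spline l j" 0] spline_in_span[OF j] k n by simp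
  then have "trunc_chain l (spline l j) n \<in> spline_space k (\<lambda>_. True)"
    using spline_space_level_mono[of "l + n" k, OF _ k _ antimono_True] l k n by auto
  then obtain a where a: "trunc_chain l (spline l j) n = comb k a" by (auto simp: in_spline_space_iff)
  have "trunc_chain l (spline l j) (Suc n) = comb k (\<lambda>j. if covered k (touched k j) then 0 else a j)"
    using trunc_comb[OF k, of a] by (simp add: a n)
  then have "trunc_chain l (spline l j) (Suc n) \<in> spline_space k (apart (box_elements k r))"
    unfolding in_spline_space_iff using r
    by (intro exI[of _ "\<lambda>j. if covered k (touched k j) then 0 else a j"]) (auto simp: saturated_def)
  then show ?thesis
    using trunc_chain_in_spline_space[OF antimono_apart l(1), of "L - l" "spline l j" "Suc n"] k n l by (simp add: thb_spline_def)
qed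

lemma saturated_level_1: "saturated 1 r"
proof -
  have "element e \<subseteq> \<Psi> 1" if "e \<in> elements" for e
    using element_subset_domain_1 that by blast
  then show ?thesis by (auto simp: saturated_def covered_def touched_def)
qed

lemma spline_space_restrict_sum:
  assumes I: "finite I" "I' \<subseteq> I" and f: "(\<Sum>p\<in>I. g p) \<in> spline_space L G"
    and rest: "\<And>p. p \<in> I - I' \<Longrightarrow> g p \<in> spline_space L G"
  shows "(\<Sum>p\<in>I'. g p) \<in> spline_space L G"
proof -
  have "sum g I = sum g (I - I') + sum g I'" using I by (intro sum.subset_diff)
  then have "sum g I' = sum g I - sum g (I - I')" by (simp only: add_diff_cancel_left')
  also have "\<dots> \<in> spline_space L G" by (intro spline_space_diff[OF f] spline_space_sum rest)
  finally show ?thesis .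
qed

lemma saturated_lower_levels_index:
  assumes "k \<in> levels" "saturated k r" "q \<in> thb_index 1" "q \<notin> thb_index k"
  shows "thb_spline (fst q) (snd q) \<in> spline_space L (apart (box_elements k r))"
proof -
  obtain m j where q: "q = (m, j)" by (cases q)
  then have "m \<in> levels" "m < k" "j \<in> spline_index m" using assms(3,4) by (auto simp: thb_index_def)
  then show ?thesis using saturated_lower_levels[OF assms(1,2)] q by simp
qed

lemma indep_saturated_box:
  assumes k: "k \<in> levels" "saturated k r" and I: "finite I" "I \<subseteq> thb_index 1"
    and f: "(\<Sum>p\<in>I. a p *\<^sub>R thb_spline (fst p) (snd p)) \<in> spline_space L (apart (box_elements k r))"
    and p: "p \<in> I" "thb_spline (fst p) (snd p) \<notin> spline_space L (apart (box_elements k r))"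
  shows "a p = 0"
proof -
  have low: "thb_spline (fst q) (snd q) \<in> spline_space L (apart (box_elements k r))" if "q \<in> I - thb_index k" for q
    using saturated_lower_levels_index[OF k] that I by blast
  have fk: "(\<Sum>p\<in>I \<inter> thb_index k. a p *\<^sub>R thb_spline (fst p) (snd p)) \<in> spline_space L (apart (box_elements k r))"
    using low by (intro spline_space_restrict_sum[OF I(1) _ f] spline_space_scale) auto
  have "p \<in> I \<inter> thb_index k" using low[of p] p by blast
  then show ?thesis
    using indep_from_level[OF k(1) _ _ fk _ p(2)] I by blast
qed

text \<open>
  On the parent only THB-splines of level \<open>\<ge> k\<close> are visible; the corner argument handles level \<open>k\<close> and
  the finer levels are independent on any box.
\<close>

lemma indep_child_of_saturated_box:
  assumes k: "k \<in> levels" "k < L" "saturated k r" and r: "covered (k + 1) (box_elements k r)"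
    and s: "\<And>i. s i div 2 = r i" and I: "finite I" "I \<subseteq> thb_index 1"
    and f: "(\<Sum>p\<in>I. a p *\<^sub>R thb_spline (fst p) (snd p)) \<in> spline_space L (apart (box_elements (k + 1) s))"
    and p: "p \<in> I" "thb_spline (fst p) (snd p) \<notin> spline_space L (apart (box_elements (k + 1) s))"
  shows "a p = 0"
proof -
  let ?T = "\<lambda>p. a p *\<^sub>R thb_spline (fst p) (snd p)" and ?V = "spline_space L (apart (box_elements (k + 1) s))"
  have k1: "k + 1 \<in> levels" using k by auto
  have sub: "box_elements (k + 1) s \<subseteq> box_elements k r" using box_elements_children[OF k(2), of r] s by auto
  have low: "thb_spline (fst q) (snd q) \<in> ?V" if "q \<in> I - thb_index k" for q
  proof -
    have "thb_spline (fst q) (snd q) \<in> spline_space L (apart (box_elements k r))"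
      using saturated_lower_levels_index[OF k(1,3)] that I by blast
    then show ?thesis using spline_space_imp[of "apart (box_elements k r)" "apart (box_elements (k + 1) s)" L] sub by blast
  qed
  have fk: "sum ?T (I \<inter> thb_index k) \<in> ?V"
    using low by (intro spline_space_restrict_sum[OF I(1) _ f] spline_space_scale) auto
  have mid: "a q = 0" if "q \<in> I \<inter> thb_index k" "q \<notin> thb_index (k + 1)" "thb_spline (fst q) (snd q) \<notin> ?V" for q
  proof -
    obtain m j where q: "q = (m, j)" by (cases q)
    then have m: "m = k" using that by (auto simp: thb_index_def)
    have "a (k, j) = 0"
      by (rule corner[OF k(1,2) r s _ _ fk]) (use I that q m in auto)
    then show ?thesis using q m by simp
  qed
  have mid': "?T q \<in> ?V" if "q \<in> I \<inter> thb_index k - I \<inter> thb_index (k + 1)" for q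
  proof (cases "thb_spline (fst q) (snd q) \<in> ?V")
    case False
    then have "a q = 0" using mid that by blast
    then show ?thesis using spline_space_zero by (simp only: scaleR_zero_left)
  qed (rule spline_space_scale)
  show ?thesis
  proof (cases "p \<in> thb_index (k + 1)")
    case True
    have fk1: "sum ?T (I \<inter> thb_index (k + 1)) \<in> ?V"
      using I by (intro spline_space_restrict_sum[OF _ _ fk] mid') (auto simp: thb_index_def)
    show ?thesis
      by (rule indep_from_level[OF k1 _ _ fk1 _ p(2)]) (use I p True in auto)
  next
    case False
    then show ?thesis using mid low p by blast
  qed
qed

lemma box_elements_nonempty:
  assumes q: "is_qbox S d k r"
  obtains e where "e \<in> box_elements k r"
proof
  have k: "k \<in> levels" using q by (simp add: is_qbox_def)
  let ?e = "\<lambda>i. 2 ^ (L - k) * (r i * d i)"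
  have "r i * d i < nint S k i" for i
    using box_range[OF k, of "r i" i] q deg_pos[of i] by (simp add: is_qbox_def)
  then have "?e i < nint S L i" for i
    using nested_levels(1)[OF k L_level, of i] k by simp
  moreover have "ancestor k (?e i) div d i = r i" for i using deg_pos[of i] by (simp add: ancestor_def)
  ultimately show "?e \<in> box_elements k r" by (simp add: box_elements_def elements_def box_of_def)
qed

text \<open>
  A spline touching the box reaches only into neighbouring boxes. The closure of each neighbour shares
  with the closure of the box a point \<open>x\<close> of the open cube. Since the box is not a border box, \<open>x\<close> is
  interior to \<open>\<Omega>\<^sub>k\<close>; so \<open>\<Omega>\<^sub>k\<close> meets the neighbour and, being a union of boxes of the previous level,
  contains it.
\<close>

lemma nonborder_saturated:
  assumes k: "1 < k" and q: "is_qbox S d k r" and sub: "region S d k r \<subseteq> \<Psi> k"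
    and nsplines: "\<not> border S d \<Psi> k r"
  shows "saturated k r"
  unfolding saturated_def
proof (intro ballI impI)
  fix h assume h: "h \<in> spline_index k" "touched k h \<inter> box_elements k r \<noteq> {}"
  have kl: "k \<in> levels" using q by (simp add: is_qbox_def)
  obtain k' where k': "k = k' + 1" "k' \<in> levels" "k' < L"
    using k kl by (cases k) auto
  obtain R where R: "R \<subseteq> {r. is_qbox S d k' r}" "\<Psi> k = (\<Union>r\<in>R. closure (region S d k' r))"
    "\<And>e. e \<in> elements \<Longrightarrow> element e \<subseteq> \<Psi> k \<longleftrightarrow> box_of k' e \<in> R"
    using domain_boxes[OF k'(2,3)] unfolding k'(1) by metis
  obtain e0 where e0: "e0 \<in> touched k h" "e0 \<in> box_elements k r" using h by blast
  show "covered k (touched k h)"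
    unfolding covered_def
  proof
    fix e assume e: "e \<in> touched k h"
    then have elements: "e \<in> elements" by (simp add: touched_def)
    define s where "s = box_of k e"
    have es: "e \<in> box_elements k s" using elements by (simp add: box_elements_def s_def)
    have qs: "is_qbox S d k s" unfolding s_def by (rule box_of_is_qbox[OF kl elements])
    have near: "s i \<le> r i + 1" "r i \<le> s i + 1" for i
    proof -
      have t: "h i \<in> touches1 i (ancestor k (e i))" "h i \<in> touches1 i (ancestor k (e0 i))"
        using e e0 by (auto simp: touched_def)
      have d: "(y + d i) div d i = y div d i + 1" for y using deg_pos[of i] by simp
      have "r i = ancestor k (e0 i) div d i" using e0(2) by (auto simp: box_elements_def box_of_def)
      then show "s i \<le> r i + 1" "r i \<le> s i + 1"
        using div_le_mono[OF touches1_near[OF t], of "d i"] div_le_mono[OF touches1_near[OF t(2,1)], of "d i"]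
        unfolding d by (simp_all add: s_def box_of_def)
    qed
    show "element e \<subseteq> \<Psi> k"
    proof (cases "s = r")
      case True
      then show ?thesis using element_subset_region[OF kl es] sub by blast
    next
      case False
      have rr: "(r i + 1) * d i \<le> nint S k i" and ss: "(s i + 1) * d i \<le> nint S k i" for i
        using q qs box_range[OF kl] by (auto simp: is_qbox_def)
      define lo hi where "lo u i = brk S k i (u * d i)" and "hi u i = brk S k i ((u + 1) * d i)" for u :: nat and i
      have lohi: "lo (r i) i < hi (r i) i" "lo (s i) i < hi (s i) i" "0 \<le> lo (r i) i" "0 \<le> lo (s i) i"
        "hi (r i) i \<le> 1" "hi (s i) i \<le> 1" for i
        using rr[of i] ss[of i] deg_pos[of i] brk_ends[OF kl, of i]
          brk_mono[OF kl, of 0 "r i * d i" i] brk_mono[OF kl, of 0 "s i * d i" i]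
          brk_mono[OF kl rr[of i] order_refl] brk_mono[OF kl ss[of i] order_refl]
        by (auto simp: lo_def hi_def intro!: brk_less[OF kl])
      \<comment> \<open>A point common to the closures of the two boxes, with interior coordinates wherever possible.\<close>
      define x where "x = (\<chi> i. if s i = r i then (lo (r i) i + hi (r i) i) / 2
        else if s i = r i + 1 then hi (r i) i else lo (r i) i)"
      have adj: "hi (r i) i = lo (s i) i" if "s i = r i + 1" for i using that by (simp add: lo_def hi_def)
      have adj': "lo (r i) i = hi (s i) i" if "s i \<noteq> r i" "s i \<noteq> r i + 1" for i
      proof -
        have "r i = s i + 1" using near[of i] that by linarith
        then show ?thesis by (simp add: lo_def hi_def)
      qed
      have xr: "lo (r i) i \<le> x $ i" "x $ i \<le> hi (r i) i" for i
        using lohi[of i] by (auto simp: x_def)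
      have xs: "lo (s i) i \<le> x $ i" "x $ i \<le> hi (s i) i" for i
        using lohi[of i] adj[of i] adj'[of i] by (auto simp: x_def)
      have reg: "region S d k u = box (\<chi> i. lo (u i) i) (\<chi> i. hi (u i) i)" for u
        by (simp add: region_def lo_def hi_def)
      have ne: "region S d k r \<noteq> {}" "region S d k s \<noteq> {}"
        using lohi by (simp_all add: reg interval_ne_empty_cart)
      have cl: "x \<in> closure (region S d k r)" "x \<in> closure (region S d k s)"
        using ne xr xs closure_box unfolding reg by (auto simp: mem_box_cart)
      obtain i where i: "s i \<noteq> r i" using False by blast
      have "x \<notin> region S d k r" using i by (auto simp: reg mem_box_cart x_def intro!: exI[of _ i])
      then have fr: "x \<in> frontier (region S d k r)"
        using cl(1) interior_subset unfolding frontier_def by blast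
      have "0 < x $ i \<and> x $ i < 1" for i
        using lohi[of i] adj[of i] adj'[of i] by (auto simp: x_def)
      then have "x \<in> unit_cube" by (simp add: unit_cube_def mem_box_cart)
      moreover have "interior unit_cube = (unit_cube :: (real ^ 'n) set)"
        unfolding unit_cube_def by (intro interior_open open_box)
      ultimately have "x \<notin> frontier unit_cube" by (simp add: frontier_def)
      then have "x \<notin> frontier (\<Psi> k)" using nsplines q k sub fr by (auto simp: border_def)
      moreover have "x \<in> \<Psi> k" using cl(1) closure_minimal[OF sub closed_domain[OF kl]] by blast
      ultimately have "x \<in> interior (\<Psi> k)" using closed_domain[OF kl] by (simp add: frontier_def)
      then obtain y where y: "y \<in> interior (\<Psi> k)" "y \<in> region S d k s"
        using cl(2) open_Int_closure_eq_empty[of "interior (\<Psi> k)" "region S d k s"] by blast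
      then obtain t where t: "t \<in> R" "y \<in> closure (region S d k' t)" using R(2) interior_subset by blast
      have par: "region S d k s \<subseteq> region S d k' (\<lambda>i. s i div 2)" "is_qbox S d k' (\<lambda>i. s i div 2)"
        using region_parent[OF k'(2,3)] qs k'(1) by auto
      have "(\<lambda>i. s i div 2) = t" using regions_disjoint[OF par(2), of t y] par(1) y t R(1) by blast
      moreover have "box_of k' e = (\<lambda>i. s i div 2)" using box_of_Suc[OF k'(3), of e] by (simp add: fun_eq_iff s_def k'(1))
      ultimately show ?thesis using R(3)[OF elements] t(1) by simp
    qed
  qed
qed

lemma border_contained_in_well_behaved:
  assumes "border S d \<Psi> k r"
  obtains l s where "l \<in> {2..k}" "well_behaved S d \<Psi> l s" "region S d k r \<subseteq> region S d l s"
proof (cases "well_behaved S d \<Psi> k r")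
  case True
  then show thesis using that[of k r] assms by (auto simp: border_def)
next
  case False
  then have "\<exists>l\<in>{2..<k}. \<exists>s. well_behaved S d \<Psi> l s \<and> region S d k r \<subseteq> region S d l s"
    using assms well_behaved.simps[of S d \<Psi> k r] by blast
  then obtain l s where "l \<in> {2..<k}" "well_behaved S d \<Psi> l s" "region S d k r \<subseteq> region S d l s"
    by blast
  then show thesis using that[of l s] by auto
qed

text \<open>
  A regular box is saturated, because as a border box it would lie in a well-behaved box. A
  well-behaved box has a saturated parent of the previous level for the same reason. At level 1 all
  boxes are saturated.
\<close>

theorem indep_on_box:
  assumes E: "well_behaved S d \<Psi> l r \<or> regular S d \<Psi> l r" and I: "finite I" "I \<subseteq> thb_index 1"
    and f: "(\<Sum>p\<in>I. a p *\<^sub>R thb_spline (fst p) (snd p)) \<in> spline_space L (apart (box_elements l r))"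
    and p: "p \<in> I" "thb_spline (fst p) (snd p) \<notin> spline_space L (apart (box_elements l r))"
  shows "a p = 0"
  using E
proof
  assume reg: "regular S d \<Psi> l r"
  then have q: "is_qbox S d l r" and l: "l \<in> levels" and sub: "region S d l r \<subseteq> \<Psi> l"
    by (auto simp: regular_def active_def is_qbox_def)
  have "\<not> border S d \<Psi> l r"
    using reg border_contained_in_well_behaved[of l r] unfolding regular_def by metis
  then have "saturated l r" using nonborder_saturated[OF _ q sub] saturated_level_1 l by (cases "l = 1") auto
  from indep_saturated_box[OF l this I f p] show ?thesis .
next
  assume wb: "well_behaved S d \<Psi> l r"
  then have b: "border S d \<Psi> l r"
    and not_in: "\<And>k s. k \<in> {2..<l} \<Longrightarrow> well_behaved S d \<Psi> k s \<Longrightarrow> \<not> region S d l r \<subseteq> region S d k s"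
    by (subst (asm) well_behaved.simps; blast)+
  have q: "is_qbox S d l r" and l: "l \<in> levels" "1 < l" and sub: "region S d l r \<subseteq> \<Psi> l"
    using b by (auto simp: border_def is_qbox_def)
  obtain k where k: "l = k + 1" "k \<in> levels" "k < L" using l by (cases l) auto
  define s where "s = (\<lambda>i. r i div 2)"
  obtain R where R: "R \<subseteq> {r. is_qbox S d k r}" "\<Psi> l = (\<Union>r\<in>R. closure (region S d k r))"
    "\<And>e. e \<in> elements \<Longrightarrow> element e \<subseteq> \<Psi> l \<longleftrightarrow> box_of k e \<in> R"
    using domain_boxes[OF k(2,3)] unfolding k(1) by metis
  have par: "region S d l r \<subseteq> region S d k s" "is_qbox S d k s"
    using region_parent[OF k(2,3)] q unfolding k(1) s_def by auto
  obtain e where e: "e \<in> box_elements l r" using box_elements_nonempty[OF q] .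
  have "box_of k e = s" using box_of_Suc[OF k(3), of e] e by (auto simp: box_elements_def s_def k(1))
  moreover have "element e \<subseteq> \<Psi> l" using element_subset_region[OF l(1) e] sub by blast
  ultimately have sR: "s \<in> R" using R(3)[of e] e by (auto simp: box_elements_def)
  have ins: "covered l (box_elements k s)" using R(3) sR by (auto simp: covered_def box_elements_def)
  have "region S d k s \<subseteq> \<Psi> l" using sR closure_subset unfolding R(2) by blast
  then have subk: "region S d k s \<subseteq> \<Psi> k" using domain_mono[OF k(2) l(1)] k(1) by auto
  have "\<not> border S d \<Psi> k s"
  proof
    assume "border S d \<Psi> k s"
    then obtain m u where "m \<in> {2..k}" "well_behaved S d \<Psi> m u" "region S d k s \<subseteq> region S d m u"
      by (rule border_contained_in_well_behaved)
    then show False using not_in[of m u] par(1) k(1) by auto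
  qed
  then have "saturated k s" using nonborder_saturated[OF _ par(2) subk] saturated_level_1 k(2) by (cases "k = 1") auto
  from indep_child_of_saturated_box[OF k(2,3) this _ _ I _ p(1), of r a] ins f p(2) show ?thesis
    unfolding k(1) s_def by blast
qed

lemma not_overloaded:
  assumes E: "well_behaved S d \<Psi> l r \<or> regular S d \<Psi> l r"
  shows "\<not> is_overloaded (region S d l r) (thb S \<Psi>)"
proof -
  have q: "is_qbox S d l r"
    using E by (auto simp: regular_def active_def well_behaved.simps[of _ _ _ l] border_def)
  then have l: "l \<in> levels" by (simp add: is_qbox_def)
  let ?E = "region S d l r" and ?V = "spline_space L (apart (box_elements l r))"
  let ?T = "\<lambda>p. thb_spline (fst p) (snd p)"
  define I where "I = {p \<in> thb_index 1. ?T p \<notin> ?V}"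
  have I: "finite I" "I \<subseteq> thb_index 1" using finite_thb_index by (auto simp: I_def)
  have "indep_family ?E I ?T"
  proof (rule indep_familyI)
    fix a p assume a: "\<And>x. x \<in> ?E \<Longrightarrow> (\<Sum>p\<in>I. a p * ?T p x) = 0" and p: "p \<in> I"
    have "(\<Sum>p\<in>I. a p *\<^sub>R ?T p) \<in> ?V"
    proof (rule vanishing_in_spline_space[OF _ box_elements_subset])
      show "(\<Sum>p\<in>I. a p *\<^sub>R ?T p) \<in> spline_space L (\<lambda>_. True)"
        using I by (intro spline_space_sum spline_space_scale thb_spline_in_span) (auto simp: thb_index_def)
      fix e x assume "e \<in> box_elements l r" "x \<in> element e"
      then show "(\<Sum>p\<in>I. a p *\<^sub>R ?T p) x = 0"
        using a[of x] element_subset_region[OF l] by (auto simp: sum_fun_apply scaleR_fun_apply)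
    qed
    from indep_on_box[OF E I this p] p show "a p = 0" by (auto simp: I_def)
  qed
  then have inj: "inj_on (\<lambda>p. restr ?E (?T p)) I" and ind: "independent ((\<lambda>p. restr ?E (?T p)) ` I)"
    using indep_family_iff[OF I(1), of ?E ?T] by blast+
  have sub: "nonvanishing ?E (thb S \<Psi>) \<subseteq> ?T ` I"
  proof
    fix f assume "f \<in> nonvanishing ?E (thb S \<Psi>)"
    then have f: "f \<in> thb S \<Psi>" "restr ?E f \<noteq> 0" by (auto simp: nonvanishing_def)
    then obtain k j where kj: "f = thb_spline k j" "k \<in> levels" "j \<in> spline_index k" "covered k (touched k j)"
      using thb_subset by blast
    obtain x where x: "x \<in> ?E" "f x \<noteq> 0"
      using f(2) by (auto simp: restr_def fun_eq_iff split: if_splits)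
    obtain e where e: "e \<in> box_elements l r" "\<And>i. brk S L i (e i) \<le> x $ i \<and> x $ i < brk S L i (e i + 1)"
      using region_elements[OF q x(1)] by metis
    have "f \<notin> ?V" using spline_space_vanishing[OF L_level _ e(1) _ e(2), of f] x(2) e(1) box_elements_subset by auto
    then have "(k, j) \<in> I" using kj by (auto simp: I_def thb_index_def)
    then show "f \<in> ?T ` I" using kj(1) by force
  qed
  have "inj_on (restr ?E) (?T ` I)" using inj by (auto simp: inj_on_def)
  moreover have "restr ?E ` nonvanishing ?E (thb S \<Psi>) \<subseteq> (\<lambda>p. restr ?E (?T p)) ` I"
    using sub by auto
  ultimately show ?thesis
    unfolding is_overloaded_def using sub ind inj_on_subset real_vector.independent_mono by blast
qed

end

theorem theorem4p1:
  fixes S :: "'n::finite spline_data"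
    and \<eta> :: real
    and \<Psi> :: "nat \<Rightarrow> (real ^ 'n) set"
    and l :: nat
    and r :: "'n \<Rightarrow> nat"
  assumes "spline_hierarchy \<eta> S"
    and "\<forall>i. 1 \<le> deg S i"
    and "domain_hierarchy S \<Psi>"
    and "qbox_compatible S (deg S) \<Psi>"
    and "well_behaved S (deg S) \<Psi> l r \<or> regular S (deg S) \<Psi> l r"
  shows "\<not> is_overloaded (region S (deg S) l r) (thb S \<Psi>)"
proof -
  interpret box_setting S \<eta> \<Psi>
    using assms(1-4) by unfold_locales auto
  show ?thesis using assms(5) by (rule not_overloaded)
qed

end
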